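(* Consider the doubly intractable setting described in the context, let $K\colon(\mathcal{Z}\times\mathcal{X})\times\mathcal{B}(\mathcal{X})\to[0,1]$ be a transition kernel such that the family $(K_z)_{z\in\mathcal{Z}}$, $K_z(x,A)=K(z,x,A)$, is simultaneous Wasserstein contractive (with constants $C,\tau$ and w.r.t. the target distributions $(\pi_z)_{z\in\mathcal{Z}}$), and assume that the bounding functions $\ell,u$ exist with $R^{(\ell,u)}<\infty$. Let $\alpha\ge0$ and let $(X_n,Z_n)_{n\in\mathbb{N}_0}$ be the process generated by the AIR algorithm for doubly intractable problems with $N(t_j)=\lceil j^{1+\alpha}\rceil$ for $j\in\mathbb{N}$ and $N(0)=0$. Assume that $(X_n,Z_n)_{n\in\mathbb{N}_0}$ is metric regular. Then there exists $\widetilde{C}\in(0,\infty)$ (depending on $\alpha,\kappa,\Lambda,\tau,C,R^{(\ell,u)}$) such that \[ \mathbb{E}\left|\widehat{\pi}_n(h)-\pi_{z^*}(h)\right|^2\le3\,\widetilde{C}\,\|h\|_\rho^2\cdot \begin{cases} n^{-\frac{1+\alpha}{2}}(1-\alpha)^{-1} & \alpha\in[0,1),\\ n^{-1}\log(n) & \alpha=1,\\ n^{-1}(\alpha-1)^{-1} & \alpha\in(1,\infty), \end{cases} \] for every $n\in\mathbb{N}$ (with $n\ge3$ in the case $\alpha=1$) and every Lipschitz function $h\colon\mathcal{X}\to\mathbb{R}$ (w.r.t. $\rho$) that is $\pi_z$-integrable for all $z\in\mathcal{Z}\cup\{z^*\}$. Here $\kappa=\sup_{j,k\in\mathbb{N}_0}\mathbb{E}[\mathrm{ecc}_{Z_j}(X_k)^2]$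 and $\Lambda=\sup_{j,k\in\mathbb{N}_0}\mathbb{E}[\mathrm{diff}(Z_j,X_k)]$.
   Context: Doubly intractable setting. $(\mathcal{D},\mathcal{F}_{\mathcal{D}},\mu)$ is a probability space, $\bar y\in\mathcal{D}$ is fixed, $(\mathcal{X},\rho)$ is a metric space that is Polish, with Borel $\sigma$-algebra $\mathcal{B}(\mathcal{X})$, $\nu$ is a probability measure on $\mathcal{X}$, and $E\colon\mathcal{D}\times\mathcal{X}\to\mathbb{R}$ is measurable. Standing assumption: for all $\varepsilon>0$ and $x\in\mathcal{X}$ there is $\delta>0$ such that for all $x'\in\mathcal{X}$, $\rho(x,x')<\delta$ implies $\sup_{y\in\mathcal{D}}|\exp(-E(y,x))-\exp(-E(y,x'))|<\varepsilon$. Put $z^*(x)=\int_{\mathcal{D}}\exp(-E(y,x))\,\mu(dy)\in(0,\infty)$. $\mathcal{P}$ is a set of probability measures on $\mathcal{D}$ containing all $\frac1N\sum_{j=1}^N\delta_{y_j}$, $N\in\mathbb{N}$, $y_1,\dots,y_N\in\mathcal{D}$, and $\mathcal{Z}$ is the set of functions $z\colon\mathcal{X}\to(0,\infty)$ of the form $z(x)=\int_{\mathcal{D}}\exp(-E(y,x))\,\gamma(dy)$ with $\gamma\in\mathcal{P}$, equipped with a suitable $\sigma$-algebra. For $z\in\mathcal{Z}\cup\{z^*\}$, $\pi_z(dx)=\frac{\exp(-E(\bar y,x))}{C_z\,z(x)}\nu(dx)$ with $C_z=\int_{\mathcal{X}}\exp(-E(\bar y,x))z(x)^{-1}\nu(dx)$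 (so that $\pi_z$ is a probability measure). Bounding functions. $\ell,u\colon\mathcal{X}\to(0,\infty)$ are functions with $\ell(x)\le\exp(-E(y,x))\le u(x)$ for all $(y,x)\in\mathcal{D}\times\mathcal{X}$. For $x_0\in\mathcal{X}$, \[ R_1(x_0)=\frac{\int_{\mathcal{X}}\rho(x,x_0)^2\exp(-E(\bar y,x))\,\ell(x)^{-1}\nu(dx)}{\int_{\mathcal{X}}\exp(-E(\bar y,x'))\,u(x')^{-1}\nu(dx')},\qquad R^{(\ell,u)}=\inf_{x_0\in\mathcal{X}}\int_{\mathcal{X}}\left(\rho(x_0,x)^2+R_1(x_0)\right)\frac{u(x)^2}{\ell(x)^2}\,\pi_{z^*}(dx). \] Algorithm. Put $t_j=j(j+1)/2$, $t_0=0$; $N\colon\{0,t_1,t_2,\dots\}\to\mathbb{N}\cup\{0\}$ is increasing. $X_0$ is drawn from an initial distribution, $Z_0\in\mathcal{Z}$ from a transition kernel given $X_0$, and $X_1\sim K(Z_0,X_0,\cdot)$. For $n\in\mathbb{N}$, given $X_0,\dots,X_n$ and $Z_0,\dots,Z_{n-1}$: if $n=t_j$ for some $j\in\mathbb{N}$, sample $Y_{N(t_{j-1})+1},\dots,Y_{N(t_j)}$ iid from $\mu$ (all $Y_k$ iid) and set $Z_n(x)=\frac1{N(n)}\sum_{k=1}^{N(n)}\exp(-E(Y_k,x))$; otherwise set $Z_n=Z_{n-1}$. Then sample $X_{n+1}\sim K(Z_n,X_n,\cdot)$ (conditionally on the whole past). Further $\widehat{\pi}_n(h)=\frac1n\sum_{j=1}^nh(X_j)$.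 Metric notions. $\|h\|_\rho=\sup_{x\ne y}|h(x)-h(y)|/\rho(x,y)$; $W(\mu_1,\mu_2)=\inf_\xi\int\rho\,d\xi$ over couplings $\xi$ of $\mu_1,\mu_2$; $\tau(K_z^k)=\sup_{x_1\ne x_2}W(K_z^k(x_1,\cdot),K_z^k(x_2,\cdot))/\rho(x_1,x_2)$, where $K_z^k$ is the $k$-fold product of $K_z$; $\mathrm{ecc}_z(x)=\int\rho(x,x')\pi_z(dx')$; $\mathrm{diff}(z,x)=\int\int\rho(x_1,x_2)^2K_z(x,dx_1)K_z(x,dx_2)$. $(K_z)_{z\in\mathcal{Z}}$ is simultaneous Wasserstein contractive if there are $C\in(0,\infty)$, $\tau\in[0,1)$, $k_0\in\mathbb{N}$ such that for every $z\in\mathcal{Z}$ the invariant distribution of $K_z$ is $\pi_z$, $\tau(K_z)\le C$ and $\tau(K_z^{k_0})\le\tau$ ($k_0$ taken smallest possible). $(X_n,Z_n)$ is metric regular if $\sup_{j,k\in\mathbb{N}_0}\mathbb{E}[\mathrm{ecc}_{Z_j}(X_k)^2]<\infty$ and $\sup_{j,k\in\mathbb{N}_0}\mathbb{E}[\mathrm{diff}(Z_j,X_k)]<\infty$.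
   Formalization: The constant may also depend on k_0 from simultaneous Wasserstein contractivity; without k_0 the claimed dependence fails (lazy kernels, fixed C=1, τ=1/2, κ, Λ, R, with k_0→∞). The underlying spaces are fixed before the constant is chosen. *)

theory Defs
  imports "HOL-Probability.Probability"
begin

section \<open>Metric notions\<close>

definition lip_norm :: "('x::metric_space \<Rightarrow> real) \<Rightarrow> ennreal" where
  "lip_norm h = (SUP (x, y)\<in>{(x, y). x \<noteq> y}. ennreal (\<bar>h x - h y\<bar> / dist x y))"

definition couplings :: "'x measure \<Rightarrow> 'x measure \<Rightarrow> ('x \<times> 'x) measure set" where
  "couplings \<mu>1 \<mu>2 =
     {\<xi>. sets \<xi> = sets (\<mu>1 \<Otimes>\<^sub>M \<mu>2) \<and> distr \<xi> \<mu>1 fst = \<mu>1 \<and> distr \<xi> \<mu>2 snd = \<mu>2}"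

definition wasserstein :: "'x::metric_space measure \<Rightarrow> 'x measure \<Rightarrow> ennreal" where
  "wasserstein \<mu>1 \<mu>2 = (INF \<xi>\<in>couplings \<mu>1 \<mu>2. \<integral>\<^sup>+(x, y). ennreal (dist x y) \<partial>\<xi>)"

primrec kernel_power :: "('x::metric_space \<Rightarrow> 'x measure) \<Rightarrow> nat \<Rightarrow> 'x \<Rightarrow> 'x measure" where
  "kernel_power Q 0 = (\<lambda>x. return borel x)"
| "kernel_power Q (Suc k) = (\<lambda>x. Q x \<bind> kernel_power Q k)"

definition ergodicity_coeff :: "('x::metric_space \<Rightarrow> 'x measure) \<Rightarrow> ennreal" where
  "ergodicity_coeff Q =
     (SUP (x1, x2)\<in>{(x1, x2). x1 \<noteq> x2}. wasserstein (Q x1) (Q x2) / ennreal (dist x1 x2))"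


section \<open>Doubly intractable distributions\<close>

text \<open>
  The probability space \<open>\<D>\<close> is \<open>\<mu>\<close>, with carrier \<open>space \<mu>\<close> and \<open>\<sigma>\<close>-algebra \<open>sets \<mu>\<close>.  The space
  \<open>\<X>\<close> is the type \<open>'x\<close> with its Borel \<open>\<sigma>\<close>-algebra and \<open>\<rho> = dist\<close>.
\<close>

definition mixture :: "('d \<Rightarrow> 'x \<Rightarrow> real) \<Rightarrow> 'd measure \<Rightarrow> 'x \<Rightarrow> real" where
  "mixture E \<gamma> = (\<lambda>x. \<integral>y. exp (- E y x) \<partial>\<gamma>)"

text \<open>The empirical measure \<open>(1/N) \<Sum>\<^sub>j \<delta>\<^bsub>y j\<^esub>\<close>, \<open>j = 1, \<dots>, N\<close>, is the law of \<open>y j\<close> for a uniformly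
  distributed index \<open>j\<close>.\<close>

definition empirical_measure :: "'d measure \<Rightarrow> nat \<Rightarrow> (nat \<Rightarrow> 'd) \<Rightarrow> 'd measure" where
  "empirical_measure \<mu> N y = distr (uniform_count_measure {1..N}) \<mu> y"

definition norm_funs :: "('d \<Rightarrow> 'x \<Rightarrow> real) \<Rightarrow> 'd measure set \<Rightarrow> ('x \<Rightarrow> real) set" where
  "norm_funs E P =
     {z. \<exists>\<gamma>\<in>P. z = mixture E \<gamma> \<and> (\<forall>x. integrable \<gamma> (\<lambda>y. exp (- E y x)) \<and> 0 < z x)}"

definition norm_const :: "'x measure \<Rightarrow> ('d \<Rightarrow> 'x \<Rightarrow> real) \<Rightarrow> 'd \<Rightarrow> ('x \<Rightarrow> real) \<Rightarrow> ennreal" where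
  "norm_const \<nu> E ybar z = (\<integral>\<^sup>+x. ennreal (exp (- E ybar x) / z x) \<partial>\<nu>)"

definition target :: "'x measure \<Rightarrow> ('d \<Rightarrow> 'x \<Rightarrow> real) \<Rightarrow> 'd \<Rightarrow> ('x \<Rightarrow> real) \<Rightarrow> 'x measure" where
  "target \<nu> E ybar z =
     density \<nu> (\<lambda>x. ennreal (exp (- E ybar x) / z x) / norm_const \<nu> E ybar z)"

text \<open>
  \<open>MZ\<close> is the set \<open>norm_funs E P\<close> with some \<open>\<sigma>\<close>-algebra for which evaluation \<open>(z, x) \<mapsto> z x\<close> is
  jointly measurable.  Polishness is required of the topology only: the metric \<open>dist\<close> itself
  need not be complete.  Separability of \<open>\<X>\<close> is the sort constraint \<open>second_countable_topology\<close>.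
\<close>

definition doubly_intractable ::
  "'d measure \<Rightarrow> 'd \<Rightarrow> 'x::{metric_space, second_countable_topology} measure \<Rightarrow>
   ('d \<Rightarrow> 'x \<Rightarrow> real) \<Rightarrow> 'd measure set \<Rightarrow> ('x \<Rightarrow> real) measure \<Rightarrow> bool" where
  "doubly_intractable \<mu> ybar \<nu> E P MZ \<longleftrightarrow>
     prob_space \<mu> \<and> ybar \<in> space \<mu> \<and>
     completely_metrizable_space (euclidean :: 'x topology) \<and>
     prob_space \<nu> \<and> sets \<nu> = sets borel \<and>
     (\<lambda>(y, x). E y x) \<in> borel_measurable (\<mu> \<Otimes>\<^sub>M borel) \<and>
     (\<forall>\<epsilon>>0. \<forall>x. \<exists>\<delta>>0. \<forall>x'. dist x x' < \<delta> \<longrightarrow>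
        (SUP y\<in>space \<mu>. ennreal \<bar>exp (- E y x) - exp (- E y x')\<bar>) < ennreal \<epsilon>) \<and>
     (\<forall>x. integrable \<mu> (\<lambda>y. exp (- E y x)) \<and> 0 < mixture E \<mu> x) \<and>
     (\<forall>\<gamma>\<in>P. prob_space \<gamma> \<and> sets \<gamma> = sets \<mu>) \<and>
     (\<forall>N\<ge>1. \<forall>y. (\<forall>j\<in>{1..N}. y j \<in> space \<mu>) \<longrightarrow> empirical_measure \<mu> N y \<in> P) \<and>
     space MZ = norm_funs E P \<and>
     (\<lambda>(z, x). z x) \<in> borel_measurable (MZ \<Otimes>\<^sub>M borel) \<and>
     (\<forall>z\<in>norm_funs E P \<union> {mixture E \<mu>}. prob_space (target \<nu> E ybar z))"

definition bounding_funs ::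
  "'d measure \<Rightarrow> ('d \<Rightarrow> 'x::metric_space \<Rightarrow> real) \<Rightarrow> ('x \<Rightarrow> real) \<Rightarrow> ('x \<Rightarrow> real) \<Rightarrow> bool" where
  "bounding_funs \<mu> E l u \<longleftrightarrow>
     l \<in> borel_measurable borel \<and> u \<in> borel_measurable borel \<and>
     (\<forall>x. 0 < l x \<and> 0 < u x) \<and>
     (\<forall>y\<in>space \<mu>. \<forall>x. l x \<le> exp (- E y x) \<and> exp (- E y x) \<le> u x)"

definition bound_R1 ::
  "'x::metric_space measure \<Rightarrow> ('d \<Rightarrow> 'x \<Rightarrow> real) \<Rightarrow> 'd \<Rightarrow> ('x \<Rightarrow> real) \<Rightarrow> ('x \<Rightarrow> real) \<Rightarrow> 'x \<Rightarrow> ennreal"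
where
  "bound_R1 \<nu> E ybar l u x0 =
     (\<integral>\<^sup>+x. ennreal ((dist x x0)\<^sup>2 * exp (- E ybar x) / l x) \<partial>\<nu>) /
     (\<integral>\<^sup>+x. ennreal (exp (- E ybar x) / u x) \<partial>\<nu>)"

definition bound_R ::
  "'d measure \<Rightarrow> 'x::metric_space measure \<Rightarrow> ('d \<Rightarrow> 'x \<Rightarrow> real) \<Rightarrow> 'd \<Rightarrow>
   ('x \<Rightarrow> real) \<Rightarrow> ('x \<Rightarrow> real) \<Rightarrow> ennreal" where
  "bound_R \<mu> \<nu> E ybar l u =
     (INF x0. \<integral>\<^sup>+x. (ennreal ((dist x0 x)\<^sup>2) + bound_R1 \<nu> E ybar l u x0) *
        ennreal ((u x)\<^sup>2 / (l x)\<^sup>2) \<partial>target \<nu> E ybar (mixture E \<mu>))"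


section \<open>Simultaneous Wasserstein contractivity and metric regularity\<close>

text \<open>The set \<open>Zs\<close> indexes the kernels, \<open>tgt z\<close> is the target of \<open>K z\<close>.\<close>

definition contraction_bound ::
  "'z set \<Rightarrow> ('z \<Rightarrow> 'x::metric_space \<Rightarrow> 'x measure) \<Rightarrow> real \<Rightarrow> nat \<Rightarrow> bool" where
  "contraction_bound Zs K \<tau> k \<longleftrightarrow>
     1 \<le> k \<and> (\<forall>z\<in>Zs. ergodicity_coeff (kernel_power (K z) k) \<le> ennreal \<tau>)"

definition sim_wasserstein_contractive ::
  "'z set \<Rightarrow> ('z \<Rightarrow> 'x::metric_space measure) \<Rightarrow> ('z \<Rightarrow> 'x \<Rightarrow> 'x measure) \<Rightarrow>
   real \<Rightarrow> real \<Rightarrow> nat \<Rightarrow> bool" where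
  "sim_wasserstein_contractive Zs tgt K C \<tau> k0 \<longleftrightarrow>
     0 < C \<and> 0 \<le> \<tau> \<and> \<tau> < 1 \<and>
     (\<forall>z\<in>Zs. (tgt z \<bind> K z) = tgt z \<and> ergodicity_coeff (K z) \<le> ennreal C) \<and>
     contraction_bound Zs K \<tau> k0 \<and> (\<forall>k<k0. \<not> contraction_bound Zs K \<tau> k)"

definition ecc :: "('z \<Rightarrow> 'x::metric_space measure) \<Rightarrow> 'z \<Rightarrow> 'x \<Rightarrow> ennreal" where
  "ecc tgt z x = (\<integral>\<^sup>+x'. ennreal (dist x x') \<partial>tgt z)"

definition diff_kernel :: "('z \<Rightarrow> 'x::metric_space \<Rightarrow> 'x measure) \<Rightarrow> 'z \<Rightarrow> 'x \<Rightarrow> ennreal" where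
  "diff_kernel K z x = (\<integral>\<^sup>+x1. (\<integral>\<^sup>+x2. ennreal ((dist x1 x2)\<^sup>2) \<partial>K z x) \<partial>K z x)"

definition sup_ecc ::
  "'w measure \<Rightarrow> ('z \<Rightarrow> 'x::metric_space measure) \<Rightarrow> (nat \<Rightarrow> 'w \<Rightarrow> 'x) \<Rightarrow> (nat \<Rightarrow> 'w \<Rightarrow> 'z) \<Rightarrow> ennreal"
where
  "sup_ecc M tgt X Z = (SUP (j, k). \<integral>\<^sup>+\<omega>. (ecc tgt (Z j \<omega>) (X k \<omega>))\<^sup>2 \<partial>M)"

definition sup_diff ::
  "'w measure \<Rightarrow> ('z \<Rightarrow> 'x::metric_space \<Rightarrow> 'x measure) \<Rightarrow> (nat \<Rightarrow> 'w \<Rightarrow> 'x) \<Rightarrow>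
   (nat \<Rightarrow> 'w \<Rightarrow> 'z) \<Rightarrow> ennreal" where
  "sup_diff M K X Z = (SUP (j, k). \<integral>\<^sup>+\<omega>. diff_kernel K (Z j \<omega>) (X k \<omega>) \<partial>M)"

definition metric_regular ::
  "'w measure \<Rightarrow> ('z \<Rightarrow> 'x::metric_space measure) \<Rightarrow> ('z \<Rightarrow> 'x \<Rightarrow> 'x measure) \<Rightarrow>
   (nat \<Rightarrow> 'w \<Rightarrow> 'x) \<Rightarrow> (nat \<Rightarrow> 'w \<Rightarrow> 'z) \<Rightarrow> bool" where
  "metric_regular M tgt K X Z \<longleftrightarrow> sup_ecc M tgt X Z < \<infinity> \<and> sup_diff M K X Z < \<infinity>"


section \<open>The AIR algorithm\<close>

definition air_time :: "nat \<Rightarrow> nat" where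
  "air_time j = j * (j + 1) div 2"

text \<open>The conditional distribution of \<open>V\<close> given the \<open>\<sigma>\<close>-algebra of \<open>F\<close> is \<open>Q \<omega>\<close>.\<close>

definition cond_law ::
  "'w measure \<Rightarrow> 'w measure \<Rightarrow> ('w \<Rightarrow> 'a) \<Rightarrow> 'a measure \<Rightarrow> ('w \<Rightarrow> 'a measure) \<Rightarrow> bool" where
  "cond_law M F V S Q \<longleftrightarrow>
     (\<forall>A\<in>sets S. AE \<omega> in M. real_cond_exp M F (\<lambda>\<omega>. indicator A (V \<omega>)) \<omega> = measure (Q \<omega>) A)"

text \<open>The \<open>\<sigma>\<close>-algebra generated by \<open>X i\<close> for \<open>i < a\<close>, \<open>Z i\<close> for \<open>i < b\<close>, and \<open>Y k\<close> for
  \<open>1 \<le> k \<le> c\<close>.\<close>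

definition air_past ::
  "'w measure \<Rightarrow> 'd measure \<Rightarrow> 'z measure \<Rightarrow> (nat \<Rightarrow> 'w \<Rightarrow> 'x::metric_space) \<Rightarrow>
   (nat \<Rightarrow> 'w \<Rightarrow> 'z) \<Rightarrow> (nat \<Rightarrow> 'w \<Rightarrow> 'd) \<Rightarrow> nat \<Rightarrow> nat \<Rightarrow> nat \<Rightarrow> 'w measure" where
  "air_past M \<mu> MZ X Z Y a b c =
     vimage_algebra (space M)
       (\<lambda>\<omega>. (\<lambda>i\<in>{..<a}. X i \<omega>, \<lambda>i\<in>{..<b}. Z i \<omega>, \<lambda>k\<in>{1..c}. Y k \<omega>))
       ((\<Pi>\<^sub>M i\<in>{..<a}. borel) \<Otimes>\<^sub>M (\<Pi>\<^sub>M i\<in>{..<b}. MZ) \<Otimes>\<^sub>M (\<Pi>\<^sub>M k\<in>{1..c}. \<mu>))"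

text \<open>
  \<open>N\<close> is meaningful only at the times \<open>air_time j\<close>, and \<open>Y k\<close> only for \<open>k \<ge> 1\<close>.  The transition to
  \<open>X (Suc n)\<close> is conditional on everything generated up to time \<open>n\<close>, which includes the
  auxiliary samples drawn up to the last update time not exceeding \<open>n\<close>.
\<close>

definition air_process ::
  "'d measure \<Rightarrow> ('d \<Rightarrow> 'x::metric_space \<Rightarrow> real) \<Rightarrow> ('x \<Rightarrow> real) measure \<Rightarrow>
   (('x \<Rightarrow> real) \<Rightarrow> 'x \<Rightarrow> 'x measure) \<Rightarrow> (nat \<Rightarrow> nat) \<Rightarrow> 'w measure \<Rightarrow>
   (nat \<Rightarrow> 'w \<Rightarrow> 'x) \<Rightarrow> (nat \<Rightarrow> 'w \<Rightarrow> 'x \<Rightarrow> real) \<Rightarrow> (nat \<Rightarrow> 'w \<Rightarrow> 'd) \<Rightarrow> bool" where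
  "air_process \<mu> E MZ K N M X Z Y \<longleftrightarrow>
     prob_space M \<and> mono_on (range air_time) N \<and>
     (\<forall>n. X n \<in> borel_measurable M) \<and> (\<forall>n. Z n \<in> M \<rightarrow>\<^sub>M MZ) \<and>
     prob_space.indep_vars M (\<lambda>_. \<mu>) Y {1..} \<and> (\<forall>k\<ge>1. distr M \<mu> (Y k) = \<mu>) \<and>
     (\<exists>Q. Q \<in> borel \<rightarrow>\<^sub>M prob_algebra MZ \<and>
        cond_law M (vimage_algebra (space M) (X 0) borel) (Z 0) MZ (\<lambda>\<omega>. Q (X 0 \<omega>))) \<and>
     (\<forall>j\<ge>1. prob_space.indep_set M
        (sets (air_past M \<mu> MZ X Z Y (Suc (air_time j)) (air_time j) (N (air_time (j - 1)))))
        (sets (vimage_algebra (space M)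
           (\<lambda>\<omega>. \<lambda>k\<in>{N (air_time (j - 1)) + 1..N (air_time j)}. Y k \<omega>)
           (\<Pi>\<^sub>M k\<in>{N (air_time (j - 1)) + 1..N (air_time j)}. \<mu>)))) \<and>
     (\<forall>n\<ge>1. \<forall>\<omega>\<in>space M. Z n \<omega> =
        (if n \<in> range air_time
         then (\<lambda>x. 1 / real (N n) * (\<Sum>k = 1..N n. exp (- E (Y k \<omega>) x)))
         else Z (n - 1) \<omega>)) \<and>
     (\<forall>n. cond_law M
        (air_past M \<mu> MZ X Z Y (Suc n) (Suc n) (N (Max (range air_time \<inter> {..n}))))
        (X (Suc n)) borel (\<lambda>\<omega>. K (Z n \<omega>) (X n \<omega>)))"

definition air_average :: "(nat \<Rightarrow> 'w \<Rightarrow> 'x) \<Rightarrow> ('x \<Rightarrow> real) \<Rightarrow> nat \<Rightarrow> 'w \<Rightarrow> real" where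
  "air_average X h n \<omega> = 1 / real n * (\<Sum>j = 1..n. h (X j \<omega>))"

end

theory Submission
  imports Defs
begin

text \<open>
  Write \<open>\<pi>\<^sub>z\<close> for \<open>target \<nu> E ybar z\<close> and let \<open>g\<^sub>z = \<Sum>\<^sub>k\<^sub><\<^sub>m (K\<^sub>z\<^sup>k h - \<pi>\<^sub>z h)\<close>.  Then
  \<open>h(X\<^sub>j\<^sub>+\<^sub>1) - \<pi>\<^sub>z\<^sub>* h\<close> is the sum of the martingale increment \<open>g\<^sub>z(X\<^sub>j\<^sub>+\<^sub>1) - K\<^sub>z g\<^sub>z(X\<^sub>j)\<close>, the
  difference \<open>K\<^sub>z g\<^sub>z(X\<^sub>j) - K\<^sub>z g\<^sub>z(X\<^sub>j\<^sub>+\<^sub>1)\<close>, the truncation error \<open>K\<^sub>z\<^sup>m h(X\<^sub>j\<^sub>+\<^sub>1) - \<pi>\<^sub>z h\<close>, and the bias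
  \<open>\<pi>\<^sub>z h - \<pi>\<^sub>z\<^sub>* h\<close>, all at \<open>z = Z\<^sub>j\<close>.  Contractivity makes \<open>g\<^sub>z\<close> Lipschitz uniformly in \<open>z\<close> and \<open>m\<close>.
  The increments are orthogonal with second moments controlled by \<open>\<Lambda>\<close>; the differences
  telescope between updates of \<open>Z\<close>, leaving \<open>O(\<surd>n)\<close> terms controlled by \<open>\<kappa>\<close>; the truncation
  error vanishes as \<open>m\<close> grows.  The bias equals the \<open>\<pi>\<^sub>z\<^sub>*\<close>-mean of \<open>(h - \<pi>\<^sub>z h) (1 - z\<^sup>* / z)\<close> up to sign, so
  its second moment is at most \<open>2 (R + 1) / N\<close> times the squared Lipschitz constant, by the
  variance of an empirical mean; summed over \<open>j\<close>, this gives the rate.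
\<close>

section \<open>Wasserstein contractions\<close>

text \<open>The kernel and its target change with \<open>Z\<close>, which depends on the past.
  Freezing \<open>z\<close> at \<open>Z j\<close> for the step from \<open>X j\<close> to
  \<open>X (Suc j)\<close> keeps the conditional law of the increment exact; the price is that
  estimates are needed at mismatched pairs such as \<open>Z (j - 1)\<close> and \<open>X j\<close>,
  which is where the supremum over all index pairs in \<kappa> enters. Comparing two target
  densities directly would bring in the ratio of their normalising constants; centring
  \<open>h\<close> at its mean under the target of \<open>z\<close> removes it. By time n about sqrt
  n updates have occurred, so about n powr ((1 + \<alpha>) / 2) samples are in use and the root mean
  square bias at time j is at most of order j powr (- (1 + \<alpha>) / 4). Biases at different times
  share samples and cannot be treated as orthogonal, so they are added by Minkowski's inequality.
  The martingale bound is of order 1 / n in any case; capping \<alpha> at 1 in the bias exponent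
  therefore costs nothing, and one bound with exponent - (1 + min 1 \<alpha>) / 2 covers all three
  regimes.\<close>

lemma dist_measurable_coupling:
  fixes \<mu>1 \<mu>2 :: "'x::{metric_space, second_countable_topology} measure"
  assumes "sets \<mu>1 = sets borel" "sets \<mu>2 = sets borel" "\<xi> \<in> couplings \<mu>1 \<mu>2"
  shows "(\<lambda>p. dist (fst p) (snd p)) \<in> borel_measurable \<xi>" "fst \<in> \<xi> \<rightarrow>\<^sub>M \<mu>1" "snd \<in> \<xi> \<rightarrow>\<^sub>M \<mu>2"
proof -
  have s: "sets \<xi> = sets (\<mu>1 \<Otimes>\<^sub>M \<mu>2)"
    using assms(3) by (auto simp: couplings_def)
  then have s': "sets \<xi> = sets (borel \<Otimes>\<^sub>M borel)"
    using assms(1,2) by (metis sets_pair_measure_cong)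
  show "(\<lambda>p. dist (fst p) (snd p)) \<in> borel_measurable \<xi>"
    by (subst measurable_cong_sets[OF s' refl]) measurable
  show "fst \<in> \<xi> \<rightarrow>\<^sub>M \<mu>1" "snd \<in> \<xi> \<rightarrow>\<^sub>M \<mu>2"
    by (subst measurable_cong_sets[OF s refl], measurable)+
qed

text \<open>Optimal couplings are never invoked: a strict bound on the infimum already yields a
  coupling whose cost obeys it.\<close>

lemma wasserstein_lessE:
  fixes \<mu>1 \<mu>2 :: "'x::metric_space measure"
  assumes "wasserstein \<mu>1 \<mu>2 < a"
  obtains \<xi> where "\<xi> \<in> couplings \<mu>1 \<mu>2" "(\<integral>\<^sup>+p. ennreal (dist (fst p) (snd p)) \<partial>\<xi>) < a"
  using assms unfolding wasserstein_def INF_less_iff by (auto simp: case_prod_unfold)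

lemma lipschitz_borel_measurable:
  fixes h :: "'x::metric_space \<Rightarrow> real"
  assumes "L-lipschitz_on UNIV h"
  shows "h \<in> borel_measurable borel"
  using assms by (intro borel_measurable_continuous_onI lipschitz_on_continuous_on)

lemma lipschitz_on_absD:
  fixes h :: "'x::metric_space \<Rightarrow> real"
  assumes "L-lipschitz_on UNIV h"
  shows "\<bar>h x - h y\<bar> \<le> L * dist x y"
  using lipschitz_onD[OF assms, of x y] by (simp add: dist_real_def)

lemma lipschitz_integrable:
  fixes h :: "'x::{metric_space, second_countable_topology} \<Rightarrow> real"
  assumes prob: "prob_space \<pi>" and sets: "sets \<pi> = sets borel"
    and moment: "integrable \<pi> (dist x0)" and h: "L-lipschitz_on UNIV h"
  shows "integrable \<pi> h"
proof -
  interpret prob_space \<pi> by (rule prob)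
  note [measurable_cong] = sets
  have [measurable]: "h \<in> borel_measurable borel" using lipschitz_borel_measurable[OF h] .
  show ?thesis
  proof (rule Bochner_Integration.integrable_bound)
    show "integrable \<pi> (\<lambda>x. \<bar>h x0\<bar> + L * dist x0 x)" using moment by auto
    show "AE x in \<pi>. norm (h x) \<le> norm (\<bar>h x0\<bar> + L * dist x0 x)"
    proof (rule AE_I2)
      fix x show "norm (h x) \<le> norm (\<bar>h x0\<bar> + L * dist x0 x)"
        using lipschitz_on_absD[OF h, of x0 x] by auto
    qed
  qed measurable
qed

text \<open>Along a coupling of finite cost, the values of \<open>h\<close> at the two coordinates
  differ by at most \<open>L\<close> times their distance, which is integrable.\<close>

lemma wasserstein_integrable:
  fixes h :: "'x::{metric_space, second_countable_topology} \<Rightarrow> real"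
  assumes sets: "sets \<mu>1 = sets borel" "sets \<mu>2 = sets borel"
    and h: "L-lipschitz_on UNIV h" and int: "integrable \<mu>1 h"
    and W: "wasserstein \<mu>1 \<mu>2 < \<infinity>"
  shows "integrable \<mu>2 h"
proof -
  have hm: "h \<in> borel_measurable borel" using lipschitz_borel_measurable[OF h] .
  then have hm1[measurable]: "h \<in> borel_measurable \<mu>1" "h \<in> borel_measurable \<mu>2"
    using measurable_cong_sets[OF sets(1) refl] measurable_cong_sets[OF sets(2) refl] by auto
  obtain \<xi> where \<xi>: "\<xi> \<in> couplings \<mu>1 \<mu>2" "(\<integral>\<^sup>+p. ennreal (dist (fst p) (snd p)) \<partial>\<xi>) < \<infinity>"
    using wasserstein_lessE[OF W] .
  note [measurable] = dist_measurable_coupling[OF sets \<xi>(1)]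
  have d: "distr \<xi> \<mu>1 fst = \<mu>1" "distr \<xi> \<mu>2 snd = \<mu>2"
    using \<xi>(1) by (auto simp: couplings_def)
  have i1: "integrable \<xi> (\<lambda>p. h (fst p))"
    using int integrable_distr_eq[of fst \<xi> \<mu>1 h] d by simp
  have i2: "integrable \<xi> (\<lambda>p. dist (fst p) (snd p))"
    using \<xi>(2) by (intro integrableI_bounded) auto
  have "integrable \<xi> (\<lambda>p. h (snd p))"
  proof (rule Bochner_Integration.integrable_bound)
    show "integrable \<xi> (\<lambda>p. \<bar>h (fst p)\<bar> + L * dist (fst p) (snd p))"
      using i1 i2 by auto
    show "AE p in \<xi>. norm (h (snd p)) \<le> norm (\<bar>h (fst p)\<bar> + L * dist (fst p) (snd p))"
    proof (rule AE_I2)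
      fix p show "norm (h (snd p)) \<le> norm (\<bar>h (fst p)\<bar> + L * dist (fst p) (snd p))"
        using lipschitz_on_absD[OF h, of "fst p" "snd p"] by auto
    qed
  qed measurable
  then show ?thesis
    using integrable_distr_eq[of snd \<xi> \<mu>2 h] d by simp
qed

text \<open>The easy half of Kantorovich duality, for a possibly unbounded \<open>h\<close>:
  couplings of cost below \<open>c + e\<close> suffice, and \<open>e\<close> then tends to
  0.\<close>

lemma wasserstein_integral_diff:
  fixes h :: "'x::{metric_space, second_countable_topology} \<Rightarrow> real"
  assumes sets: "sets \<mu>1 = sets borel" "sets \<mu>2 = sets borel"
    and h: "L-lipschitz_on UNIV h" and int: "integrable \<mu>1 h" "integrable \<mu>2 h"
    and W: "wasserstein \<mu>1 \<mu>2 \<le> ennreal c" and c: "0 \<le> c"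
  shows "\<bar>(\<integral>x. h x \<partial>\<mu>1) - (\<integral>x. h x \<partial>\<mu>2)\<bar> \<le> L * c"
proof -
  have L: "0 \<le> L" using h by (rule lipschitz_on_nonneg)
  have bound: "\<bar>(\<integral>x. h x \<partial>\<mu>1) - (\<integral>x. h x \<partial>\<mu>2)\<bar> \<le> L * (c + e)" if e: "0 < e" for e
  proof -
    have "wasserstein \<mu>1 \<mu>2 < ennreal (c + e)"
      using W e c by (metis add.commute ennreal_less_iff le_less_trans less_add_same_cancel2)
    from wasserstein_lessE[OF this] obtain \<xi> where \<xi>: "\<xi> \<in> couplings \<mu>1 \<mu>2"
        "(\<integral>\<^sup>+p. ennreal (dist (fst p) (snd p)) \<partial>\<xi>) < ennreal (c + e)" .
    note [measurable] = dist_measurable_coupling[OF sets \<xi>(1)]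
    have d: "distr \<xi> \<mu>1 fst = \<mu>1" "distr \<xi> \<mu>2 snd = \<mu>2"
      using \<xi>(1) by (auto simp: couplings_def)
    have i1: "integrable \<xi> (\<lambda>p. h (fst p))"
      using int(1) integrable_distr_eq[of fst \<xi> \<mu>1 h] d by simp
    have i2: "integrable \<xi> (\<lambda>p. h (snd p))"
      using int(2) integrable_distr_eq[of snd \<xi> \<mu>2 h] d by simp
    have i3: "integrable \<xi> (\<lambda>p. dist (fst p) (snd p))"
      using \<xi>(2) by (intro integrableI_bounded) (auto intro: less_trans)
    have e1: "(\<integral>x. h x \<partial>\<mu>1) = (\<integral>p. h (fst p) \<partial>\<xi>)"
      using integral_distr[of fst \<xi> \<mu>1 h] d int by simp
    have e2: "(\<integral>x. h x \<partial>\<mu>2) = (\<integral>p. h (snd p) \<partial>\<xi>)"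
      using integral_distr[of snd \<xi> \<mu>2 h] d int by simp
    have "ennreal (\<integral>p. dist (fst p) (snd p) \<partial>\<xi>) < ennreal (c + e)"
      using \<xi>(2) nn_integral_eq_integral[OF i3] by simp
    then have le: "(\<integral>p. dist (fst p) (snd p) \<partial>\<xi>) \<le> c + e"
      using ennreal_less_iff[of "\<integral>p. dist (fst p) (snd p) \<partial>\<xi>" "c + e"] by simp
    have "\<bar>(\<integral>x. h x \<partial>\<mu>1) - (\<integral>x. h x \<partial>\<mu>2)\<bar> = \<bar>\<integral>p. h (fst p) - h (snd p) \<partial>\<xi>\<bar>"
      unfolding e1 e2 using i1 i2 by simp
    also have "\<dots> \<le> (\<integral>p. \<bar>h (fst p) - h (snd p)\<bar> \<partial>\<xi>)" by (rule integral_abs_bound)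
    also have "\<dots> \<le> (\<integral>p. L * dist (fst p) (snd p) \<partial>\<xi>)"
      using i1 i2 i3 by (intro integral_mono) (auto intro: lipschitz_on_absD[OF h])
    also have "\<dots> \<le> L * (c + e)" using le L by (simp add: mult_left_mono)
    finally show ?thesis .
  qed
  \<comment> \<open>The slack is rescaled to \<open>e / L\<close>, hence the separate case
    \<open>L = 0\<close>.\<close>
  then have "\<bar>(\<integral>x. h x \<partial>\<mu>1) - (\<integral>x. h x \<partial>\<mu>2)\<bar> \<le> L * c + e" if "0 < e" for e
  proof (cases "L = 0")
    case True then show ?thesis using bound[of 1] that by simp
  next
    case False
    then have "0 < L" using L by simp
    then have "L * (c + e / L) = L * c + e" by (simp add: distrib_left)
    then show ?thesis using bound[of "e / L"] that \<open>0 < L\<close> by simp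
  qed
  then show ?thesis by (rule field_le_epsilon)
qed

lemma ergodicity_coeff_wasserstein:
  fixes Q :: "'x::metric_space \<Rightarrow> 'x measure"
  assumes "ergodicity_coeff Q \<le> ennreal c" "0 \<le> c" "x \<noteq> y"
  shows "wasserstein (Q x) (Q y) \<le> ennreal (c * dist x y)"
proof -
  have "wasserstein (Q x) (Q y) / ennreal (dist x y) \<le> ergodicity_coeff Q"
    unfolding ergodicity_coeff_def using assms(3)
    by (intro SUP_upper2[of "(x, y)"]) auto
  then have "wasserstein (Q x) (Q y) / ennreal (dist x y) \<le> ennreal c"
    using assms(1) by simp
  then have "wasserstein (Q x) (Q y) / ennreal (dist x y) * ennreal (dist x y)
      \<le> ennreal c * ennreal (dist x y)"
    by (intro mult_right_mono) auto
  also have "wasserstein (Q x) (Q y) / ennreal (dist x y) * ennreal (dist x y) = wasserstein (Q x) (Q y)"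
    using assms(3) by (intro ennreal_divide_times[THEN trans] ) (simp add: ennreal_mult_divide_eq)
  finally show ?thesis using assms(2) by (simp add: ennreal_mult)
qed

text \<open>Fubini for a signed integrand: the nonnegative version is applied to positive and
  negative parts, and integrability under every \<open>N x\<close> lets the inner integral be split
  pointwise.\<close>

lemma integral_bind_kernel:
  fixes f :: "'b \<Rightarrow> real"
  assumes N: "N \<in> M \<rightarrow>\<^sub>M subprob_algebra B"
    and int: "integrable (M \<bind> N) f" and intN: "\<And>x. x \<in> space M \<Longrightarrow> integrable (N x) f"
    and fm[measurable]: "f \<in> borel_measurable B"
  shows "(\<integral>y. f y \<partial>(M \<bind> N)) = (\<integral>x. \<integral>y. f y \<partial>N x \<partial>M)"
proof -
  note N[measurable]
  have part: "integrable M (\<lambda>x. \<integral>y. g y \<partial>N x) \<and>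
      (\<integral>\<^sup>+y. ennreal (g y) \<partial>(M \<bind> N)) = ennreal (\<integral>x. \<integral>y. g y \<partial>N x \<partial>M)"
    if g[measurable]: "g \<in> borel_measurable B" and g0: "\<And>y. 0 \<le> g y" "\<And>y. g y \<le> \<bar>f y\<bar>" for g
  proof -
    have 1: "(\<integral>\<^sup>+y. ennreal (g y) \<partial>(M \<bind> N)) = (\<integral>\<^sup>+x. \<integral>\<^sup>+y. ennreal (g y) \<partial>N x \<partial>M)"
      by (rule nn_integral_bind[OF _ N]) measurable
    have "integrable (N x) g" if "x \<in> space M" for x
    proof (rule Bochner_Integration.integrable_bound[OF intN[OF that]])
      show "g \<in> borel_measurable (N x)"
        using subprob_measurableD(2)[OF N that] g measurable_cong_sets by blast
    qed (use g0 in auto)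
    then have "(\<integral>\<^sup>+y. ennreal (g y) \<partial>N x) = ennreal (\<integral>y. g y \<partial>N x)" if "x \<in> space M" for x
      using that g0 by (intro nn_integral_eq_integral) auto
    then have 2: "(\<integral>\<^sup>+x. \<integral>\<^sup>+y. ennreal (g y) \<partial>N x \<partial>M) = (\<integral>\<^sup>+x. ennreal (\<integral>y. g y \<partial>N x) \<partial>M)"
      by (intro nn_integral_cong) auto
    have m[measurable]: "(\<lambda>x. \<integral>y. g y \<partial>N x) \<in> borel_measurable M"
      by (rule measurable_compose[OF N integral_measurable_subprob_algebra]) measurable
    have "(\<integral>\<^sup>+y. ennreal (g y) \<partial>(M \<bind> N)) \<le> (\<integral>\<^sup>+y. ennreal (norm (f y)) \<partial>(M \<bind> N))"
      using g0 by (intro nn_integral_mono) (auto intro: ennreal_leI)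
    also have "\<dots> < \<infinity>" using int by (simp add: integrable_iff_bounded)
    finally have fin: "(\<integral>\<^sup>+x. ennreal (\<integral>y. g y \<partial>N x) \<partial>M) < \<infinity>" using 1 2 by simp
    have nn: "0 \<le> (\<integral>y. g y \<partial>N x)" for x using g0 by simp
    have i: "integrable M (\<lambda>x. \<integral>y. g y \<partial>N x)"
      using fin nn by (intro integrableI_bounded) auto
    then show ?thesis using 1 2 nn nn_integral_eq_integral[OF i] by auto
  qed
  have p: "integrable M (\<lambda>x. \<integral>y. max (f y) 0 \<partial>N x)"
     "(\<integral>\<^sup>+y. ennreal (max (f y) 0) \<partial>(M \<bind> N)) = ennreal (\<integral>x. \<integral>y. max (f y) 0 \<partial>N x \<partial>M)"
    using part[of "\<lambda>y. max (f y) 0"] by auto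
  have q: "integrable M (\<lambda>x. \<integral>y. max (- f y) 0 \<partial>N x)"
     "(\<integral>\<^sup>+y. ennreal (max (- f y) 0) \<partial>(M \<bind> N)) = ennreal (\<integral>x. \<integral>y. max (- f y) 0 \<partial>N x \<partial>M)"
    using part[of "\<lambda>y. max (- f y) 0"] by auto
  have split: "(\<integral>y. f y \<partial>N x) = (\<integral>y. max (f y) 0 \<partial>N x) - (\<integral>y. max (- f y) 0 \<partial>N x)"
    if "x \<in> space M" for x
  proof -
    have "(\<integral>y. f y \<partial>N x) = (\<integral>y. max (f y) 0 - max (- f y) 0 \<partial>N x)"
      by (intro Bochner_Integration.integral_cong) auto
    then show ?thesis using intN[OF that] by (simp add: Bochner_Integration.integral_diff)
  qed
  have "(\<integral>x. \<integral>y. f y \<partial>N x \<partial>M) = (\<integral>x. (\<integral>y. max (f y) 0 \<partial>N x) - (\<integral>y. max (- f y) 0 \<partial>N x) \<partial>M)"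
    by (intro Bochner_Integration.integral_cong) (auto simp: split)
  also have "\<dots> = (\<integral>x. \<integral>y. max (f y) 0 \<partial>N x \<partial>M) - (\<integral>x. \<integral>y. max (- f y) 0 \<partial>N x \<partial>M)"
    using p q by simp
  also have "\<dots> = (\<integral>y. f y \<partial>(M \<bind> N))"
    unfolding real_lebesgue_integral_def[OF int]
    using p(2) q(2) by (simp add: ennreal_max_0 max.commute)
  finally show "(\<integral>y. f y \<partial>(M \<bind> N)) = (\<integral>x. \<integral>y. f y \<partial>N x \<partial>M)" by simp
qed

section \<open>Geometric decay of the iterated kernel operator\<close>

text \<open>The Markov operator of \<open>Q\<close> on functions. As a Bochner integral it defaults
  to 0 where \<open>h\<close> is not integrable; \<open>lipschitz_integrable_Q\<close> excludes this
  for Lipschitz \<open>h\<close>.\<close>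

definition kernel_avg :: "('x \<Rightarrow> 'y measure) \<Rightarrow> ('y \<Rightarrow> real) \<Rightarrow> 'x \<Rightarrow> real" where
  "kernel_avg Q h x = (\<integral>y. h y \<partial>Q x)"

text \<open>Of the \<open>k = k0 * (k div k0) + k mod k0\<close> steps, each full block of \<open>k0\<close> contributes a
  factor \<open>\<tau>\<close> and the incomplete one at most \<open>max 1 C ^ k0\<close>.\<close>

definition decay :: "real \<Rightarrow> real \<Rightarrow> nat \<Rightarrow> nat \<Rightarrow> real" where
  "decay C \<tau> k0 k = max 1 C ^ k0 * \<tau> ^ (k div k0)"

text \<open>The total of \<open>decay\<close> over all exponents: each power of \<tau> occurs
  \<open>k0\<close> times, which leaves \<open>k0\<close> copies of a geometric series.\<close>

definition poisson_const :: "real \<Rightarrow> real \<Rightarrow> nat \<Rightarrow> real" where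
  "poisson_const C \<tau> k0 = max 1 C ^ k0 * (real k0 / (1 - \<tau>))"

lemma decay_nonneg: "0 \<le> \<tau> \<Longrightarrow> 0 \<le> decay C \<tau> k0 k"
  by (simp add: decay_def)

lemma sum_decay_le:
  assumes "0 \<le> \<tau>" "\<tau> < 1" "1 \<le> k0" "finite I"
  shows "(\<Sum>k\<in>I. decay C \<tau> k0 k) \<le> poisson_const C \<tau> k0"
proof -
  obtain m where m: "I \<subseteq> {..<m}"
    using assms(4) by (auto simp: finite_nat_set_iff_bounded)
  \<comment> \<open>The index set is enlarged to \<open>m\<close> complete blocks of length
    \<open>k0\<close>, so that the exponent is constant on each block.\<close>
  have "(\<Sum>k\<in>I. \<tau> ^ (k div k0)) \<le> (\<Sum>k<m * k0. \<tau> ^ (k div k0))"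
  proof (intro sum_mono2)
    have "m \<le> m * k0" using assms(3) by simp
    then have "{..<m} \<subseteq> {..<m * k0}" by (simp only: lessThan_subset_iff)
    with m show "I \<subseteq> {..<m * k0}" by (rule subset_trans)
  qed (use assms in auto)
  also have "\<dots> = (\<Sum>q<m. \<Sum>k\<in>{q * k0..<q * k0 + k0}. \<tau> ^ (k div k0))"
    by (rule sum.nat_group[symmetric])
  also have "\<dots> = (\<Sum>q<m. \<Sum>k\<in>{q * k0..<q * k0 + k0}. \<tau> ^ q)"
  proof (intro sum.cong refl)
    fix q k assume "k \<in> {q * k0..<q * k0 + k0}"
    then have "k div k0 = q" by (intro div_nat_eqI) (auto simp: mult.commute)
    then show "\<tau> ^ (k div k0) = \<tau> ^ q" by simp
  qed
  also have "\<dots> = real k0 * (\<Sum>q<m. \<tau> ^ q)" by (simp add: sum_distrib_left)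
  also have "\<dots> \<le> real k0 * (1 / (1 - \<tau>))"
  proof (intro mult_left_mono)
    have "(\<Sum>q<m. \<tau> ^ q) \<le> (\<Sum>q. \<tau> ^ q)"
      using assms by (intro sum_le_suminf summable_geometric) auto
    then show "(\<Sum>q<m. \<tau> ^ q) \<le> 1 / (1 - \<tau>)" using assms by (simp add: suminf_geometric)
  qed simp
  finally have "(\<Sum>k\<in>I. \<tau> ^ (k div k0)) \<le> real k0 / (1 - \<tau>)" by simp
  then show ?thesis
    unfolding decay_def poisson_const_def sum_distrib_left[symmetric]
    by (intro mult_left_mono) auto
qed

lemma decay_arbitrarily_small:
  assumes "0 \<le> \<tau>" "\<tau> < 1" "1 \<le> k0" "0 < e"
  shows "\<exists>k. decay C \<tau> k0 k \<le> e"
proof -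
  have "(\<lambda>q. max 1 C ^ k0 * \<tau> ^ q) \<longlonglongrightarrow> max 1 C ^ k0 * 0"
    using assms by (intro tendsto_mult tendsto_const LIMSEQ_power_zero) auto
  then have "\<forall>\<^sub>F q in sequentially. max 1 C ^ k0 * \<tau> ^ q < e"
    using assms(4) order_tendstoD(2) by fastforce
  then obtain q where "max 1 C ^ k0 * \<tau> ^ q < e" by (auto simp: eventually_sequentially)
  then have "decay C \<tau> k0 (q * k0) \<le> e" using assms(3) by (simp add: decay_def)
  then show ?thesis ..
qed

text \<open>One frozen parameter. A single step may expand distances, since \<open>C\<close> may
  exceed 1; only the \<open>k0\<close>-step coefficient is controlled by \<tau>. The assumption
  \<open>moment\<close> makes every Lipschitz function integrable under \<pi>.\<close>

locale contractive_kernel =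
  fixes Q :: "'x::{metric_space, second_countable_topology} \<Rightarrow> 'x measure"
    and \<pi> :: "'x measure" and C \<tau> :: real and k0 :: nat
  assumes Q[measurable]: "Q \<in> borel \<rightarrow>\<^sub>M prob_algebra borel"
    and prob_pi: "prob_space \<pi>" and sets_pi[measurable_cong]: "sets \<pi> = sets borel"
    and invariant: "\<pi> \<bind> Q = \<pi>"
    and moment: "\<And>x. integrable \<pi> (dist x)"
    and C_pos: "0 < C" and tau_nonneg: "0 \<le> \<tau>" and k0_pos: "1 \<le> k0"
    and coeff1: "ergodicity_coeff Q \<le> ennreal C"
    and coeff_k0: "ergodicity_coeff (kernel_power Q k0) \<le> ennreal \<tau>"
begin

lemma prob_Q: "prob_space (Q x)" and sets_Q: "sets (Q x) = sets borel"
  using measurable_space[OF Q, of x] by (auto simp: space_prob_algebra)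

lemma Q_subprob: "Q \<in> borel \<rightarrow>\<^sub>M subprob_algebra borel"
  using Q by (rule measurable_prob_algebraD)

lemma Q_subprob_pi: "Q \<in> \<pi> \<rightarrow>\<^sub>M subprob_algebra borel"
  using Q_subprob measurable_cong_sets[OF sets_pi refl] by blast

lemma kernel_power_measurable: "kernel_power Q k \<in> borel \<rightarrow>\<^sub>M prob_algebra borel"
  by (induction k) (auto intro: measurable_bind_prob_space Q)

lemma sets_kernel_power: "sets (kernel_power Q k x) = sets borel"
  using measurable_space[OF kernel_power_measurable, of x] by (auto simp: space_prob_algebra)

lemma lipschitz_integrable_pi: "L-lipschitz_on UNIV h \<Longrightarrow> integrable \<pi> (h :: 'x \<Rightarrow> real)"
  by (rule lipschitz_integrable[OF prob_pi sets_pi moment])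

text \<open>Invariance gives integrability under \<open>Q x\<close> for \<pi>-almost every
  \<open>x\<close>, hence at some point \<open>x1\<close>. Since \<open>Q x1\<close> and
  \<open>Q x\<close> are at finite Wasserstein distance, every other point follows.\<close>

lemma lipschitz_integrable_Q:
  fixes h :: "'x \<Rightarrow> real"
  assumes h: "L-lipschitz_on UNIV h"
  shows "integrable (Q x) h"
proof -
  interpret prob_space \<pi> by (rule prob_pi)
  have hm[measurable]: "h \<in> borel_measurable borel" using lipschitz_borel_measurable[OF h] .
  have "(\<integral>\<^sup>+x. \<integral>\<^sup>+y. norm (h y) \<partial>Q x \<partial>\<pi>) = (\<integral>\<^sup>+y. norm (h y) \<partial>(\<pi> \<bind> Q))"
    by (rule nn_integral_bind[OF _ Q_subprob_pi, symmetric]) measurable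
  also have "\<dots> < \<infinity>"
    using lipschitz_integrable_pi[OF h] by (simp add: invariant integrable_iff_bounded)
  finally have "(\<integral>\<^sup>+x. \<integral>\<^sup>+y. norm (h y) \<partial>Q x \<partial>\<pi>) \<noteq> \<infinity>" by simp
  moreover have "(\<lambda>x. \<integral>\<^sup>+y. norm (h y) \<partial>Q x) \<in> borel_measurable \<pi>"
    by (rule measurable_compose[OF Q_subprob_pi nn_integral_measurable_subprob_algebra]) measurable
  ultimately have "AE x in \<pi>. (\<integral>\<^sup>+y. norm (h y) \<partial>Q x) \<noteq> \<infinity>"
    by (intro nn_integral_noteq_infinite)
  then have "\<exists>x1. (\<integral>\<^sup>+y. norm (h y) \<partial>Q x1) \<noteq> \<infinity>"
    using eventually_happens'[OF ae_filter_bot] by blast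
  then obtain x1 where "(\<integral>\<^sup>+y. norm (h y) \<partial>Q x1) < \<infinity>" by (auto simp: less_top)
  then have i1: "integrable (Q x1) h"
    unfolding integrable_iff_bounded using hm measurable_cong_sets[OF sets_Q refl] by blast
  show ?thesis
  proof (cases "x = x1")
    case False
    then have "wasserstein (Q x1) (Q x) \<le> ennreal (C * dist x1 x)"
      using C_pos by (intro ergodicity_coeff_wasserstein coeff1) auto
    then have "wasserstein (Q x1) (Q x) < \<infinity>" by (simp add: le_less_trans)
    then show ?thesis using wasserstein_integrable[OF sets_Q sets_Q h i1] by simp
  qed (use i1 in simp)
qed

lemma kernel_avg_lipschitz:
  assumes h: "L-lipschitz_on UNIV h"
  shows "(L * C)-lipschitz_on UNIV (kernel_avg Q h)"
proof (rule lipschitz_onI)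
  fix x y
  show "dist (kernel_avg Q h x) (kernel_avg Q h y) \<le> L * C * dist x y"
  proof (cases "x = y")
    case False
    then have "wasserstein (Q x) (Q y) \<le> ennreal (C * dist x y)"
      using C_pos by (intro ergodicity_coeff_wasserstein coeff1) auto
    from wasserstein_integral_diff[OF sets_Q sets_Q h _ _ this]
    show ?thesis using lipschitz_integrable_Q[OF h] C_pos
      by (simp add: kernel_avg_def dist_real_def mult.assoc)
  qed simp
qed (use lipschitz_on_nonneg[OF h] C_pos in simp)

text \<open>A crude constant that may grow with \<open>k\<close>. It secures integrability of all
  iterates and bounds the incomplete block in \<open>kernel_avg_decay_lipschitz\<close>.\<close>

lemma kernel_avg_pow_lipschitz:
  assumes h: "L-lipschitz_on UNIV h"
  shows "(L * C ^ k)-lipschitz_on UNIV ((kernel_avg Q ^^ k) h)"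
proof (induction k)
  case (Suc k)
  then show ?case using kernel_avg_lipschitz[OF Suc] by (simp add: mult_ac)
qed (use h in simp)

text \<open>Links kernel powers, to which the contraction assumption refers, with iterates of the
  operator. For nonnegative functions the induction needs integrability under a single step only;
  applied to the modulus of \<open>h\<close> it supplies the integrability required by the signed
  induction.\<close>

lemma kernel_power_integrable_avg:
  assumes h: "L-lipschitz_on UNIV h"
  shows "integrable (kernel_power Q k x) h"
    and "(\<integral>y. h y \<partial>kernel_power Q k x) = (kernel_avg Q ^^ k) h x"
proof -
  have nonneg_case: "(\<integral>\<^sup>+y. ennreal (g y) \<partial>kernel_power Q k x) = ennreal ((kernel_avg Q ^^ k) g x)
        \<and> 0 \<le> (kernel_avg Q ^^ k) g x"
    if g: "L-lipschitz_on UNIV g" "\<And>y. 0 \<le> g y" for g x k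
  proof (induction k arbitrary: x)
    case 0
    have [measurable]: "g \<in> borel_measurable borel" using lipschitz_borel_measurable[OF g(1)] .
    show ?case using g by (simp add: nn_integral_return)
  next
    case (Suc k)
    have [measurable]: "g \<in> borel_measurable borel" using lipschitz_borel_measurable[OF g(1)] .
    have meas: "kernel_power Q k \<in> Q x \<rightarrow>\<^sub>M subprob_algebra borel"
      using measurable_prob_algebraD[OF kernel_power_measurable] measurable_cong_sets[OF sets_Q refl]
      by blast
    have "(\<integral>\<^sup>+y. ennreal (g y) \<partial>kernel_power Q (Suc k) x)
        = (\<integral>\<^sup>+y. \<integral>\<^sup>+w. ennreal (g w) \<partial>kernel_power Q k y \<partial>Q x)"
      by (simp, rule nn_integral_bind[OF _ meas]) measurable
    also have "\<dots> = (\<integral>\<^sup>+y. ennreal ((kernel_avg Q ^^ k) g y) \<partial>Q x)" using Suc by simp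
    also have "\<dots> = ennreal (\<integral>y. (kernel_avg Q ^^ k) g y \<partial>Q x)"
      using Suc lipschitz_integrable_Q[OF kernel_avg_pow_lipschitz[OF g(1), of k]]
      by (intro nn_integral_eq_integral) auto
    also have "(\<integral>y. (kernel_avg Q ^^ k) g y \<partial>Q x) = (kernel_avg Q ^^ Suc k) g x"
      by (simp add: kernel_avg_def)
    finally show ?case using Suc by (simp add: kernel_avg_def[of Q "(kernel_avg Q ^^ k) g"])
  qed
  have int: "integrable (kernel_power Q k x) h" for k x
  proof -
    have "(\<integral>\<^sup>+y. ennreal \<bar>h y\<bar> \<partial>kernel_power Q k x) < \<infinity>"
    proof -
      have "L-lipschitz_on UNIV (\<lambda>y. \<bar>h y\<bar>)"
        using h by (auto simp: lipschitz_on_def dist_real_def intro: order_trans[OF abs_triangle_ineq3])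
      then show ?thesis using nonneg_case[of "\<lambda>y. \<bar>h y\<bar>"] by simp
    qed
    then show ?thesis
      unfolding integrable_iff_bounded using lipschitz_borel_measurable[OF h]
        measurable_cong_sets[OF sets_kernel_power refl] by auto
  qed
  show "integrable (kernel_power Q k x) h" by (rule int)
  show "(\<integral>y. h y \<partial>kernel_power Q k x) = (kernel_avg Q ^^ k) h x"
  proof (induction k arbitrary: x)
    case 0
    show ?case using lipschitz_borel_measurable[OF h] by (simp add: integral_return)
  next
    case (Suc k)
    have meas: "kernel_power Q k \<in> Q x \<rightarrow>\<^sub>M subprob_algebra borel"
      using measurable_prob_algebraD[OF kernel_power_measurable] measurable_cong_sets[OF sets_Q refl]
      by blast
    have "(\<integral>y. h y \<partial>kernel_power Q (Suc k) x) = (\<integral>y. \<integral>w. h w \<partial>kernel_power Q k y \<partial>Q x)"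
      using integral_bind_kernel[OF meas, of h] int[of "Suc k" x] int
        lipschitz_borel_measurable[OF h] by simp
    then show ?case using Suc by (simp add: kernel_avg_def)
  qed
qed

lemma kernel_avg_k0_lipschitz:
  assumes h: "L-lipschitz_on UNIV h"
  shows "(L * \<tau>)-lipschitz_on UNIV ((kernel_avg Q ^^ k0) h)"
proof (rule lipschitz_onI)
  fix x y
  show "dist ((kernel_avg Q ^^ k0) h x) ((kernel_avg Q ^^ k0) h y) \<le> L * \<tau> * dist x y"
  proof (cases "x = y")
    case False
    then have "wasserstein (kernel_power Q k0 x) (kernel_power Q k0 y) \<le> ennreal (\<tau> * dist x y)"
      using tau_nonneg by (intro ergodicity_coeff_wasserstein coeff_k0) auto
    from wasserstein_integral_diff[OF sets_kernel_power sets_kernel_power h _ _ this]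
    show ?thesis using kernel_power_integrable_avg[OF h] tau_nonneg
      by (simp add: dist_real_def mult.assoc)
  qed simp
qed (use lipschitz_on_nonneg[OF h] tau_nonneg in simp)

lemma kernel_avg_decay_lipschitz:
  assumes h: "L-lipschitz_on UNIV h"
  shows "(L * decay C \<tau> k0 k)-lipschitz_on UNIV ((kernel_avg Q ^^ k) h)"
proof -
  have q: "(L * \<tau> ^ q)-lipschitz_on UNIV (((kernel_avg Q ^^ k0) ^^ q) h)" for q
  proof (induction q)
    case (Suc q)
    then show ?case using kernel_avg_k0_lipschitz[OF Suc] by (simp add: mult_ac)
  qed (use h in simp)
  have "(kernel_avg Q ^^ k) h = (kernel_avg Q ^^ (k mod k0)) (((kernel_avg Q ^^ k0) ^^ (k div k0)) h)"
  proof -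
    have "kernel_avg Q ^^ k = kernel_avg Q ^^ (k mod k0 + k0 * (k div k0))" by simp
    then show ?thesis by (simp only: funpow_add funpow_mult comp_apply)
  qed
  then have l: "(L * \<tau> ^ (k div k0) * C ^ (k mod k0))-lipschitz_on UNIV ((kernel_avg Q ^^ k) h)"
    using kernel_avg_pow_lipschitz[OF q[of "k div k0"], of "k mod k0"] by simp
  have "C ^ (k mod k0) \<le> max 1 C ^ (k mod k0)"
    using C_pos by (intro power_mono) auto
  also have "\<dots> \<le> max 1 C ^ k0"
    using k0_pos by (intro power_increasing) (auto simp: less_imp_le)
  finally have "L * \<tau> ^ (k div k0) * C ^ (k mod k0) \<le> L * \<tau> ^ (k div k0) * max 1 C ^ k0"
    using lipschitz_on_nonneg[OF h] tau_nonneg by (intro mult_left_mono) auto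
  then show ?thesis
    by (intro lipschitz_on_mono[OF l]) (auto simp: decay_def mult_ac)
qed

lemma integral_kernel_avg_pow:
  assumes h: "L-lipschitz_on UNIV h"
  shows "(\<integral>x. (kernel_avg Q ^^ k) h x \<partial>\<pi>) = (\<integral>x. h x \<partial>\<pi>)"
proof (induction k)
  case (Suc k)
  let ?g = "(kernel_avg Q ^^ k) h"
  note g = kernel_avg_pow_lipschitz[OF h, of k]
  have "(\<integral>x. ?g x \<partial>(\<pi> \<bind> Q)) = (\<integral>x. \<integral>y. ?g y \<partial>Q x \<partial>\<pi>)"
    using integral_bind_kernel[OF Q_subprob_pi, of ?g] lipschitz_integrable_pi[OF g]
      lipschitz_integrable_Q[OF g] lipschitz_borel_measurable[OF g] invariant by simp
  then show ?case using Suc by (simp add: invariant kernel_avg_def[of Q ?g])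
qed simp

text \<open>By invariance the mean of \<open>h\<close> is also the mean of its \<open>k\<close>-th
  iterate, so the deviation is an average of differences of that iterate, and its small Lipschitz
  constant applies. This is where the eccentricity comes from.\<close>

lemma kernel_avg_pow_centered:
  assumes h: "L-lipschitz_on UNIV h"
  shows "\<bar>(kernel_avg Q ^^ k) h x - (\<integral>y. h y \<partial>\<pi>)\<bar> \<le> L * decay C \<tau> k0 k * (\<integral>y. dist x y \<partial>\<pi>)"
proof -
  interpret prob_space \<pi> by (rule prob_pi)
  let ?g = "(kernel_avg Q ^^ k) h"
  note g = kernel_avg_decay_lipschitz[OF h, of k]
  have "?g x - (\<integral>y. h y \<partial>\<pi>) = (\<integral>y. ?g x - ?g y \<partial>\<pi>)"
    using lipschitz_integrable_pi[OF g] by (simp add: integral_kernel_avg_pow[OF h] prob_space)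
  then have "\<bar>?g x - (\<integral>y. h y \<partial>\<pi>)\<bar> \<le> (\<integral>y. \<bar>?g x - ?g y\<bar> \<partial>\<pi>)"
    by (simp add: integral_abs_bound)
  also have "\<dots> \<le> (\<integral>y. L * decay C \<tau> k0 k * dist x y \<partial>\<pi>)"
    using lipschitz_integrable_pi[OF g] moment[of x]
    by (intro integral_mono) (auto intro: lipschitz_on_absD[OF g])
  finally show ?thesis by simp
qed

end

section \<open>Conditional laws and second moments\<close>

text \<open>\<open>cond_law\<close> speaks of one event at a time. It identifies the joint law of
  the past and \<open>V\<close> with the one built from the kernel on rectangles, hence everywhere,
  so the integrand may depend jointly on both.\<close>

lemma cond_law_nn_integral:
  assumes M: "prob_space M" and sub: "subalgebra M F"
    and V[measurable]: "V \<in> M \<rightarrow>\<^sub>M S" and Q: "Q \<in> F \<rightarrow>\<^sub>M prob_algebra S"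
    and law: "cond_law M F V S Q" and f[measurable]: "f \<in> borel_measurable (F \<Otimes>\<^sub>M S)"
  shows "(\<integral>\<^sup>+\<omega>. f (\<omega>, V \<omega>) \<partial>M) = (\<integral>\<^sup>+\<omega>. \<integral>\<^sup>+x. f (\<omega>, x) \<partial>Q \<omega> \<partial>M)"
proof -
  interpret prob_space M by (rule M)
  interpret finite_measure_subalgebra M F
    by unfold_locales (rule sub)
  have sp: "space F = space M" using sub by (simp add: subalgebra_def)
  \<comment> \<open>The first coordinate is the identity, read with the smaller sigma-algebra of
    \<open>F\<close>, so it carries the whole past.\<close>
  define J1 where "J1 = distr M (F \<Otimes>\<^sub>M S) (\<lambda>\<omega>. (\<omega>, V \<omega>))"
  define k where "k = (\<lambda>\<omega>. distr (Q \<omega>) (F \<Otimes>\<^sub>M S) (\<lambda>x. (\<omega>, x)))"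
  have pair[measurable]: "(\<lambda>\<omega>. (\<omega>, V \<omega>)) \<in> M \<rightarrow>\<^sub>M F \<Otimes>\<^sub>M S"
    using measurable_from_subalg[OF sub measurable_ident_sets[OF refl]] by simp
  have "k \<in> F \<rightarrow>\<^sub>M prob_algebra (F \<Otimes>\<^sub>M S)"
    unfolding k_def using Q by measurable
  then have k[measurable]: "k \<in> M \<rightarrow>\<^sub>M subprob_algebra (F \<Otimes>\<^sub>M S)"
    by (intro measurable_prob_algebraD measurable_from_subalg[OF sub])
  have QS: "prob_space (Q \<omega>)" "sets (Q \<omega>) = sets S" if "\<omega> \<in> space M" for \<omega>
    using measurable_space[OF Q, of \<omega>] that sp by (auto simp: space_prob_algebra)
  have nn2: "(\<integral>\<^sup>+z. g z \<partial>(M \<bind> k)) = (\<integral>\<^sup>+\<omega>. \<integral>\<^sup>+x. g (\<omega>, x) \<partial>Q \<omega> \<partial>M)"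
    if [measurable]: "g \<in> borel_measurable (F \<Otimes>\<^sub>M S)" for g :: "_ \<Rightarrow> ennreal"
  proof -
    have "(\<integral>\<^sup>+z. g z \<partial>(M \<bind> k)) = (\<integral>\<^sup>+\<omega>. \<integral>\<^sup>+z. g z \<partial>k \<omega> \<partial>M)"
      by (rule nn_integral_bind[OF _ k]) measurable
    also have "\<dots> = (\<integral>\<^sup>+\<omega>. \<integral>\<^sup>+x. g (\<omega>, x) \<partial>Q \<omega> \<partial>M)"
    proof (intro nn_integral_cong)
      fix \<omega> assume \<omega>: "\<omega> \<in> space M"
      then have "Pair \<omega> \<in> Q \<omega> \<rightarrow>\<^sub>M F \<Otimes>\<^sub>M S"
        using measurable_Pair1'[of \<omega> F S] measurable_cong_sets[OF QS(2)[OF \<omega>] refl] sp by blast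
      then show "(\<integral>\<^sup>+z. g z \<partial>k \<omega>) = (\<integral>\<^sup>+x. g (\<omega>, x) \<partial>Q \<omega>)"
        unfolding k_def by (rule nn_integral_distr) (use that in \<open>simp_all only: measurable_distr_eq1\<close>)
    qed
    finally show ?thesis .
  qed
  have "J1 = M \<bind> k"
  proof (rule measure_eqI_generator_eq[OF Int_stable_pair_measure_generator[of F S],
        where \<Omega> = "space F \<times> space S" and A = "\<lambda>_. space F \<times> space S"])
    show "{a \<times> b |a b. a \<in> sets F \<and> b \<in> sets S} \<subseteq> Pow (space F \<times> space S)"
      by (rule pair_measure_closed)
    show "sets J1 = sigma_sets (space F \<times> space S) {a \<times> b |a b. a \<in> sets F \<and> b \<in> sets S}"
      by (simp add: J1_def sets_pair_measure)
    show "sets (M \<bind> k) = sigma_sets (space F \<times> space S) {a \<times> b |a b. a \<in> sets F \<and> b \<in> sets S}"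
      by (simp add: sets_bind_measurable[OF k not_empty] sets_pair_measure)
    show "emeasure J1 (space F \<times> space S) \<noteq> \<infinity>" for i :: nat
      by (simp add: J1_def emeasure_distr[OF pair])
    fix X assume "X \<in> {a \<times> b |a b. a \<in> sets F \<and> b \<in> sets S}"
    then obtain B A where X: "X = B \<times> A" and B: "B \<in> sets F" and A[measurable]: "A \<in> sets S"
      by auto
    have BM[measurable]: "B \<in> sets M" using sub B by (auto simp: subalgebra_def)
    have i: "integrable M (\<lambda>\<omega>. indicator A (V \<omega>) :: real)"
      by (intro integrable_const_bound[where B = 1] AE_I2) (auto split: split_indicator)
    have "emeasure J1 X = emeasure M ((\<lambda>\<omega>. (\<omega>, V \<omega>)) -` X \<inter> space M)"
      unfolding J1_def X using B by (intro emeasure_distr) auto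
    also have "(\<lambda>\<omega>. (\<omega>, V \<omega>)) -` X \<inter> space M = {\<omega>\<in>space M. \<omega> \<in> B \<and> V \<omega> \<in> A}"
      unfolding X by auto
    also have "emeasure M \<dots> = ennreal (prob {\<omega>\<in>space M. \<omega> \<in> B \<and> V \<omega> \<in> A})"
      by (simp add: emeasure_eq_measure)
    also have "prob {\<omega>\<in>space M. \<omega> \<in> B \<and> V \<omega> \<in> A} = (\<integral>\<omega>\<in>B. indicator A (V \<omega>) \<partial>M)"
    proof -
      have "(\<integral>\<omega>\<in>B. indicator A (V \<omega>) \<partial>M) = (\<integral>\<omega>. (indicator {\<omega>\<in>space M. \<omega> \<in> B \<and> V \<omega> \<in> A} \<omega> :: real) \<partial>M)"
        unfolding set_lebesgue_integral_def
        by (intro Bochner_Integration.integral_cong) (auto split: split_indicator)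
      then show ?thesis by (simp add: Int_absorb2)
    qed
    also have "\<dots> = (\<integral>\<omega>\<in>B. real_cond_exp M F (\<lambda>\<omega>. indicator A (V \<omega>)) \<omega> \<partial>M)"
      by (rule real_cond_exp_intA[OF i B])
    also have "\<dots> = (\<integral>\<omega>\<in>B. measure (Q \<omega>) A \<partial>M)"
    proof -
      have "(\<lambda>\<omega>. measure (Q \<omega>) A) \<in> borel_measurable M"
        by (intro measurable_from_subalg[OF sub] measurable_compose[OF Q]) measurable
      then show ?thesis
        using law A unfolding set_lebesgue_integral_def cond_law_def
        by (intro integral_cong_AE) (auto intro!: borel_measurable_scaleR borel_measurable_cond_exp2)
    qed
    also have "ennreal \<dots> = (\<integral>\<^sup>+\<omega>. indicator B \<omega> * ennreal (measure (Q \<omega>) A) \<partial>M)"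
    proof -
      have m: "(\<lambda>\<omega>. measure (Q \<omega>) A) \<in> borel_measurable M"
        by (intro measurable_from_subalg[OF sub] measurable_compose[OF Q]) measurable
      have "integrable M (\<lambda>\<omega>. indicator B \<omega> *\<^sub>R measure (Q \<omega>) A)"
      proof (rule integrable_const_bound[where B = 1])
        show "AE \<omega> in M. norm (indicator B \<omega> *\<^sub>R measure (Q \<omega>) A) \<le> 1"
          using QS by (intro AE_I2) (auto split: split_indicator simp: prob_space.prob_le_1)
      qed (use m in measurable)
      then show ?thesis unfolding set_lebesgue_integral_def
        by (subst nn_integral_eq_integral[symmetric])
          (auto intro!: nn_integral_cong split: split_indicator)
    qed
    also have "\<dots> = (\<integral>\<^sup>+\<omega>. \<integral>\<^sup>+x. indicator X (\<omega>, x) \<partial>Q \<omega> \<partial>M)"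
    proof (intro nn_integral_cong)
      fix \<omega> assume \<omega>: "\<omega> \<in> space M"
      interpret Q: prob_space "Q \<omega>" by (rule QS[OF \<omega>])
      have "(\<integral>\<^sup>+x. indicator X (\<omega>, x) \<partial>Q \<omega>) = (\<integral>\<^sup>+x. indicator B \<omega> * indicator A x \<partial>Q \<omega>)"
        unfolding X by (intro nn_integral_cong) (auto split: split_indicator)
      also have "\<dots> = indicator B \<omega> * ennreal (measure (Q \<omega>) A)"
        using A QS[OF \<omega>] by (simp add: nn_integral_cmult Q.emeasure_eq_measure)
      finally show "indicator B \<omega> * ennreal (measure (Q \<omega>) A) = (\<integral>\<^sup>+x. indicator X (\<omega>, x) \<partial>Q \<omega>)" by simp
    qed
    also have "\<dots> = (\<integral>\<^sup>+z. indicator X z \<partial>(M \<bind> k))"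
      using B A unfolding X by (intro nn2[symmetric] borel_measurable_indicator) simp
    also have "\<dots> = emeasure (M \<bind> k) X"
    proof (rule nn_integral_indicator)
      have "X \<in> sets (F \<Otimes>\<^sub>M S)" using B A unfolding X by simp
      then show "X \<in> sets (M \<bind> k)"
        by (simp add: sets_bind_measurable[OF k not_empty])
    qed
    finally show "emeasure J1 X = emeasure (M \<bind> k) X" .
  qed auto
  then have "(\<integral>\<^sup>+z. f z \<partial>J1) = (\<integral>\<^sup>+\<omega>. \<integral>\<^sup>+x. f (\<omega>, x) \<partial>Q \<omega> \<partial>M)"
    by (simp add: nn2)
  then show ?thesis unfolding J1_def by (simp add: nn_integral_distr)
qed

text \<open>A vanishing inner mean says that positive and negative parts have equal finite inner
  integrals; the nonnegative disintegration then makes their outer integrals equal.\<close>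

lemma cond_law_integral_zero:
  fixes f :: "'w \<times> 'a \<Rightarrow> real"
  assumes M: "prob_space M" and sub: "subalgebra M F"
    and V[measurable]: "V \<in> M \<rightarrow>\<^sub>M S" and Q: "Q \<in> F \<rightarrow>\<^sub>M prob_algebra S"
    and law: "cond_law M F V S Q" and f[measurable]: "f \<in> borel_measurable (F \<Otimes>\<^sub>M S)"
    and int: "integrable M (\<lambda>\<omega>. f (\<omega>, V \<omega>))"
    and intQ: "\<And>\<omega>. \<omega> \<in> space M \<Longrightarrow> integrable (Q \<omega>) (\<lambda>x. f (\<omega>, x))"
    and zero: "\<And>\<omega>. \<omega> \<in> space M \<Longrightarrow> (\<integral>x. f (\<omega>, x) \<partial>Q \<omega>) = 0"
  shows "(\<integral>\<omega>. f (\<omega>, V \<omega>) \<partial>M) = 0"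
proof -
  have eq: "(\<integral>\<^sup>+x. ennreal (f (\<omega>, x)) \<partial>Q \<omega>) = (\<integral>\<^sup>+x. ennreal (- f (\<omega>, x)) \<partial>Q \<omega>)"
    if "\<omega> \<in> space M" for \<omega>
  proof -
    have "enn2real (\<integral>\<^sup>+x. ennreal (f (\<omega>, x)) \<partial>Q \<omega>) = enn2real (\<integral>\<^sup>+x. ennreal (- f (\<omega>, x)) \<partial>Q \<omega>)"
      using zero[OF that] unfolding real_lebesgue_integral_def[OF intQ[OF that]] by simp
    moreover have "(\<integral>\<^sup>+x. ennreal (f (\<omega>, x)) \<partial>Q \<omega>) \<noteq> \<infinity>" "(\<integral>\<^sup>+x. ennreal (- f (\<omega>, x)) \<partial>Q \<omega>) \<noteq> \<infinity>"
      using real_integrable_def[THEN iffD1, OF intQ[OF that]] by auto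
    ultimately show ?thesis by (metis ennreal_enn2real infinity_ennreal_def top.not_eq_extremum)
  qed
  have "(\<integral>\<^sup>+\<omega>. ennreal (f (\<omega>, V \<omega>)) \<partial>M) = (\<integral>\<^sup>+\<omega>. \<integral>\<^sup>+x. ennreal (f (\<omega>, x)) \<partial>Q \<omega> \<partial>M)"
    by (rule cond_law_nn_integral[OF M sub V Q law]) measurable
  also have "\<dots> = (\<integral>\<^sup>+\<omega>. \<integral>\<^sup>+x. ennreal (- f (\<omega>, x)) \<partial>Q \<omega> \<partial>M)"
    by (intro nn_integral_cong eq)
  also have "\<dots> = (\<integral>\<^sup>+\<omega>. ennreal (- f (\<omega>, V \<omega>)) \<partial>M)"
    by (rule cond_law_nn_integral[OF M sub V Q law, symmetric]) measurable
  finally show ?thesis unfolding real_lebesgue_integral_def[OF int] by simp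
qed

section \<open>Second moments of sums\<close>

text \<open>Cauchy-Schwarz for \<open>sqrt (c i)\<close> and \<open>a i / sqrt (c i)\<close>.
  Division by zero yields 0, so a term of weight 0 must itself vanish.\<close>

lemma sum_square_le_weighted:
  fixes a c :: "'i \<Rightarrow> real"
  assumes c: "\<And>i. i \<in> I \<Longrightarrow> 0 \<le> c i" and z: "\<And>i. i \<in> I \<Longrightarrow> c i = 0 \<Longrightarrow> a i = 0"
  shows "(\<Sum>i\<in>I. a i)\<^sup>2 \<le> (\<Sum>i\<in>I. c i) * (\<Sum>i\<in>I. (a i)\<^sup>2 / c i)"
proof -
  have "(\<Sum>i\<in>I. a i) = (\<Sum>i\<in>I. sqrt (c i) * (a i / sqrt (c i)))"
    by (intro sum.cong) (use c z in auto)
  then have "(\<Sum>i\<in>I. a i)\<^sup>2 \<le> (\<Sum>i\<in>I. (sqrt (c i))\<^sup>2) * (\<Sum>i\<in>I. (a i / sqrt (c i))\<^sup>2)"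
    by (simp only: Cauchy_Schwarz_ineq_sum)
  also have "\<dots> = (\<Sum>i\<in>I. c i) * (\<Sum>i\<in>I. (a i)\<^sup>2 / c i)"
    by (intro arg_cong2[where f = "(*)"] sum.cong) (use c in \<open>auto simp: power_divide\<close>)
  finally show ?thesis .
qed

text \<open>Minkowski's inequality in L2 with prescribed bounds. Taking these bounds as the weights
  in Cauchy-Schwarz makes each term contribute \<open>c i\<close> times the total, and no roots of
  integrals appear.\<close>

lemma nn_integral_sum_square_le:
  fixes a :: "'i \<Rightarrow> 'w \<Rightarrow> real"
  assumes I: "finite I" and a[measurable]: "\<And>i. i \<in> I \<Longrightarrow> a i \<in> borel_measurable M"
    and c: "\<And>i. i \<in> I \<Longrightarrow> 0 \<le> c i"
    and le: "\<And>i. i \<in> I \<Longrightarrow> (\<integral>\<^sup>+\<omega>. ennreal ((a i \<omega>)\<^sup>2) \<partial>M) \<le> ennreal ((c i)\<^sup>2)"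
  shows "(\<integral>\<^sup>+\<omega>. ennreal ((\<Sum>i\<in>I. a i \<omega>)\<^sup>2) \<partial>M) \<le> ennreal ((\<Sum>i\<in>I. c i)\<^sup>2)"
proof -
  \<comment> \<open>A summand with bound 0 vanishes almost everywhere, which makes its zero weight
    admissible.\<close>
  have "AE \<omega> in M. \<forall>i\<in>I. c i = 0 \<longrightarrow> a i \<omega> = 0"
  proof (subst AE_finite_all[OF I], intro ballI)
    fix i assume i: "i \<in> I"
    show "AE \<omega> in M. c i = 0 \<longrightarrow> a i \<omega> = 0"
    proof (cases "c i = 0")
      case True
      then have "(\<integral>\<^sup>+\<omega>. ennreal ((a i \<omega>)\<^sup>2) \<partial>M) = 0" using le[OF i] by simp
      then have "AE \<omega> in M. ennreal ((a i \<omega>)\<^sup>2) = 0"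
        using a[OF i] by (subst (asm) nn_integral_0_iff_AE) auto
      then show ?thesis by eventually_elim (simp add: ennreal_eq_0_iff)
    qed simp
  qed
  then have "AE \<omega> in M. ennreal ((\<Sum>i\<in>I. a i \<omega>)\<^sup>2)
      \<le> (\<Sum>i\<in>I. ennreal ((\<Sum>i\<in>I. c i) / c i) * ennreal ((a i \<omega>)\<^sup>2))"
  proof eventually_elim
    case (elim \<omega>)
    then have "(\<Sum>i\<in>I. a i \<omega>)\<^sup>2 \<le> (\<Sum>i\<in>I. c i) * (\<Sum>i\<in>I. (a i \<omega>)\<^sup>2 / c i)"
      using c by (intro sum_square_le_weighted) auto
    also have "\<dots> = (\<Sum>i\<in>I. (\<Sum>i\<in>I. c i) / c i * (a i \<omega>)\<^sup>2)"
      by (simp add: sum_distrib_left)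
    finally have "ennreal ((\<Sum>i\<in>I. a i \<omega>)\<^sup>2) \<le> ennreal (\<Sum>i\<in>I. (\<Sum>i\<in>I. c i) / c i * (a i \<omega>)\<^sup>2)"
      by (rule ennreal_leI)
    also have "\<dots> = (\<Sum>i\<in>I. ennreal ((\<Sum>i\<in>I. c i) / c i) * ennreal ((a i \<omega>)\<^sup>2))"
    proof -
      have nn: "0 \<le> (\<Sum>i\<in>I. c i) / c i" if "i \<in> I" for i
        using c that by (auto intro!: divide_nonneg_nonneg sum_nonneg)
      have "ennreal (\<Sum>i\<in>I. (\<Sum>i\<in>I. c i) / c i * (a i \<omega>)\<^sup>2)
          = (\<Sum>i\<in>I. ennreal ((\<Sum>i\<in>I. c i) / c i * (a i \<omega>)\<^sup>2))"
        using nn by (intro sum_ennreal[symmetric] mult_nonneg_nonneg) auto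
      also have "\<dots> = (\<Sum>i\<in>I. ennreal ((\<Sum>i\<in>I. c i) / c i) * ennreal ((a i \<omega>)\<^sup>2))"
        using nn by (intro sum.cong[OF refl] ennreal_mult) auto
      finally show ?thesis .
    qed
    finally show ?case .
  qed
  then have "(\<integral>\<^sup>+\<omega>. ennreal ((\<Sum>i\<in>I. a i \<omega>)\<^sup>2) \<partial>M)
      \<le> (\<integral>\<^sup>+\<omega>. (\<Sum>i\<in>I. ennreal ((\<Sum>i\<in>I. c i) / c i) * ennreal ((a i \<omega>)\<^sup>2)) \<partial>M)"
    by (rule nn_integral_mono_AE)
  also have "\<dots> = (\<Sum>i\<in>I. ennreal ((\<Sum>i\<in>I. c i) / c i) * (\<integral>\<^sup>+\<omega>. ennreal ((a i \<omega>)\<^sup>2) \<partial>M))"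
    by (subst nn_integral_sum) (auto intro!: sum.cong nn_integral_cmult)
  also have "\<dots> \<le> (\<Sum>i\<in>I. ennreal ((\<Sum>i\<in>I. c i) / c i) * ennreal ((c i)\<^sup>2))"
    using le by (intro sum_mono mult_left_mono) auto
  also have "\<dots> = (\<Sum>i\<in>I. ennreal ((\<Sum>i\<in>I. c i) * c i))"
    by (intro sum.cong refl) (simp add: ennreal_mult''[symmetric], simp add: power2_eq_square)
  also have "\<dots> = ennreal (\<Sum>i\<in>I. (\<Sum>i\<in>I. c i) * c i)"
    using c by (intro sum_ennreal) (auto intro!: mult_nonneg_nonneg sum_nonneg)
  also have "(\<Sum>i\<in>I. (\<Sum>i\<in>I. c i) * c i) = (\<Sum>i\<in>I. c i)\<^sup>2"
    by (simp add: power2_eq_square sum_distrib_left)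
  finally show ?thesis .
qed

lemma integrable_mult_of_squares:
  fixes f g :: "'w \<Rightarrow> real"
  assumes [measurable]: "f \<in> borel_measurable M" "g \<in> borel_measurable M"
    and "integrable M (\<lambda>\<omega>. (f \<omega>)\<^sup>2)" "integrable M (\<lambda>\<omega>. (g \<omega>)\<^sup>2)"
  shows "integrable M (\<lambda>\<omega>. f \<omega> * g \<omega>)"
proof (rule Bochner_Integration.integrable_bound)
  show "integrable M (\<lambda>\<omega>. (f \<omega>)\<^sup>2 + (g \<omega>)\<^sup>2)" using assms by simp
  show "AE \<omega> in M. norm (f \<omega> * g \<omega>) \<le> norm ((f \<omega>)\<^sup>2 + (g \<omega>)\<^sup>2)"
  proof (rule AE_I2)
    fix \<omega>
    have "2 * \<bar>f \<omega>\<bar> * \<bar>g \<omega>\<bar> \<le> (f \<omega>)\<^sup>2 + (g \<omega>)\<^sup>2"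
      using sum_squares_bound[of "\<bar>f \<omega>\<bar>" "\<bar>g \<omega>\<bar>"] by simp
    then have "\<bar>f \<omega>\<bar> * \<bar>g \<omega>\<bar> \<le> (f \<omega>)\<^sup>2 + (g \<omega>)\<^sup>2"
      using mult_nonneg_nonneg[OF abs_ge_zero[of "f \<omega>"] abs_ge_zero[of "g \<omega>"]] by linarith
    then show "norm (f \<omega> * g \<omega>) \<le> norm ((f \<omega>)\<^sup>2 + (g \<omega>)\<^sup>2)"
      by (simp add: abs_mult)
  qed
qed measurable

lemma integral_square_orthogonal_sum:
  fixes a :: "'i \<Rightarrow> 'w \<Rightarrow> real"
  assumes I: "finite I" and a: "\<And>i. i \<in> I \<Longrightarrow> a i \<in> borel_measurable M"
    and sq: "\<And>i. i \<in> I \<Longrightarrow> integrable M (\<lambda>\<omega>. (a i \<omega>)\<^sup>2)"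
    and orth: "\<And>i j. i \<in> I \<Longrightarrow> j \<in> I \<Longrightarrow> i \<noteq> j \<Longrightarrow> (\<integral>\<omega>. a i \<omega> * a j \<omega> \<partial>M) = 0"
  shows "integrable M (\<lambda>\<omega>. (\<Sum>i\<in>I. a i \<omega>)\<^sup>2)"
    and "(\<integral>\<omega>. (\<Sum>i\<in>I. a i \<omega>)\<^sup>2 \<partial>M) = (\<Sum>i\<in>I. \<integral>\<omega>. (a i \<omega>)\<^sup>2 \<partial>M)"
proof -
  have int: "integrable M (\<lambda>\<omega>. a i \<omega> * a j \<omega>)" if "i \<in> I" "j \<in> I" for i j
    using that by (intro integrable_mult_of_squares a sq)
  have eq: "(\<Sum>i\<in>I. a i \<omega>)\<^sup>2 = (\<Sum>i\<in>I. \<Sum>j\<in>I. a i \<omega> * a j \<omega>)" for \<omega>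
    by (simp add: power2_eq_square sum_product)
  show "integrable M (\<lambda>\<omega>. (\<Sum>i\<in>I. a i \<omega>)\<^sup>2)"
    unfolding eq by (intro Bochner_Integration.integrable_sum int)
  have "(\<integral>\<omega>. (\<Sum>i\<in>I. a i \<omega>)\<^sup>2 \<partial>M) = (\<Sum>i\<in>I. \<Sum>j\<in>I. \<integral>\<omega>. a i \<omega> * a j \<omega> \<partial>M)"
    unfolding eq
    by (subst Bochner_Integration.integral_sum, intro Bochner_Integration.integrable_sum int, assumption+)
      (intro sum.cong refl Bochner_Integration.integral_sum int, assumption+)
  also have "\<dots> = (\<Sum>i\<in>I. \<Sum>j\<in>I. if j = i then \<integral>\<omega>. a i \<omega> * a i \<omega> \<partial>M else 0)"
    by (intro sum.cong refl) (auto simp: orth)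
  also have "\<dots> = (\<Sum>i\<in>I. \<integral>\<omega>. (a i \<omega>)\<^sup>2 \<partial>M)"
    using I by (simp add: power2_eq_square)
  finally show "(\<integral>\<omega>. (\<Sum>i\<in>I. a i \<omega>)\<^sup>2 \<partial>M) = (\<Sum>i\<in>I. \<integral>\<omega>. (a i \<omega>)\<^sup>2 \<partial>M)" .
qed

lemma nn_integral_square_finite_integrable:
  fixes f :: "'w \<Rightarrow> real"
  assumes [measurable]: "f \<in> borel_measurable M" and "(\<integral>\<^sup>+\<omega>. ennreal ((f \<omega>)\<^sup>2) \<partial>M) \<le> ennreal c"
  shows "integrable M (\<lambda>\<omega>. (f \<omega>)\<^sup>2)" "0 \<le> c \<Longrightarrow> (\<integral>\<omega>. (f \<omega>)\<^sup>2 \<partial>M) \<le> c"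
proof -
  show i: "integrable M (\<lambda>\<omega>. (f \<omega>)\<^sup>2)"
    using assms by (intro integrableI_bounded) (auto intro: le_less_trans)
  show "(\<integral>\<omega>. (f \<omega>)\<^sup>2 \<partial>M) \<le> c" if "0 \<le> c"
    using assms(2) nn_integral_eq_integral[OF i] that by simp
qed

text \<open>Jensen's inequality read off from the nonnegativity of the variance; without square
  integrability the right-hand side is infinite.\<close>

lemma (in prob_space) integral_square_le_nn_integral:
  fixes f :: "'a \<Rightarrow> real"
  assumes int: "integrable M f"
  shows "ennreal ((\<integral>x. f x \<partial>M)\<^sup>2) \<le> (\<integral>\<^sup>+x. ennreal ((f x)\<^sup>2) \<partial>M)"
proof (cases "integrable M (\<lambda>x. (f x)\<^sup>2)")
  case True
  have "0 \<le> variance f" by (simp add: integral_nonneg_AE)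
  then have "(\<integral>x. f x \<partial>M)\<^sup>2 \<le> (\<integral>x. (f x)\<^sup>2 \<partial>M)"
    using variance_eq[OF int True] by simp
  then show ?thesis using nn_integral_eq_integral[OF True] by (simp add: ennreal_leI)
next
  case False
  then have "\<not> (\<integral>\<^sup>+x. ennreal ((f x)\<^sup>2) \<partial>M) < \<infinity>"
    using int by (auto simp: integrable_iff_bounded)
  then show ?thesis by (simp add: not_less top_unique)
qed

lemma square_sum4_le:
  fixes a b c d :: real
  shows "(a + b + c + d)\<^sup>2 \<le> 4 * (a\<^sup>2 + b\<^sup>2 + c\<^sup>2 + d\<^sup>2)"
proof -
  have "0 \<le> (a - b)\<^sup>2 + (a - c)\<^sup>2 + (a - d)\<^sup>2 + (b - c)\<^sup>2 + (b - d)\<^sup>2 + (c - d)\<^sup>2" by simp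
  then show ?thesis by (simp add: power2_eq_square algebra_simps)
qed

section \<open>Power sums and update times\<close>

text \<open>The case of exponent 1/2 implies the others: the surplus factor
  \<open>real (Suc j) powr (1 / 2 - p)\<close> is at most \<open>real n powr (1 / 2 - p)\<close>.
  The constant 2 is therefore the same for all \<open>p\<close>.\<close>

lemma sum_powr_neg_le:
  assumes p: "p \<le> 1 / 2"
  shows "(\<Sum>j<n. real (Suc j) powr - p) \<le> 2 * real n powr (1 - p)"
proof (cases "n = 0")
  case False
  have sqrt_sum: "(\<Sum>j<n. real (Suc j) powr - (1 / 2)) \<le> 2 * sqrt (real n)" for n
  proof (induction n)
    case (Suc n)
    let ?a = "sqrt (real n)" and ?b = "sqrt (real (Suc n))"
    have b: "0 < ?b" by simp
    \<comment> \<open>This is equivalent to the statement that passing from \<open>n\<close> to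
      \<open>Suc n\<close> raises \<open>2 * sqrt n\<close> by at least
      \<open>1 / sqrt (Suc n)\<close>.\<close>
    have "2 * ?a * ?b \<le> ?a\<^sup>2 + ?b\<^sup>2" by (rule sum_squares_bound)
    also have "\<dots> = 2 * ?b\<^sup>2 - 1" by simp
    finally have "(2 * ?a + 1 / ?b) * ?b \<le> (2 * ?b) * ?b"
      using b by (simp add: distrib_right power2_eq_square mult.assoc)
    then have "2 * ?a + 1 / ?b \<le> 2 * ?b" using b by (rule mult_right_le_imp_le)
    moreover have "real (Suc n) powr - (1 / 2) = 1 / ?b"
      by (simp only: powr_minus_divide powr_half_sqrt of_nat_0_le_iff)
    ultimately show ?case using Suc by simp
  qed simp
  have "(\<Sum>j<n. real (Suc j) powr - p) \<le> (\<Sum>j<n. real n powr (1 / 2 - p) * real (Suc j) powr - (1 / 2))"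
  proof (intro sum_mono)
    fix j assume "j \<in> {..<n}"
    then have "real (Suc j) powr (1 / 2 - p) \<le> real n powr (1 / 2 - p)"
      using p by (intro powr_mono2) auto
    then have "real (Suc j) powr (1 / 2 - p) * real (Suc j) powr - (1 / 2)
        \<le> real n powr (1 / 2 - p) * real (Suc j) powr - (1 / 2)"
      by (intro mult_right_mono) auto
    then show "real (Suc j) powr - p \<le> real n powr (1 / 2 - p) * real (Suc j) powr - (1 / 2)"
      by (simp add: powr_add[symmetric])
  qed
  also have "\<dots> = real n powr (1 / 2 - p) * (\<Sum>j<n. real (Suc j) powr - (1 / 2))"
    by (simp add: sum_distrib_left)
  also have "\<dots> \<le> real n powr (1 / 2 - p) * (2 * sqrt (real n))"
    using sqrt_sum[of n] by (intro mult_left_mono) auto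
  also have "\<dots> = 2 * (real n powr (1 / 2 - p) * real n powr (1 / 2))" by (simp add: powr_half_sqrt)
  also have "\<dots> = 2 * real n powr (1 - p)" by (simp add: powr_add[symmetric])
  finally show ?thesis .
qed simp

lemma air_time_0 [simp]: "air_time 0 = 0"
  by (simp add: air_time_def)

lemma air_time_Suc: "air_time (Suc j) = air_time j + Suc j"
proof -
  have "Suc j * (Suc j + 1) = j * (j + 1) + Suc j * 2" by (simp add: algebra_simps)
  then show ?thesis unfolding air_time_def by (simp only: div_mult_self2[of 2] zero_neq_numeral) simp
qed

lemma two_air_time: "2 * air_time j = j * (j + 1)"
  by (induction j) (auto simp: air_time_Suc)

lemma air_time_strict_mono: "strict_mono air_time"
  by (rule strict_monoI_Suc) (simp add: air_time_Suc)

lemma air_time_block: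
  obtains i where "air_time i \<le> n" "n < air_time (Suc i)"
proof -
  have "\<exists>i. air_time i \<le> n \<and> n < air_time (Suc i)"
  proof (induction n)
    case 0
    show ?case by (intro exI[of _ 0]) (simp add: air_time_Suc)
  next
    case (Suc n)
    then obtain i where i: "air_time i \<le> n" "n < air_time (Suc i)" by blast
    show ?case
    proof (cases "Suc n < air_time (Suc i)")
      case True
      then show ?thesis using i by (intro exI[of _ i]) simp
    next
      case False
      then show ?thesis using i by (intro exI[of _ "Suc i"]) (simp add: air_time_Suc[of "Suc i"])
    qed
  qed
  then show ?thesis using that by blast
qed

text \<open>The \<open>j\<close>-th update comes at about \<open>j^2 / 2\<close>, so only indices
  with \<open>j^2 \<le> 2 * n\<close> can occur before \<open>n\<close>. The squared form avoids
  roots of naturals.\<close>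

lemma card_air_times_le: "(card (range air_time \<inter> {1..<n}))\<^sup>2 \<le> 2 * n"
proof -
  define J where "J = {j. 1 \<le> j \<and> j\<^sup>2 \<le> 2 * n}"
  have "j \<le> 2 * n" if "j\<^sup>2 \<le> 2 * n" "1 \<le> j" for j :: nat
    using that by (metis le_trans nat_le_iff_add power2_nat_le_imp_le self_le_power pos2)
  then have J: "finite J" by (intro finite_subset[of J "{..2 * n}"]) (auto simp: J_def)
  have "range air_time \<inter> {1..<n} \<subseteq> air_time ` J"
  proof
    fix t assume "t \<in> range air_time \<inter> {1..<n}"
    then obtain j where j: "t = air_time j" "1 \<le> air_time j" "air_time j < n" by auto
    then have "1 \<le> j" by (cases j) auto
    moreover have "j\<^sup>2 \<le> 2 * air_time j" by (simp add: two_air_time power2_eq_square)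
    ultimately show "t \<in> air_time ` J" using j by (auto simp: J_def)
  qed
  then have c: "card (range air_time \<inter> {1..<n}) \<le> card J"
    using J by (meson card_image_le card_mono finite_imageI le_trans)
  have "(card J)\<^sup>2 \<le> 2 * n"
  proof (cases "J = {}")
    case False
    have "J \<subseteq> {1..Max J}" using J by (auto simp: J_def)
    then have "card J \<le> Max J" by (metis card_atLeastAtMost card_mono diff_Suc_1 finite_atLeastAtMost)
    then have "(card J)\<^sup>2 \<le> (Max J)\<^sup>2" by (intro power_mono) auto
    also have "\<dots> \<le> 2 * n" using Max_in[OF J False] by (simp add: J_def)
    finally show ?thesis .
  qed simp
  then show ?thesis using c by (meson le_trans power_mono zero_le)
qed

text \<open>Summation by parts for a potential that varies with \<open>j\<close>: consecutive terms
  meet at the common point \<open>x j\<close>, where only the change from \<open>j - 1\<close> to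
  \<open>j\<close> survives.\<close>

lemma sum_telescope_changing:
  fixes \<phi> :: "nat \<Rightarrow> 'a \<Rightarrow> real"
  assumes "1 \<le> n"
  shows "(\<Sum>j<n. \<phi> j (x j) - \<phi> j (x (Suc j)))
    = \<phi> 0 (x 0) - \<phi> (n - 1) (x n) + (\<Sum>j\<in>{1..<n}. \<phi> j (x j) - \<phi> (j - 1) (x j))"
  using assms
proof (induction n rule: dec_induct)
  case (step n)
  then show ?case by simp
qed simp

lemma powr_square: "(x powr a)\<^sup>2 = x powr (2 * a)" for x a :: real
  by (simp add: power2_eq_square powr_add[symmetric])

section \<open>Perturbation of the target\<close>

lemma inverse_antimono_ennreal:
  fixes a b :: ennreal
  assumes "a \<le> b"
  shows "inverse b \<le> inverse a"
proof (cases "a = 0 \<or> b = top")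
  case False
  then have "b \<noteq> 0" "a \<noteq> top" using assms by (auto simp: top_unique)
  with False obtain x y where "a = ennreal x" "b = ennreal y" "0 < x" "0 < y"
    by (cases a; cases b) (auto simp: ennreal_eq_0_iff not_le)
  then show ?thesis using assms by (simp add: inverse_ennreal le_imp_inverse_le)
qed auto

locale intractable_model =
  fixes \<mu> :: "'d measure" and ybar :: 'd
    and \<nu> :: "'x::{metric_space, second_countable_topology} measure"
    and E :: "'d \<Rightarrow> 'x \<Rightarrow> real" and P :: "'d measure set" and MZ :: "('x \<Rightarrow> real) measure"
    and l u :: "'x \<Rightarrow> real"
  assumes setting: "doubly_intractable \<mu> ybar \<nu> E P MZ"
    and bounds: "bounding_funs \<mu> E l u"
    and R_finite: "bound_R \<mu> \<nu> E ybar l u < \<infinity>"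
begin

abbreviation zstar :: "'x \<Rightarrow> real" where "zstar \<equiv> mixture E \<mu>"

abbreviation tgt :: "('x \<Rightarrow> real) \<Rightarrow> 'x measure" where "tgt \<equiv> target \<nu> E ybar"

abbreviation w :: "'x \<Rightarrow> real" where "w \<equiv> \<lambda>x. exp (- E ybar x)"

lemma setting_facts:
  "prob_space \<mu>" "prob_space \<nu>" "ybar \<in> space \<mu>" "sets \<nu> = sets borel"
  "(\<lambda>(y, x). E y x) \<in> borel_measurable (\<mu> \<Otimes>\<^sub>M borel)"
  "\<forall>x. integrable \<mu> (\<lambda>y. exp (- E y x)) \<and> 0 < mixture E \<mu> x"
  "\<forall>\<gamma>\<in>P. prob_space \<gamma> \<and> sets \<gamma> = sets \<mu>"
  "space MZ = norm_funs E P"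
  "(\<lambda>(z, x). z x) \<in> borel_measurable (MZ \<Otimes>\<^sub>M borel)"
  "\<forall>z\<in>norm_funs E P \<union> {mixture E \<mu>}. prob_space (target \<nu> E ybar z)"
  using setting unfolding doubly_intractable_def by - (elim conjE, assumption)+

lemmas prob_mu = setting_facts(1) and prob_nu = setting_facts(2) and ybar = setting_facts(3)
  and sets_nu[measurable_cong] = setting_facts(4) and E_measurable[measurable] = setting_facts(5)
  and space_MZ = setting_facts(8) and eval_measurable[measurable] = setting_facts(9)

lemma zstar_integrable: "integrable \<mu> (\<lambda>y. exp (- E y x))" and zstar_pos: "0 < zstar x"
  and P_prob: "\<gamma> \<in> P \<Longrightarrow> prob_space \<gamma>" and P_sets: "\<gamma> \<in> P \<Longrightarrow> sets \<gamma> = sets \<mu>"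
  and prob_tgt: "z \<in> norm_funs E P \<union> {zstar} \<Longrightarrow> prob_space (tgt z)"
  using setting_facts(6,7,10) by auto

lemma l_measurable[measurable]: "l \<in> borel_measurable borel"
  and u_measurable[measurable]: "u \<in> borel_measurable borel"
  and l_pos: "0 < l x" and u_pos: "0 < u x"
  and l_le: "y \<in> space \<mu> \<Longrightarrow> l x \<le> exp (- E y x)" and u_ge: "y \<in> space \<mu> \<Longrightarrow> exp (- E y x) \<le> u x"
  using bounds by (simp_all add: bounding_funs_def)

lemma w_measurable[measurable]: "w \<in> borel_measurable borel"
  using measurable_compose[OF measurable_Pair1'[OF ybar] E_measurable] by simp

lemma l_le_u: "l x \<le> u x"
  using l_le[OF ybar] u_ge[OF ybar] by (rule order_trans)

text \<open>An average under a probability measure inherits pointwise bounds. Since \<mu> need not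
  lie in \<open>P\<close>, \<open>zstar\<close> is adjoined explicitly.\<close>

lemma mixture_bounds:
  assumes z: "z \<in> norm_funs E P \<union> {zstar}"
  shows "l x \<le> z x" "z x \<le> u x" "0 < z x" "z \<in> borel_measurable borel"
proof -
  have "\<exists>\<gamma>. prob_space \<gamma> \<and> sets \<gamma> = sets \<mu> \<and> z = mixture E \<gamma> \<and> (\<forall>x. integrable \<gamma> (\<lambda>y. exp (- E y x)))"
  proof (cases "z = zstar")
    case True
    then show ?thesis using prob_mu zstar_integrable by blast
  next
    case False
    then obtain \<gamma> where "\<gamma> \<in> P" "z = mixture E \<gamma>" "\<forall>x. integrable \<gamma> (\<lambda>y. exp (- E y x))"
      using z by (auto simp: norm_funs_def)
    then show ?thesis using P_prob[of \<gamma>] P_sets[of \<gamma>] by blast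
  qed
  then obtain \<gamma> where \<gamma>: "prob_space \<gamma>" "sets \<gamma> = sets \<mu>" "z = mixture E \<gamma>"
      "\<And>x. integrable \<gamma> (\<lambda>y. exp (- E y x))" by blast
  interpret prob_space \<gamma> by (rule \<gamma>)
  note [measurable_cong] = \<gamma>(2)
  have sp: "space \<gamma> = space \<mu>" using \<gamma>(2) by (rule sets_eq_imp_space_eq)
  show "l x \<le> z x" unfolding \<gamma>(3) mixture_def
    using l_le by (intro integral_ge_const \<gamma>(4) AE_I2) (simp add: sp)
  then show "0 < z x" using l_pos less_le_trans by blast
  show "z x \<le> u x" unfolding \<gamma>(3) mixture_def
    using u_ge by (intro integral_le_const \<gamma>(4) AE_I2) (simp add: sp)
  show "z \<in> borel_measurable borel" unfolding \<gamma>(3) mixture_def by measurable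
qed

text \<open>A zero constant would contradict the positivity of the weight. An infinite one would
  make the density, a quotient by infinity, vanish, although \<open>tgt z\<close> is a probability
  measure.\<close>

lemma norm_const_bounds:
  assumes z: "z \<in> norm_funs E P \<union> {zstar}"
  shows "0 < norm_const \<nu> E ybar z" "norm_const \<nu> E ybar z < \<infinity>"
proof -
  interpret nu: prob_space \<nu> by (rule prob_nu)
  interpret t: prob_space "tgt z" by (rule prob_tgt[OF z])
  note [measurable] = mixture_bounds(4)[OF z]
  let ?c = "norm_const \<nu> E ybar z"
  have "?c \<noteq> 0"
  proof
    assume "?c = 0"
    then have "AE x in \<nu>. ennreal (w x / z x) = 0"
      unfolding norm_const_def by (subst (asm) nn_integral_0_iff_AE) auto
    then have "AE x in \<nu>. False"
    proof eventually_elim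
      case (elim x)
      have "0 < w x / z x" by (intro divide_pos_pos mixture_bounds(3)[OF z]) simp
      then show False using elim by (simp add: ennreal_eq_0_iff)
    qed
    then show False by simp
  qed
  then show "0 < ?c" by (simp add: zero_less_iff_neq_zero)
  have "?c \<noteq> \<infinity>"
  proof
    assume "?c = \<infinity>"
    then have "emeasure (tgt z) (space \<nu>) = 0" unfolding target_def
      by (subst emeasure_density) auto
    moreover have "space \<nu> = space (tgt z)" by (simp add: target_def)
    ultimately show False using t.emeasure_space_1 by simp
  qed
  then show "?c < \<infinity>" by (simp add: less_top)
qed

definition zconst :: "('x \<Rightarrow> real) \<Rightarrow> real" where
  "zconst z = enn2real (norm_const \<nu> E ybar z)"

lemma zconst_pos:
  assumes "z \<in> norm_funs E P \<union> {zstar}"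
  shows "0 < zconst z" "norm_const \<nu> E ybar z = ennreal (zconst z)"
  using norm_const_bounds[OF assms] by (auto simp: zconst_def enn2real_positive_iff)

lemma tgt_eq_density:
  assumes z: "z \<in> norm_funs E P \<union> {zstar}"
  shows "tgt z = density \<nu> (\<lambda>x. ennreal (w x / z x / zconst z))"
  unfolding target_def zconst_pos(2)[OF z]
  using zconst_pos(1)[OF z] mixture_bounds(3)[OF z]
  by (intro arg_cong2[where f = density] refl ext divide_ennreal) (auto intro: divide_nonneg_pos less_imp_le)

lemma sets_tgt: "sets (tgt z) = sets borel"
  by (simp add: target_def sets_nu)

lemma tgt_integral:
  fixes f :: "'x \<Rightarrow> real"
  assumes z: "z \<in> norm_funs E P \<union> {zstar}" and f: "f \<in> borel_measurable borel"
  shows "integrable (tgt z) f \<longleftrightarrow> integrable \<nu> (\<lambda>x. w x / z x / zconst z * f x)"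
    and "(\<integral>x. f x \<partial>tgt z) = (\<integral>x. w x / z x / zconst z * f x \<partial>\<nu>)"
proof -
  note [measurable] = mixture_bounds(4)[OF z] f
  have 0: "AE x in \<nu>. 0 \<le> w x / z x / zconst z"
    using zconst_pos(1)[OF z] mixture_bounds(3)[OF z]
    by (auto intro!: divide_nonneg_nonneg less_imp_le)
  show "integrable (tgt z) f \<longleftrightarrow> integrable \<nu> (\<lambda>x. w x / z x / zconst z * f x)"
    unfolding tgt_eq_density[OF z] using 0 by (intro integrable_real_density) measurable
  show "(\<integral>x. f x \<partial>tgt z) = (\<integral>x. w x / z x / zconst z * f x \<partial>\<nu>)"
    unfolding tgt_eq_density[OF z] using 0 by (intro integral_real_density) measurable
qed

lemma tgt_nn_integral:
  assumes z: "z \<in> norm_funs E P \<union> {zstar}" and f[measurable]: "f \<in> borel_measurable borel"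
  shows "(\<integral>\<^sup>+x. f x \<partial>tgt z) = (\<integral>\<^sup>+x. ennreal (w x / z x) * f x \<partial>\<nu>) / norm_const \<nu> E ybar z"
proof -
  note [measurable] = mixture_bounds(4)[OF z]
  have "(\<integral>\<^sup>+x. f x \<partial>tgt z) = (\<integral>\<^sup>+x. ennreal (w x / z x) / norm_const \<nu> E ybar z * f x \<partial>\<nu>)"
    unfolding target_def by (rule nn_integral_density) measurable
  also have "\<dots> = (\<integral>\<^sup>+x. ennreal (w x / z x) * f x / norm_const \<nu> E ybar z \<partial>\<nu>)"
    by (simp add: divide_ennreal_def mult_ac)
  also have "\<dots> = (\<integral>\<^sup>+x. ennreal (w x / z x) * f x \<partial>\<nu>) / norm_const \<nu> E ybar z"
    by (rule nn_integral_divide) measurable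
  finally show ?thesis .
qed

text \<open>The mass of an event is an integral over the state of an expression in
  \<open>z x\<close>, so joint measurability of evaluation on \<open>MZ\<close> passes to
  it.\<close>

lemma tgt_kernel: "tgt \<in> MZ \<rightarrow>\<^sub>M prob_algebra borel"
proof (rule measurable_prob_algebraI)
  interpret nu: prob_space \<nu> by (rule prob_nu)
  show pr: "prob_space (tgt z)" if "z \<in> space MZ" for z
    using that prob_tgt by (simp add: space_MZ)
  have nc[measurable]: "norm_const \<nu> E ybar \<in> borel_measurable MZ"
    unfolding norm_const_def by measurable
  show "tgt \<in> MZ \<rightarrow>\<^sub>M subprob_algebra borel"
  proof (rule measurable_subprob_algebra)
    show "subprob_space (tgt z)" if "z \<in> space MZ" for z
      using pr[OF that] by (rule prob_space_imp_subprob_space)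
    show "sets (tgt z) = sets borel" for z by (rule sets_tgt)
    fix A :: "'x set" assume A[measurable]: "A \<in> sets borel"
    have "emeasure (tgt z) A
        = (\<integral>\<^sup>+x. ennreal (w x / z x) / norm_const \<nu> E ybar z * indicator A x \<partial>\<nu>)"
      if "z \<in> space MZ" for z
    proof -
      have [measurable]: "z \<in> borel_measurable borel"
        using mixture_bounds(4) that by (simp add: space_MZ)
      show ?thesis unfolding target_def by (rule emeasure_density) (auto simp: sets_nu)
    qed
    moreover have "(\<lambda>z. \<integral>\<^sup>+x. ennreal (w x / z x) / norm_const \<nu> E ybar z * indicator A x \<partial>\<nu>)
        \<in> borel_measurable MZ" by measurable
    ultimately show "(\<lambda>z. emeasure (tgt z) A) \<in> borel_measurable MZ"
      by (simp cong: measurable_cong)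
  qed
qed

section \<open>Uniform moments of the targets and the bias\<close>

text \<open>The infimum defining \<open>bound_R\<close> need not be attained, so a centre within 1
  of it is taken; this is the origin of \<open>R + 1\<close>. At this centre \<open>bound_R1\<close>
  is finite, because it is averaged against a factor \<open>u^2 / l^2\<close> that is at least
  1.\<close>

lemma obtain_center:
  obtains x0 r where "0 \<le> r" "bound_R1 \<nu> E ybar l u x0 = ennreal r"
    "(\<integral>\<^sup>+x. ennreal (((dist x0 x)\<^sup>2 + r) * ((u x)\<^sup>2 / (l x)\<^sup>2)) \<partial>tgt zstar)
      \<le> bound_R \<mu> \<nu> E ybar l u + 1"
proof -
  interpret t: prob_space "tgt zstar" using prob_tgt by simp
  note [measurable_cong] = sets_tgt
  let ?\<Phi> = "\<lambda>x0. \<integral>\<^sup>+x. (ennreal ((dist x0 x)\<^sup>2) + bound_R1 \<nu> E ybar l u x0) *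
        ennreal ((u x)\<^sup>2 / (l x)\<^sup>2) \<partial>tgt zstar"
  obtain b where b: "0 \<le> b" "bound_R \<mu> \<nu> E ybar l u = ennreal b"
    using R_finite by (cases "bound_R \<mu> \<nu> E ybar l u") auto
  have b1: "bound_R \<mu> \<nu> E ybar l u + 1 = ennreal (b + 1)" using b by simp
  have "bound_R \<mu> \<nu> E ybar l u < bound_R \<mu> \<nu> E ybar l u + 1"
    unfolding b1 unfolding b(2) using b(1) ennreal_less_iff[of b "b + 1"] by simp
  then obtain x0 where x0: "?\<Phi> x0 < bound_R \<mu> \<nu> E ybar l u + 1"
    unfolding bound_R_def INF_less_iff by blast
  let ?r = "bound_R1 \<nu> E ybar l u x0"
  have "?r = (\<integral>\<^sup>+x. ?r \<partial>tgt zstar)" by (simp add: t.emeasure_space_1)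
  also have "\<dots> \<le> ?\<Phi> x0"
  proof (intro nn_integral_mono)
    fix x
    have "(l x)\<^sup>2 \<le> (u x)\<^sup>2" using l_pos[of x] l_le_u[of x] by (intro power_mono) auto
    then have "1 \<le> (u x)\<^sup>2 / (l x)\<^sup>2" using l_pos[of x] by (simp add: le_divide_eq)
    then have "1 \<le> ennreal ((u x)\<^sup>2 / (l x)\<^sup>2)" by (simp only: ennreal_1[symmetric] ennreal_leI)
    then show "?r \<le> (ennreal ((dist x0 x)\<^sup>2) + ?r) * ennreal ((u x)\<^sup>2 / (l x)\<^sup>2)"
      by (metis add_increasing mult.right_neutral mult_mono order_refl zero_le)
  qed
  also have "\<dots> < \<infinity>" using x0 unfolding b1 by (rule less_trans) simp
  finally obtain r where r: "0 \<le> r" "?r = ennreal r" by (cases ?r) auto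
  show ?thesis
  proof (rule that[OF r])
    have "(\<integral>\<^sup>+x. ennreal (((dist x0 x)\<^sup>2 + r) * ((u x)\<^sup>2 / (l x)\<^sup>2)) \<partial>tgt zstar) = ?\<Phi> x0"
      using r(1) unfolding r(2)
      by (intro nn_integral_cong) (simp only: ennreal_mult ennreal_plus zero_le_power2
          add_nonneg_nonneg divide_nonneg_nonneg)
    then show "(\<integral>\<^sup>+x. ennreal (((dist x0 x)\<^sup>2 + r) * ((u x)\<^sup>2 / (l x)\<^sup>2)) \<partial>tgt zstar)
      \<le> bound_R \<mu> \<nu> E ybar l u + 1" using x0 by simp
  qed
qed

text \<open>Replacing \<open>z\<close> by \<open>l\<close> in the numerator and by \<open>u\<close>
  in the normalising constant can only enlarge the ratio, and removes its dependence on
  \<open>z\<close>.\<close>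

lemma tgt_second_moment:
  assumes z: "z \<in> norm_funs E P \<union> {zstar}"
  shows "(\<integral>\<^sup>+x. ennreal ((dist x0 x)\<^sup>2) \<partial>tgt z) \<le> bound_R1 \<nu> E ybar l u x0"
proof -
  have "(\<integral>\<^sup>+x. ennreal ((dist x0 x)\<^sup>2) \<partial>tgt z)
      = (\<integral>\<^sup>+x. ennreal (w x / z x) * ennreal ((dist x0 x)\<^sup>2) \<partial>\<nu>) / norm_const \<nu> E ybar z"
    by (rule tgt_nn_integral[OF z]) measurable
  also have "\<dots> \<le> (\<integral>\<^sup>+x. ennreal ((dist x x0)\<^sup>2 * w x / l x) \<partial>\<nu>) /
     (\<integral>\<^sup>+x. ennreal (w x / u x) \<partial>\<nu>)"
    unfolding norm_const_def divide_ennreal_def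
  proof (intro mult_mono inverse_antimono_ennreal nn_integral_mono)
    fix x
    have p: "0 < l x" "0 < u x" "l x \<le> z x" "z x \<le> u x" "0 < z x"
      using mixture_bounds[OF z] l_pos u_pos by auto
    have "w x / z x * (dist x0 x)\<^sup>2 \<le> w x / l x * (dist x0 x)\<^sup>2"
      using p by (intro mult_right_mono divide_left_mono) auto
    then show "ennreal (w x / z x) * ennreal ((dist x0 x)\<^sup>2) \<le> ennreal ((dist x x0)\<^sup>2 * w x / l x)"
      using p by (simp add: ennreal_mult[symmetric] dist_commute ennreal_leI mult.commute)
    show "ennreal (w x / u x) \<le> ennreal (w x / z x)"
      using p by (intro ennreal_leI divide_left_mono) auto
  qed auto
  also have "\<dots> = bound_R1 \<nu> E ybar l u x0" by (simp add: bound_R1_def)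
  finally show ?thesis .
qed

lemma tgt_moment:
  assumes z: "z \<in> norm_funs E P \<union> {zstar}"
  shows "integrable (tgt z) (dist x)"
proof -
  interpret t: prob_space "tgt z" by (rule prob_tgt[OF z])
  note [measurable_cong] = sets_tgt
  obtain x0 r where r: "bound_R1 \<nu> E ybar l u x0 = ennreal r" using obtain_center by metis
  have "integrable (tgt z) (\<lambda>x. (dist x0 x)\<^sup>2)"
    using tgt_second_moment[OF z, of x0] r by (intro integrableI_bounded) (auto intro: le_less_trans)
  then have i: "integrable (tgt z) (dist x0)"
    by (rule t.square_integrable_imp_integrable[rotated]) measurable
  show ?thesis
  proof (rule Bochner_Integration.integrable_bound)
    show "integrable (tgt z) (\<lambda>y. dist x x0 + dist x0 y)" using i by simp
    show "AE y in tgt z. norm (dist x y) \<le> norm (dist x x0 + dist x0 y)"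
      by (intro AE_I2) (simp add: dist_triangle)
  qed measurable
qed

lemma tgt_lipschitz_integrable:
  assumes z: "z \<in> norm_funs E P \<union> {zstar}" and h: "L-lipschitz_on UNIV h"
  shows "integrable (tgt z) (h :: 'x \<Rightarrow> real)"
  by (rule lipschitz_integrable[OF prob_tgt[OF z] sets_tgt tgt_moment[OF z] h])

text \<open>Reweighting \<open>tgt zstar\<close> by \<open>zstar / z\<close> gives a multiple of \<open>tgt z\<close>, under which \<open>h\<close> minus
  its \<open>tgt z\<close>-mean integrates to zero.\<close>

lemma tgt_diff_identity:
  fixes h :: "'x \<Rightarrow> real"
  assumes z: "z \<in> norm_funs E P" and h: "L-lipschitz_on UNIV h"
  defines "c \<equiv> \<integral>x. h x \<partial>tgt z"
  shows "integrable (tgt zstar) (\<lambda>x. (h x - c) * (1 - zstar x / z x))"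
    and "(\<integral>x. (h x - c) * (1 - zstar x / z x) \<partial>tgt zstar) = (\<integral>x. h x \<partial>tgt zstar) - c"
proof -
  have z': "z \<in> norm_funs E P \<union> {zstar}" and zs: "zstar \<in> norm_funs E P \<union> {zstar}"
    using z by auto
  interpret t: prob_space "tgt z" by (rule prob_tgt[OF z'])
  interpret s: prob_space "tgt zstar" by (rule prob_tgt[OF zs])
  have hm[measurable]: "h \<in> borel_measurable borel" using lipschitz_borel_measurable[OF h] .
  note [measurable] = mixture_bounds(4)[OF z'] mixture_bounds(4)[OF zs]
  note ht = tgt_lipschitz_integrable[OF z' h] and hs = tgt_lipschitz_integrable[OF zs h]
  \<comment> \<open>\<open>?q\<close> is the total mass of \<open>tgt zstar\<close> reweighted by
    \<open>zstar / z\<close>.\<close>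
  let ?q = "zconst z / zconst zstar"
  have eq: "w x / zstar x / zconst zstar * ((h x - c) * (zstar x / z x))
      = ?q * (w x / z x / zconst z * (h x - c))" for x
    using zstar_pos[of x] mixture_bounds(3)[OF z', of x] zconst_pos(1)[OF z'] zconst_pos(1)[OF zs]
    by (simp add: field_simps)
  have "integrable (tgt z) (\<lambda>x. h x - c)" "(\<integral>x. h x - c \<partial>tgt z) = 0"
    using ht by (auto simp: c_def t.prob_space)
  then have i1: "integrable \<nu> (\<lambda>x. w x / z x / zconst z * (h x - c))"
      and i2: "(\<integral>x. w x / z x / zconst z * (h x - c) \<partial>\<nu>) = 0"
    using tgt_integral[OF z', of "\<lambda>x. h x - c"] by auto
  have "integrable \<nu> (\<lambda>x. ?q * (w x / z x / zconst z * (h x - c)))"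
      "(\<integral>x. ?q * (w x / z x / zconst z * (h x - c)) \<partial>\<nu>) = 0"
    using i1 integrable_mult_right[of ?q \<nu> "\<lambda>x. w x / z x / zconst z * (h x - c)"] i2
      integral_mult_right_zero[of \<nu> ?q "\<lambda>x. w x / z x / zconst z * (h x - c)"] by (blast, metis mult_zero_right)
  moreover have "(\<lambda>x. (h x - c) * (zstar x / z x)) \<in> borel_measurable borel" by measurable
  ultimately have i: "integrable (tgt zstar) (\<lambda>x. (h x - c) * (zstar x / z x))"
    and 0: "(\<integral>x. (h x - c) * (zstar x / z x) \<partial>tgt zstar) = 0"
    by (simp_all only: tgt_integral[OF zs] eq)
  have e: "(h x - c) * (1 - zstar x / z x) = (h x - c) - (h x - c) * (zstar x / z x)" for x
    by (simp add: algebra_simps)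
  show "integrable (tgt zstar) (\<lambda>x. (h x - c) * (1 - zstar x / z x))"
    unfolding e using i hs by auto
  show "(\<integral>x. (h x - c) * (1 - zstar x / z x) \<partial>tgt zstar) = (\<integral>x. h x \<partial>tgt zstar) - c"
    unfolding e using i hs 0 by (simp add: s.prob_space)
qed

text \<open>Jensen applied to \<open>tgt_diff_identity\<close>, with
  \<open>1 - zstar x / z x\<close> bounded in modulus by
  \<open>\<bar>z x - zstar x\<bar> / l x\<close>. In the result \<open>z\<close> occurs only in the
  squared error at \<open>x\<close>, so a random \<open>z\<close> can be averaged out
  pointwise.\<close>

lemma tgt_diff_square_le:
  fixes h :: "'x \<Rightarrow> real"
  assumes z: "z \<in> norm_funs E P" and h: "L-lipschitz_on UNIV h"
    and r: "0 \<le> r" "bound_R1 \<nu> E ybar l u x0 = ennreal r"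
  shows "ennreal (((\<integral>x. h x \<partial>tgt z) - (\<integral>x. h x \<partial>tgt zstar))\<^sup>2)
    \<le> (\<integral>\<^sup>+x. ennreal (2 * L\<^sup>2 * ((dist x0 x)\<^sup>2 + r) / (l x)\<^sup>2 * (z x - zstar x)\<^sup>2) \<partial>tgt zstar)"
proof -
  have z': "z \<in> norm_funs E P \<union> {zstar}" and zs: "zstar \<in> norm_funs E P \<union> {zstar}"
    using z by auto
  interpret t: prob_space "tgt z" by (rule prob_tgt[OF z'])
  interpret s: prob_space "tgt zstar" by (rule prob_tgt[OF zs])
  note [measurable_cong] = sets_tgt
  have hm[measurable]: "h \<in> borel_measurable borel" using lipschitz_borel_measurable[OF h] .
  note ht = tgt_lipschitz_integrable[OF z' h]
  define c where "c = (\<integral>x. h x \<partial>tgt z)"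
  have "ennreal ((c - h x0)\<^sup>2) = ennreal ((\<integral>x. h x - h x0 \<partial>tgt z)\<^sup>2)"
    using ht by (simp add: c_def t.prob_space)
  also have "\<dots> \<le> (\<integral>\<^sup>+x. ennreal ((h x - h x0)\<^sup>2) \<partial>tgt z)"
    using ht by (intro t.integral_square_le_nn_integral) auto
  also have "\<dots> \<le> (\<integral>\<^sup>+x. ennreal (L\<^sup>2) * ennreal ((dist x0 x)\<^sup>2) \<partial>tgt z)"
  proof (intro nn_integral_mono)
    fix x
    have "(h x - h x0)\<^sup>2 \<le> (L * dist x0 x)\<^sup>2"
      using lipschitz_on_absD[OF h, of x x0] by (intro abs_le_square_iff[THEN iffD1])
        (simp add: dist_commute lipschitz_on_nonneg[OF h])
    then show "ennreal ((h x - h x0)\<^sup>2) \<le> ennreal (L\<^sup>2) * ennreal ((dist x0 x)\<^sup>2)"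
      by (simp add: ennreal_mult[symmetric] power_mult_distrib ennreal_leI)
  qed
  also have "\<dots> \<le> ennreal (L\<^sup>2) * ennreal r"
    using tgt_second_moment[OF z', of x0] r by (subst nn_integral_cmult) (auto intro: mult_left_mono)
  finally have c: "(c - h x0)\<^sup>2 \<le> L\<^sup>2 * r" using r by (simp add: ennreal_mult[symmetric])
  have "ennreal ((c - (\<integral>x. h x \<partial>tgt zstar))\<^sup>2)
      = ennreal ((\<integral>x. (h x - c) * (1 - zstar x / z x) \<partial>tgt zstar)\<^sup>2)"
    using tgt_diff_identity(2)[OF z h] by (simp add: c_def power2_commute)
  also have "\<dots> \<le> (\<integral>\<^sup>+x. ennreal (((h x - c) * (1 - zstar x / z x))\<^sup>2) \<partial>tgt zstar)"
    using tgt_diff_identity(1)[OF z h] unfolding c_def by (rule s.integral_square_le_nn_integral)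
  also have "\<dots> \<le> (\<integral>\<^sup>+x. ennreal (2 * L\<^sup>2 * ((dist x0 x)\<^sup>2 + r) / (l x)\<^sup>2 * (z x - zstar x)\<^sup>2) \<partial>tgt zstar)"
  proof (intro nn_integral_mono ennreal_leI)
    fix x
    have p: "0 < l x" "l x \<le> z x" "0 < z x" using mixture_bounds[OF z'] l_pos by auto
    have 1: "(h x - h x0)\<^sup>2 \<le> (L * dist x0 x)\<^sup>2"
      using lipschitz_on_absD[OF h, of x x0] by (intro abs_le_square_iff[THEN iffD1])
        (simp add: dist_commute lipschitz_on_nonneg[OF h])
    \<comment> \<open>Splitting at \<open>h x0\<close> costs the factor 2; one part is controlled by
      the distance to \<open>x0\<close>, the other by the second moment \<open>r\<close>.\<close>
    have "(h x - c)\<^sup>2 \<le> 2 * (h x - h x0)\<^sup>2 + 2 * (c - h x0)\<^sup>2"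
      using sum_squares_ge_zero[of "(h x - h x0) + (c - h x0)" 0]
      by (simp add: power2_eq_square algebra_simps)
    also have "\<dots> \<le> 2 * L\<^sup>2 * ((dist x0 x)\<^sup>2 + r)"
      using 1 c by (simp add: power_mult_distrib algebra_simps)
    finally have 2: "(h x - c)\<^sup>2 \<le> 2 * L\<^sup>2 * ((dist x0 x)\<^sup>2 + r)" .
    have "(1 - zstar x / z x)\<^sup>2 = (z x - zstar x)\<^sup>2 / (z x)\<^sup>2"
      using p by (simp add: power_divide[symmetric] diff_divide_distrib)
    also have "\<dots> \<le> (z x - zstar x)\<^sup>2 / (l x)\<^sup>2"
      using p by (intro divide_left_mono power_mono) auto
    finally have "(h x - c)\<^sup>2 * (1 - zstar x / z x)\<^sup>2
        \<le> (2 * L\<^sup>2 * ((dist x0 x)\<^sup>2 + r)) * ((z x - zstar x)\<^sup>2 / (l x)\<^sup>2)"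
      using 2 r(1) by (intro mult_mono) auto
    then show "((h x - c) * (1 - zstar x / z x))\<^sup>2
        \<le> 2 * L\<^sup>2 * ((dist x0 x)\<^sup>2 + r) / (l x)\<^sup>2 * (z x - zstar x)\<^sup>2"
      by (simp add: power_mult_distrib)
  qed
  finally show ?thesis unfolding c_def .
qed

lemma tgt_integral_measurable:
  fixes h :: "'x \<Rightarrow> real"
  assumes [measurable]: "h \<in> borel_measurable borel"
  shows "(\<lambda>z. \<integral>x. h x \<partial>tgt z) \<in> borel_measurable MZ"
  by (rule measurable_compose[OF measurable_prob_algebraD[OF tgt_kernel] integral_measurable_subprob_algebra])
    measurable

text \<open>Tonelli moves the expectation inside. A variance proportional to \<open>(u x)^2\<close>
  then combines with the factor \<open>1 / (l x)^2\<close> to the integrand of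
  \<open>bound_R\<close>.\<close>

lemma expected_tgt_diff_square_le:
  fixes h :: "'x \<Rightarrow> real" and b :: real
  assumes M: "prob_space M" and Z[measurable]: "Z \<in> M \<rightarrow>\<^sub>M MZ"
    and h: "L-lipschitz_on UNIV h" and b: "0 \<le> b"
    and var: "\<And>x. (\<integral>\<^sup>+\<omega>. ennreal ((Z \<omega> x - zstar x)\<^sup>2) \<partial>M) \<le> ennreal (b * (u x)\<^sup>2)"
  shows "(\<integral>\<^sup>+\<omega>. ennreal (((\<integral>x. h x \<partial>tgt (Z \<omega>)) - (\<integral>x. h x \<partial>tgt zstar))\<^sup>2) \<partial>M)
    \<le> ennreal (2 * L\<^sup>2 * b * (enn2real (bound_R \<mu> \<nu> E ybar l u) + 1))"
proof -
  have zs: "zstar \<in> norm_funs E P \<union> {zstar}" by simp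
  interpret M: prob_space M by (rule M)
  interpret s: prob_space "tgt zstar" by (rule prob_tgt[OF zs])
  interpret ps: pair_sigma_finite M "tgt zstar" ..
  note [measurable_cong] = sets_tgt
  note [measurable] = mixture_bounds(4)[OF zs]
  have [measurable]: "(\<lambda>(\<omega>, x). Z \<omega> x) \<in> borel_measurable (M \<Otimes>\<^sub>M borel)"
    using measurable_compose[OF _ eval_measurable, of "\<lambda>(\<omega>, x). (Z \<omega>, x)" "M \<Otimes>\<^sub>M borel"] by simp
  obtain x0 r where r: "0 \<le> r" "bound_R1 \<nu> E ybar l u x0 = ennreal r"
    "(\<integral>\<^sup>+x. ennreal (((dist x0 x)\<^sup>2 + r) * ((u x)\<^sup>2 / (l x)\<^sup>2)) \<partial>tgt zstar)
      \<le> bound_R \<mu> \<nu> E ybar l u + 1" by (rule obtain_center)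
  let ?a = "\<lambda>x. 2 * L\<^sup>2 * ((dist x0 x)\<^sup>2 + r) / (l x)\<^sup>2"
  have a0: "0 \<le> ?a x" for x using r by simp
  have "(\<integral>\<^sup>+\<omega>. ennreal (((\<integral>x. h x \<partial>tgt (Z \<omega>)) - (\<integral>x. h x \<partial>tgt zstar))\<^sup>2) \<partial>M)
      \<le> (\<integral>\<^sup>+\<omega>. \<integral>\<^sup>+x. ennreal (?a x * (Z \<omega> x - zstar x)\<^sup>2) \<partial>tgt zstar \<partial>M)"
    using measurable_space[OF Z] by (intro nn_integral_mono tgt_diff_square_le h r) (simp add: space_MZ)
  also have "\<dots> = (\<integral>\<^sup>+x. \<integral>\<^sup>+\<omega>. ennreal (?a x * (Z \<omega> x - zstar x)\<^sup>2) \<partial>M \<partial>tgt zstar)"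
    by (rule ps.Fubini'[symmetric]) measurable
  also have "\<dots> \<le> (\<integral>\<^sup>+x. ennreal (2 * L\<^sup>2 * b) * ennreal (((dist x0 x)\<^sup>2 + r) * ((u x)\<^sup>2 / (l x)\<^sup>2)) \<partial>tgt zstar)"
  proof (intro nn_integral_mono)
    fix x
    have "(\<integral>\<^sup>+\<omega>. ennreal (?a x * (Z \<omega> x - zstar x)\<^sup>2) \<partial>M)
        = ennreal (?a x) * (\<integral>\<^sup>+\<omega>. ennreal ((Z \<omega> x - zstar x)\<^sup>2) \<partial>M)"
      unfolding ennreal_mult[OF a0[of x] zero_le_power2] by (rule nn_integral_cmult) measurable
    also have "\<dots> \<le> ennreal (?a x) * ennreal (b * (u x)\<^sup>2)"
      by (intro mult_left_mono var) simp
    also have "\<dots> = ennreal (?a x * (b * (u x)\<^sup>2))"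
      using a0 b by (intro ennreal_mult[symmetric]) auto
    also have "\<dots> = ennreal (2 * L\<^sup>2 * b * (((dist x0 x)\<^sup>2 + r) * ((u x)\<^sup>2 / (l x)\<^sup>2)))"
      by (simp add: field_simps)
    also have "\<dots> = ennreal (2 * L\<^sup>2 * b) * ennreal (((dist x0 x)\<^sup>2 + r) * ((u x)\<^sup>2 / (l x)\<^sup>2))"
      using b r by (intro ennreal_mult) auto
    finally show "(\<integral>\<^sup>+\<omega>. ennreal (?a x * (Z \<omega> x - zstar x)\<^sup>2) \<partial>M)
        \<le> ennreal (2 * L\<^sup>2 * b) * ennreal (((dist x0 x)\<^sup>2 + r) * ((u x)\<^sup>2 / (l x)\<^sup>2))" .
  qed
  also have "\<dots> = ennreal (2 * L\<^sup>2 * b) * (\<integral>\<^sup>+x. ennreal (((dist x0 x)\<^sup>2 + r) * ((u x)\<^sup>2 / (l x)\<^sup>2)) \<partial>tgt zstar)"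
    by (rule nn_integral_cmult) measurable
  also have "\<dots> \<le> ennreal (2 * L\<^sup>2 * b) * (bound_R \<mu> \<nu> E ybar l u + 1)"
    by (intro mult_left_mono r) simp
  also have "bound_R \<mu> \<nu> E ybar l u + 1 = ennreal (enn2real (bound_R \<mu> \<nu> E ybar l u) + 1)"
    using R_finite by simp
  also have "ennreal (2 * L\<^sup>2 * b) * \<dots> = ennreal (2 * L\<^sup>2 * b * (enn2real (bound_R \<mu> \<nu> E ybar l u) + 1))"
    using b by (intro ennreal_mult[symmetric]) auto
  finally show ?thesis .
qed

text \<open>Each sample value and its mean lie between the positive number \<open>l x\<close> and
  \<open>u x\<close>, so the centred terms are at most \<open>u x\<close> in modulus. Independence
  removes the mixed terms, leaving \<open>n\<close> of the \<open>n^2\<close> products.\<close>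

lemma empirical_variance_le:
  fixes Y :: "nat \<Rightarrow> 'w \<Rightarrow> 'd"
  assumes M: "prob_space M" and ind: "prob_space.indep_vars M (\<lambda>_. \<mu>) Y {1..}"
    and dist: "\<And>k. 1 \<le> k \<Longrightarrow> distr M \<mu> (Y k) = \<mu>" and n: "1 \<le> n"
  shows "(\<integral>\<^sup>+\<omega>. ennreal ((1 / real n * (\<Sum>k = 1..n. exp (- E (Y k \<omega>) x)) - zstar x)\<^sup>2) \<partial>M)
    \<le> ennreal (1 / real n * (u x)\<^sup>2)"
proof -
  interpret M: prob_space M by (rule M)
  interpret mu: prob_space \<mu> by (rule prob_mu)
  have Y[measurable]: "Y k \<in> M \<rightarrow>\<^sub>M \<mu>" if "1 \<le> k" for k
    using ind that by (auto simp: M.indep_vars_def)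
  have fm[measurable]: "(\<lambda>y. exp (- E y x) - zstar x) \<in> borel_measurable \<mu>" by measurable
  define a where "a k \<omega> = exp (- E (Y k \<omega>) x) - zstar x" for k \<omega>
  have a[measurable]: "a k \<in> borel_measurable M" if "1 \<le> k" for k
    unfolding a_def using measurable_compose[OF Y[OF that] fm] by simp
  have bnd: "\<bar>exp (- E y x) - zstar x\<bar> \<le> u x" if "y \<in> space \<mu>" for y
    using l_le[OF that, of x] u_ge[OF that, of x] mixture_bounds(1,2)[of zstar x] l_pos[of x] by auto
  have abnd: "\<bar>a k \<omega>\<bar> \<le> u x" if "1 \<le> k" "\<omega> \<in> space M" for k \<omega>
    unfolding a_def using bnd measurable_space[OF Y[OF that(1)] that(2)] by simp
  have sqb: "(a k \<omega>)\<^sup>2 \<le> (u x)\<^sup>2" if "1 \<le> k" "\<omega> \<in> space M" for k \<omega>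
    using abnd[OF that] by (intro abs_le_square_iff[THEN iffD1]) simp
  have sq: "integrable M (\<lambda>\<omega>. (a k \<omega>)\<^sup>2)" if k: "1 \<le> k" for k
    using sqb[OF k] a[OF k] by (intro M.integrable_const_bound[where B = "(u x)\<^sup>2"] AE_I2) auto
  have int: "integrable M (a k)" if k: "1 \<le> k" for k
    using a[OF k] sq[OF k] by (rule M.square_integrable_imp_integrable)
  have mean: "(\<integral>\<omega>. a k \<omega> \<partial>M) = 0" if k: "1 \<le> k" for k
  proof -
    have "(\<integral>\<omega>. a k \<omega> \<partial>M) = (\<integral>y. exp (- E y x) - zstar x \<partial>distr M \<mu> (Y k))"
      unfolding a_def by (rule integral_distr[symmetric]) (use Y[OF k] in measurable)
    also have "\<dots> = (\<integral>y. exp (- E y x) - zstar x \<partial>\<mu>)" by (simp add: dist[OF k])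
    also have "\<dots> = 0" using zstar_integrable[of x]
      by (simp add: mu.prob_space mixture_def)
    finally show ?thesis .
  qed
  have ia: "M.indep_vars (\<lambda>_. borel) a {1..}"
    unfolding a_def using M.indep_vars_compose2[OF ind, of "\<lambda>_ y. exp (- E y x) - zstar x" "\<lambda>_. borel"]
    by simp
  have orth: "(\<integral>\<omega>. a i \<omega> * a j \<omega> \<partial>M) = 0" if ij: "i \<in> {1..n}" "j \<in> {1..n}" "i \<noteq> j" for i j
  proof -
    have "M.indep_vars (\<lambda>_. borel) a {i, j}"
      using ij by (intro M.indep_vars_subset[OF ia]) auto
    then have "(\<integral>\<omega>. (\<Prod>k\<in>{i, j}. a k \<omega>) \<partial>M) = (\<Prod>k\<in>{i, j}. \<integral>\<omega>. a k \<omega> \<partial>M)"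
      using ij int by (intro M.indep_vars_lebesgue_integral) auto
    then show ?thesis using ij mean by simp
  qed
  have I: "integrable M (\<lambda>\<omega>. (\<Sum>k\<in>{1..n}. a k \<omega>)\<^sup>2)"
    and S: "(\<integral>\<omega>. (\<Sum>k\<in>{1..n}. a k \<omega>)\<^sup>2 \<partial>M) = (\<Sum>k\<in>{1..n}. \<integral>\<omega>. (a k \<omega>)\<^sup>2 \<partial>M)"
    using a sq orth integral_square_orthogonal_sum[where I = "{1..n}" and a = a and M = M] by auto
  have "(\<Sum>k\<in>{1..n}. \<integral>\<omega>. (a k \<omega>)\<^sup>2 \<partial>M) \<le> (\<Sum>k\<in>{1..n}. (u x)\<^sup>2)"
    using sqb sq by (intro sum_mono M.integral_le_const AE_I2) auto
  then have S': "(\<integral>\<omega>. (\<Sum>k\<in>{1..n}. a k \<omega>)\<^sup>2 \<partial>M) \<le> real n * (u x)\<^sup>2" using S by simp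
  have "1 / real n * (\<Sum>k = 1..n. exp (- E (Y k \<omega>) x)) - zstar x = 1 / real n * (\<Sum>k\<in>{1..n}. a k \<omega>)" for \<omega>
    using n by (simp add: a_def sum_subtractf field_simps)
  then have "(\<integral>\<^sup>+\<omega>. ennreal ((1 / real n * (\<Sum>k = 1..n. exp (- E (Y k \<omega>) x)) - zstar x)\<^sup>2) \<partial>M)
      = (\<integral>\<^sup>+\<omega>. ennreal (1 / (real n)\<^sup>2 * (\<Sum>k\<in>{1..n}. a k \<omega>)\<^sup>2) \<partial>M)"
    by (simp add: power_mult_distrib power_divide)
  also have "\<dots> = ennreal (1 / (real n)\<^sup>2 * (\<integral>\<omega>. (\<Sum>k\<in>{1..n}. a k \<omega>)\<^sup>2 \<partial>M))"
    using I by (subst nn_integral_eq_integral) auto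
  also have "\<dots> \<le> ennreal (1 / (real n)\<^sup>2 * (real n * (u x)\<^sup>2))"
    using S' by (intro ennreal_leI mult_left_mono) auto
  also have "1 / (real n)\<^sup>2 * (real n * (u x)\<^sup>2) = 1 / real n * (u x)\<^sup>2"
    using n by (simp add: power2_eq_square)
  finally show ?thesis .
qed

end

section \<open>The AIR process\<close>

text \<open>Pushing \<open>L x\<close> forward to the graph by \<open>Pair x\<close> moves the
  dependence on \<open>x\<close> from the integrand into the kernel.\<close>

lemma integral_measurable_kernel:
  fixes f :: "'a \<Rightarrow> 'b \<Rightarrow> real"
  assumes f[measurable]: "(\<lambda>(x, y). f x y) \<in> borel_measurable (M \<Otimes>\<^sub>M N)"
    and L[measurable]: "L \<in> M \<rightarrow>\<^sub>M prob_algebra N"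
  shows "(\<lambda>x. \<integral>y. f x y \<partial>L x) \<in> borel_measurable M"
proof -
  have k: "(\<lambda>x. distr (L x) (M \<Otimes>\<^sub>M N) (Pair x)) \<in> M \<rightarrow>\<^sub>M prob_algebra (M \<Otimes>\<^sub>M N)"
    by measurable
  have "(\<lambda>x. \<integral>p. (case p of (x, y) \<Rightarrow> f x y) \<partial>distr (L x) (M \<Otimes>\<^sub>M N) (Pair x)) \<in> borel_measurable M"
    by (rule measurable_compose[OF measurable_prob_algebraD[OF k] integral_measurable_subprob_algebra[OF f]])
  then show ?thesis
  proof (rule measurable_cong[THEN iffD1, rotated])
    fix x assume x: "x \<in> space M"
    then have s: "sets (L x) = sets N" using measurable_space[OF L x] by (simp add: space_prob_algebra)
    have "Pair x \<in> L x \<rightarrow>\<^sub>M M \<Otimes>\<^sub>M N"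
      using measurable_Pair1'[OF x, of N] measurable_cong_sets[OF s refl] by blast
    from integral_distr[OF this f]
    show "(\<integral>p. (case p of (x, y) \<Rightarrow> f x y) \<partial>distr (L x) (M \<Otimes>\<^sub>M N) (Pair x)) = (\<integral>y. f x y \<partial>L x)"
      by simp
  qed
qed

lemma vimage_algebra_subalgebra:
  assumes "f \<in> M \<rightarrow>\<^sub>M N"
  shows "subalgebra M (vimage_algebra (space M) f N)"
  unfolding subalgebra_def using assms
  by (auto simp: sets_vimage_algebra2 measurable_space measurable_sets)

locale air_setup = intractable_model \<mu> ybar \<nu> E P MZ l u
  for \<mu> :: "'d measure" and ybar
    and \<nu> :: "'x::{metric_space, second_countable_topology} measure" and E P MZ l u +
  fixes K and C \<tau> \<alpha> :: real and k0 :: nat and M :: "'w measure" and X Z Y N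
  assumes K_measurable: "(\<lambda>(z, x). K z x) \<in> MZ \<Otimes>\<^sub>M borel \<rightarrow>\<^sub>M prob_algebra borel"
    and contractive: "sim_wasserstein_contractive (norm_funs E P) (target \<nu> E ybar) K C \<tau> k0"
    and process: "air_process \<mu> E MZ K N M X Z Y"
    and N_eq: "\<And>j. 1 \<le> j \<Longrightarrow> N (air_time j) = nat \<lceil>real j powr (1 + \<alpha>)\<rceil>"
    and alpha: "0 \<le> \<alpha>"
    and regular: "metric_regular M (target \<nu> E ybar) K X Z"
begin

lemma kernel_K: "z \<in> space MZ \<Longrightarrow> K z \<in> borel \<rightarrow>\<^sub>M prob_algebra borel"
  using measurable_compose[OF measurable_Pair1' K_measurable] by simp

lemma constants: "0 < C" "0 \<le> \<tau>" "\<tau> < 1" "1 \<le> k0"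
  using contractive by (auto simp: sim_wasserstein_contractive_def contraction_bound_def)

lemma contractive_kernel: "z \<in> space MZ \<Longrightarrow> contractive_kernel (K z) (tgt z) C \<tau> k0"
  using contractive kernel_K[of z] prob_tgt[of z] tgt_moment[of z] constants
  by (intro contractive_kernel.intro)
    (auto simp: sim_wasserstein_contractive_def contraction_bound_def space_MZ sets_tgt)

lemma prob_M: "prob_space M" and X_measurable[measurable]: "X n \<in> borel_measurable M"
  and Z_measurable[measurable]: "Z n \<in> M \<rightarrow>\<^sub>M MZ"
  and Y_indep: "prob_space.indep_vars M (\<lambda>_. \<mu>) Y {1..}"
  and Y_distr: "1 \<le> k \<Longrightarrow> distr M \<mu> (Y k) = \<mu>"
  and Z_update: "1 \<le> n \<Longrightarrow> \<omega> \<in> space M \<Longrightarrow> Z n \<omega> =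
        (if n \<in> range air_time
         then (\<lambda>x. 1 / real (N n) * (\<Sum>k = 1..N n. exp (- E (Y k \<omega>) x)))
         else Z (n - 1) \<omega>)"
  using process unfolding air_process_def by simp_all

lemma Z_space: "\<omega> \<in> space M \<Longrightarrow> Z n \<omega> \<in> space MZ"
  using measurable_space[OF Z_measurable] .

lemma Y_measurable: "1 \<le> k \<Longrightarrow> Y k \<in> M \<rightarrow>\<^sub>M \<mu>"
  using Y_indep unfolding prob_space.indep_vars_def2[OF prob_M] by simp

definition past :: "nat \<Rightarrow> 'w measure" where
  "past n = air_past M \<mu> MZ X Z Y (Suc n) (Suc n) (N (Max (range air_time \<inter> {..n})))"

lemma X_cond_law: "cond_law M (past n) (X (Suc n)) borel (\<lambda>\<omega>. K (Z n \<omega>) (X n \<omega>))"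
  using process unfolding air_process_def past_def by simp

lemma past_subalgebra: "subalgebra M (past n)"
  and X_past: "i \<le> n \<Longrightarrow> X i \<in> past n \<rightarrow>\<^sub>M borel"
  and Z_past: "i \<le> n \<Longrightarrow> Z i \<in> past n \<rightarrow>\<^sub>M MZ"
proof -
  define c where "c = N (Max (range air_time \<inter> {..n}))"
  define S where "S = (\<Pi>\<^sub>M i\<in>{..<Suc n}. borel :: 'x measure) \<Otimes>\<^sub>M (\<Pi>\<^sub>M i\<in>{..<Suc n}. MZ) \<Otimes>\<^sub>M (\<Pi>\<^sub>M k\<in>{1..c}. \<mu>)"
  define v where "v \<omega> = (\<lambda>i\<in>{..<Suc n}. X i \<omega>, \<lambda>i\<in>{..<Suc n}. Z i \<omega>, \<lambda>k\<in>{1..c}. Y k \<omega>)" for \<omega>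
  have p: "past n = vimage_algebra (space M) v S"
    unfolding past_def air_past_def v_def S_def c_def ..
  have v: "v \<in> M \<rightarrow>\<^sub>M S"
    unfolding v_def S_def using Y_measurable
    by (intro measurable_Pair measurable_restrict) auto
  then show "subalgebra M (past n)" unfolding p by (rule vimage_algebra_subalgebra)
  have v': "v \<in> past n \<rightarrow>\<^sub>M S" unfolding p
    using measurable_space[OF v] by (intro measurable_vimage_algebra1) auto
  have sp: "space (past n) = space M" unfolding p by simp
  show "X i \<in> past n \<rightarrow>\<^sub>M borel" if "i \<le> n"
  proof -
    have "(\<lambda>s. fst s i) \<in> S \<rightarrow>\<^sub>M borel"
      unfolding S_def using that by (intro measurable_compose[OF measurable_fst measurable_component_singleton]) auto
    from measurable_compose[OF v' this] show ?thesis using that by (simp add: v_def)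
  qed
  show "Z i \<in> past n \<rightarrow>\<^sub>M MZ" if "i \<le> n"
  proof -
    have "(\<lambda>s. fst (snd s) i) \<in> S \<rightarrow>\<^sub>M MZ"
      unfolding S_def using that
      by (intro measurable_compose[OF measurable_compose[OF measurable_snd measurable_fst] measurable_component_singleton]) auto
    from measurable_compose[OF v' this] show ?thesis using that by (simp add: v_def)
  qed
qed

lemma K_past: "(\<lambda>\<omega>. K (Z n \<omega>) (X n \<omega>)) \<in> past n \<rightarrow>\<^sub>M prob_algebra borel"
  using measurable_compose[OF measurable_Pair[OF Z_past[of n n] X_past[of n n]] K_measurable] by simp

definition \<kappa> :: real where "\<kappa> = enn2real (sup_ecc M tgt X Z)"

definition \<Lambda> :: real where "\<Lambda> = enn2real (sup_diff M K X Z)"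

lemma ecc_le: "(\<integral>\<^sup>+\<omega>. (ecc tgt (Z j \<omega>) (X k \<omega>))\<^sup>2 \<partial>M) \<le> ennreal \<kappa>"
proof -
  have "(\<integral>\<^sup>+\<omega>. (ecc tgt (Z j \<omega>) (X k \<omega>))\<^sup>2 \<partial>M) \<le> sup_ecc M tgt X Z"
    unfolding sup_ecc_def by (intro SUP_upper2[of "(j, k)"]) auto
  also have "\<dots> = ennreal \<kappa>" using regular by (simp add: \<kappa>_def metric_regular_def)
  finally show ?thesis .
qed

lemma diff_le: "(\<integral>\<^sup>+\<omega>. diff_kernel K (Z j \<omega>) (X k \<omega>) \<partial>M) \<le> ennreal \<Lambda>"
proof -
  have "(\<integral>\<^sup>+\<omega>. diff_kernel K (Z j \<omega>) (X k \<omega>) \<partial>M) \<le> sup_diff M K X Z"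
    unfolding sup_diff_def by (intro SUP_upper2[of "(j, k)"]) auto
  also have "\<dots> = ennreal \<Lambda>" using regular by (simp add: \<Lambda>_def metric_regular_def)
  finally show ?thesis .
qed

lemma kappa_nonneg: "0 \<le> \<kappa>" and Lambda_nonneg: "0 \<le> \<Lambda>"
  by (simp_all add: \<kappa>_def \<Lambda>_def)

lemma ecc_eq: "z \<in> space MZ \<Longrightarrow> ecc tgt z x = ennreal (\<integral>y. dist x y \<partial>tgt z)"
  unfolding ecc_def using tgt_moment[of z x]
  by (intro nn_integral_eq_integral) (auto simp: space_MZ)

lemma ecc_measurable: "(\<lambda>(z, x). ecc tgt z x) \<in> borel_measurable (MZ \<Otimes>\<^sub>M borel)"
proof -
  have "(\<lambda>p. \<integral>\<^sup>+y. ennreal (dist (snd p) y) \<partial>tgt (fst p)) \<in> borel_measurable (MZ \<Otimes>\<^sub>M borel)"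
  proof (rule nn_integral_measurable_subprob_algebra2)
    show "(\<lambda>p. tgt (fst p)) \<in> MZ \<Otimes>\<^sub>M borel \<rightarrow>\<^sub>M subprob_algebra borel"
      by (rule measurable_compose[OF measurable_fst measurable_prob_algebraD[OF tgt_kernel]])
  qed measurable
  then show ?thesis unfolding ecc_def by (simp add: case_prod_beta)
qed

lemma diff_measurable: "(\<lambda>(z, x). diff_kernel K z x) \<in> borel_measurable (MZ \<Otimes>\<^sub>M borel)"
proof -
  have k: "(\<lambda>p. K (fst p) (snd p)) \<in> MZ \<Otimes>\<^sub>M borel \<rightarrow>\<^sub>M subprob_algebra borel"
    using measurable_prob_algebraD[OF K_measurable] by (simp add: case_prod_beta)
  have "(\<lambda>q. \<integral>\<^sup>+x2. ennreal ((dist (snd q) x2)\<^sup>2) \<partial>K (fst (fst q)) (snd (fst q)))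
      \<in> borel_measurable ((MZ \<Otimes>\<^sub>M borel) \<Otimes>\<^sub>M borel)"
  proof (rule nn_integral_measurable_subprob_algebra2)
    show "(\<lambda>q. K (fst (fst q)) (snd (fst q))) \<in> (MZ \<Otimes>\<^sub>M borel) \<Otimes>\<^sub>M borel \<rightarrow>\<^sub>M subprob_algebra borel"
      by (rule measurable_compose[OF measurable_fst k])
  qed measurable
  then have "(\<lambda>p. \<integral>\<^sup>+x1. (\<integral>\<^sup>+x2. ennreal ((dist x1 x2)\<^sup>2) \<partial>K (fst p) (snd p)) \<partial>K (fst p) (snd p))
      \<in> borel_measurable (MZ \<Otimes>\<^sub>M borel)"
    by (intro nn_integral_measurable_subprob_algebra2[OF _ k]) (simp add: case_prod_beta)
  then show ?thesis unfolding diff_kernel_def by (simp add: case_prod_beta)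
qed

section \<open>Truncated Poisson equation and martingale increments\<close>

definition avg :: "('x \<Rightarrow> real) \<Rightarrow> nat \<Rightarrow> ('x \<Rightarrow> real) \<Rightarrow> 'x \<Rightarrow> real" where
  "avg h k z = (kernel_avg (K z) ^^ k) h"

text \<open>A truncated solution of the Poisson equation, so that no limit has to be interchanged with
  \<open>K z\<close>; \<open>poisson_avg\<close> is its image under \<open>K z\<close>.\<close>

definition poisson :: "('x \<Rightarrow> real) \<Rightarrow> nat \<Rightarrow> ('x \<Rightarrow> real) \<Rightarrow> 'x \<Rightarrow> real" where
  "poisson h m z x = (\<Sum>k<m. avg h k z x - (\<integral>y. h y \<partial>tgt z))"

definition poisson_avg :: "('x \<Rightarrow> real) \<Rightarrow> nat \<Rightarrow> ('x \<Rightarrow> real) \<Rightarrow> 'x \<Rightarrow> real" where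
  "poisson_avg h m z x = (\<Sum>k<m. avg h (Suc k) z x - (\<integral>y. h y \<partial>tgt z))"

text \<open>Truncation leaves the \<open>m\<close>-th iterate of \<open>h\<close> where the full
  Poisson equation has the mean of \<open>h\<close>.\<close>

lemma poisson_equation: "poisson h m z x - poisson_avg h m z x = h x - avg h m z x"
proof -
  have "poisson h m z x - poisson_avg h m z x = (\<Sum>k<m. avg h k z x - avg h (Suc k) z x)"
    by (simp add: poisson_def poisson_avg_def sum_subtractf)
  also have "\<dots> = avg h 0 z x - avg h m z x" by (rule sum_lessThan_telescope')
  finally show ?thesis by (simp add: avg_def)
qed

text \<open>Both terms use \<open>Z j\<close>, and \<open>X (Suc j)\<close> is drawn from
  \<open>K (Z j) (X j)\<close>, so the conditional mean given \<open>past j\<close> is 0.\<close>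

definition increment :: "('x \<Rightarrow> real) \<Rightarrow> nat \<Rightarrow> nat \<Rightarrow> 'w \<Rightarrow> real" where
  "increment h m j \<omega> = poisson h m (Z j \<omega>) (X (Suc j) \<omega>) - poisson_avg h m (Z j \<omega>) (X j \<omega>)"

lemma eval_past_measurable:
  assumes f: "(\<lambda>(z, x). f z x) \<in> borel_measurable (MZ \<Otimes>\<^sub>M borel)" and "i \<le> n" "j \<le> n"
  shows "(\<lambda>\<omega>. f (Z i \<omega>) (X j \<omega>) :: 'b::topological_space) \<in> borel_measurable (past n)"
  using measurable_compose[OF measurable_Pair[OF Z_past[OF assms(2)] X_past[OF assms(3)]] f] by simp

lemma eval_measurable_M:
  assumes f: "(\<lambda>(z, x). f z x) \<in> borel_measurable (MZ \<Otimes>\<^sub>M borel)"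
  shows "(\<lambda>\<omega>. f (Z i \<omega>) (X j \<omega>) :: 'b::topological_space) \<in> borel_measurable M"
  using measurable_compose[OF measurable_Pair[OF Z_measurable X_measurable] f] by simp

text \<open>The two indices are kept independent because \<open>Z j\<close> is met together with
  \<open>X (Suc j)\<close>, and \<open>Z (j - 1)\<close> with \<open>X j\<close>.\<close>

lemma square_le_ecc:
  assumes "\<And>\<omega>. \<omega> \<in> space M \<Longrightarrow> ennreal ((f \<omega>)\<^sup>2) \<le> ennreal (D\<^sup>2) * (ecc tgt (Z i \<omega>) (X j \<omega>))\<^sup>2"
  shows "(\<integral>\<^sup>+\<omega>. ennreal ((f \<omega>)\<^sup>2) \<partial>M) \<le> ennreal ((D * sqrt \<kappa>)\<^sup>2)"
proof -
  have em: "(\<lambda>\<omega>. ecc tgt (Z i \<omega>) (X j \<omega>)) \<in> borel_measurable M"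
    by (rule eval_measurable_M[OF ecc_measurable])
  have "(\<integral>\<^sup>+\<omega>. ennreal ((f \<omega>)\<^sup>2) \<partial>M) \<le> (\<integral>\<^sup>+\<omega>. ennreal (D\<^sup>2) * (ecc tgt (Z i \<omega>) (X j \<omega>))\<^sup>2 \<partial>M)"
    by (intro nn_integral_mono assms)
  also have "\<dots> = ennreal (D\<^sup>2) * (\<integral>\<^sup>+\<omega>. (ecc tgt (Z i \<omega>) (X j \<omega>))\<^sup>2 \<partial>M)"
    using em by (intro nn_integral_cmult) measurable
  also have "\<dots> \<le> ennreal (D\<^sup>2) * ennreal \<kappa>" by (intro mult_left_mono ecc_le) simp
  also have "\<dots> = ennreal ((D * sqrt \<kappa>)\<^sup>2)"
    using kappa_nonneg by (simp add: ennreal_mult[symmetric] power_mult_distrib)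
  finally show ?thesis .
qed

text \<open>Between updates \<open>Z\<close> is constant. Time 0 is excluded, since
  \<open>Z 0\<close> comes from the initial kernel and is not an empirical mean.\<close>

lemma Z_eq_empirical:
  assumes n: "1 \<le> n" and \<omega>: "\<omega> \<in> space M"
    and i: "air_time i \<le> n" "n < air_time (Suc i)"
  shows "Z n \<omega> = (\<lambda>x. 1 / real (N (air_time i)) * (\<Sum>k = 1..N (air_time i). exp (- E (Y k \<omega>) x)))"
  using i(1) n i(2)
proof (induction n rule: dec_induct)
  case base
  then show ?case using Z_update[of "air_time i" \<omega>] \<omega> by simp
next
  case (step n)
  have "Suc n \<notin> range air_time"
  proof
    assume "Suc n \<in> range air_time"
    then obtain j where "Suc n = air_time j" by auto
    then have "air_time i < air_time j" "air_time j < air_time (Suc i)" using step by auto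
    then show False by (simp add: strict_mono_less[OF air_time_strict_mono])
  qed
  then have "Z (Suc n) \<omega> = Z n \<omega>" using Z_update[of "Suc n" \<omega>] \<omega> by simp
  \<comment> \<open>Time 1 is an update time, so the step from 0 to 1 never falls inside a
    block.\<close>
  moreover have "1 \<le> n"
  proof (rule ccontr)
    assume "\<not> 1 \<le> n"
    then have "n = 0" by simp
    then have "Suc n = air_time 1" by (simp add: air_time_def)
    then show False using \<open>Suc n \<notin> range air_time\<close> by (metis rangeI)
  qed
  ultimately show ?case using step by simp
qed

text \<open>The current block index \<open>i\<close> is of order \<open>sqrt n\<close>, so at least
  \<open>i powr (1 + \<alpha>)\<close> samples amount to order
  \<open>n powr ((1 + \<alpha>) / 2)\<close>. At time 0 no sample is in use, and the trivial bound
  by \<open>(u x)^2\<close> is absorbed by the constant.\<close>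

lemma Z_variance_le:
  "(\<integral>\<^sup>+\<omega>. ennreal ((Z n \<omega> x - zstar x)\<^sup>2) \<partial>M)
    \<le> ennreal (3 powr ((1 + \<alpha>) / 2) * real (Suc n) powr (- ((1 + \<alpha>) / 2)) * (u x)\<^sup>2)"
proof (cases "n = 0")
  case True
  interpret M: prob_space M by (rule prob_M)
  have "(\<integral>\<^sup>+\<omega>. ennreal ((Z n \<omega> x - zstar x)\<^sup>2) \<partial>M) \<le> (\<integral>\<^sup>+\<omega>. ennreal ((u x)\<^sup>2) \<partial>M)"
  proof (intro nn_integral_mono ennreal_leI)
    fix \<omega> assume "\<omega> \<in> space M"
    then have "Z n \<omega> \<in> norm_funs E P \<union> {zstar}" using Z_space by (simp add: space_MZ)
    from mixture_bounds(1,2)[OF this, of x] mixture_bounds(1,2)[of zstar x] l_pos[of x]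
    have "\<bar>Z n \<omega> x - zstar x\<bar> \<le> \<bar>u x\<bar>" by auto
    then show "(Z n \<omega> x - zstar x)\<^sup>2 \<le> (u x)\<^sup>2" by (rule abs_le_square_iff[THEN iffD1])
  qed
  also have "\<dots> = ennreal (1 * (u x)\<^sup>2)" by (simp add: M.emeasure_space_1)
  also have "\<dots> \<le> ennreal (3 powr ((1 + \<alpha>) / 2) * real (Suc n) powr (- ((1 + \<alpha>) / 2)) * (u x)\<^sup>2)"
    using alpha True by (intro ennreal_leI mult_right_mono) (auto intro: ge_one_powr_ge_zero)
  finally show ?thesis .
next
  case False
  then have n: "1 \<le> n" by simp
  obtain i where i: "air_time i \<le> n" "n < air_time (Suc i)" by (rule air_time_block)
  have i1: "1 \<le> i"
  proof (rule ccontr)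
    assume "\<not> 1 \<le> i"
    then have "i = 0" by simp
    then show False using i(2) n by (simp add: air_time_def)
  qed
  let ?N = "N (air_time i)" and ?q = "(1 + \<alpha>) / 2"
  \<comment> \<open>The factor 3 comes from \<open>(i + 1) * (i + 2) \<le> 6 * i^2\<close>, with
    equality at \<open>i = 1\<close>.\<close>
  have "Suc n \<le> 3 * i\<^sup>2"
  proof -
    have "2 * Suc n \<le> 2 * air_time (Suc i)" using i(2) by simp
    also have "\<dots> = (i + 1) * (i + 2)" by (simp add: two_air_time)
    also have "\<dots> \<le> 2 * (3 * i\<^sup>2)"
    proof -
      obtain d where "i = Suc d" using i1 by (cases i) auto
      then show ?thesis by (simp add: power2_eq_square)
    qed
    finally show ?thesis by simp
  qed
  then have i3: "real (Suc n) / 3 \<le> (real i)\<^sup>2"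
  proof -
    have "real (Suc n) \<le> real (3 * i\<^sup>2)" using \<open>Suc n \<le> 3 * i\<^sup>2\<close> by (simp only: of_nat_le_iff)
    then show ?thesis by simp
  qed
  have "(real (Suc n) / 3) powr ?q \<le> ((real i)\<^sup>2) powr ?q"
    using i3 alpha by (intro powr_mono2) auto
  also have "\<dots> = real i powr (1 + \<alpha>)"
  proof -
    have "(real i)\<^sup>2 = real i powr 2" using i1 by (simp add: powr_numeral)
    then have "((real i)\<^sup>2) powr ?q = real i powr (2 * ?q)" by (simp only: powr_powr)
    also have "2 * ?q = 1 + \<alpha>" by simp
    finally show ?thesis .
  qed
  also have "\<dots> \<le> real ?N"
    unfolding N_eq[OF i1] by linarith
  finally have N: "(real (Suc n) / 3) powr ?q \<le> real ?N" .
  have "0 < (real (Suc n) / 3) powr ?q" by simp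
  with N have N0: "0 < real ?N" by linarith
  have "1 / real ?N \<le> 1 / (real (Suc n) / 3) powr ?q"
    using N N0 by (intro divide_left_mono) auto
  also have "\<dots> = 3 powr ?q * real (Suc n) powr (- ?q)"
    by (simp add: powr_divide powr_minus_divide)
  finally have b: "1 / real ?N \<le> 3 powr ?q * real (Suc n) powr (- ?q)" .
  have "(\<integral>\<^sup>+\<omega>. ennreal ((Z n \<omega> x - zstar x)\<^sup>2) \<partial>M)
      = (\<integral>\<^sup>+\<omega>. ennreal ((1 / real ?N * (\<Sum>k = 1..?N. exp (- E (Y k \<omega>) x)) - zstar x)\<^sup>2) \<partial>M)"
    by (intro nn_integral_cong) (simp only: Z_eq_empirical[OF n _ i])
  also have "\<dots> \<le> ennreal (1 / real ?N * (u x)\<^sup>2)"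
    using N0 by (intro empirical_variance_le prob_M Y_indep Y_distr) auto
  also have "\<dots> \<le> ennreal (3 powr ?q * real (Suc n) powr (- ?q) * (u x)\<^sup>2)"
    using b by (intro ennreal_leI mult_right_mono) auto
  finally show ?thesis .
qed

text \<open>The factor 2 stems from splitting the square at the centre, the power of 3 from
  comparing sample size with time in \<open>Z_variance_le\<close>, and the last factor from
  \<open>obtain_center\<close>.\<close>

definition bias_const :: real where
  "bias_const = 2 * 3 powr ((1 + \<alpha>) / 2) * (enn2real (bound_R \<mu> \<nu> E ybar l u) + 1)"

lemma bias_const_nonneg: "0 \<le> bias_const"
  by (simp add: bias_const_def)

context
  fixes h :: "'x \<Rightarrow> real" and L :: real
  assumes h: "L-lipschitz_on UNIV h"
begin

lemma h_measurable[measurable]: "h \<in> borel_measurable borel"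
  using lipschitz_borel_measurable[OF h] .

lemma L_nonneg: "0 \<le> L"
  using lipschitz_on_nonneg[OF h] .

lemma avg_measurable[measurable]: "(\<lambda>(z, x). avg h k z x) \<in> borel_measurable (MZ \<Otimes>\<^sub>M borel)"
proof (induction k)
  case 0
  show ?case by (simp add: avg_def case_prod_beta)
next
  case (Suc k)
  have "(\<lambda>p. \<integral>y. avg h k (fst p) y \<partial>K (fst p) (snd p)) \<in> borel_measurable (MZ \<Otimes>\<^sub>M borel)"
  proof (rule integral_measurable_kernel)
    have "(\<lambda>(p, y). (fst p, y)) \<in> (MZ \<Otimes>\<^sub>M (borel :: 'x measure)) \<Otimes>\<^sub>M borel \<rightarrow>\<^sub>M MZ \<Otimes>\<^sub>M borel" by measurable
    from measurable_compose[OF this Suc]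
    show "(\<lambda>(p, y). avg h k (fst p) y) \<in> borel_measurable ((MZ \<Otimes>\<^sub>M (borel :: 'x measure)) \<Otimes>\<^sub>M borel)"
      by (simp add: case_prod_beta)
    show "(\<lambda>p. K (fst p) (snd p)) \<in> MZ \<Otimes>\<^sub>M borel \<rightarrow>\<^sub>M prob_algebra borel"
      using K_measurable by (simp add: case_prod_beta)
  qed
  then show ?case by (simp add: avg_def case_prod_beta kernel_avg_def[of _ "(kernel_avg _ ^^ k) h"])
qed

lemma tgt_mean_measurable[measurable]: "(\<lambda>z. \<integral>y. h y \<partial>tgt z) \<in> borel_measurable MZ"
  by (rule tgt_integral_measurable) measurable

lemma poisson_measurable[measurable]: "(\<lambda>(z, x). poisson h m z x) \<in> borel_measurable (MZ \<Otimes>\<^sub>M borel)"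
  and poisson_avg_measurable[measurable]: "(\<lambda>(z, x). poisson_avg h m z x) \<in> borel_measurable (MZ \<Otimes>\<^sub>M borel)"
  unfolding poisson_def poisson_avg_def by measurable

lemma avg_centered:
  assumes z: "z \<in> space MZ"
  shows "ennreal ((avg h k z x - (\<integral>y. h y \<partial>tgt z))\<^sup>2) \<le> ennreal ((L * decay C \<tau> k0 k)\<^sup>2) * (ecc tgt z x)\<^sup>2"
proof -
  interpret contractive_kernel "K z" "tgt z" C \<tau> k0 by (rule contractive_kernel[OF z])
  have nn: "0 \<le> (\<integral>y. dist x y \<partial>tgt z)" by simp
  have "\<bar>avg h k z x - (\<integral>y. h y \<partial>tgt z)\<bar> \<le> \<bar>L * decay C \<tau> k0 k * (\<integral>y. dist x y \<partial>tgt z)\<bar>"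
    using kernel_avg_pow_centered[OF h, of k x] unfolding avg_def by linarith
  then have "(avg h k z x - (\<integral>y. h y \<partial>tgt z))\<^sup>2 \<le> (L * decay C \<tau> k0 k)\<^sup>2 * (\<integral>y. dist x y \<partial>tgt z)\<^sup>2"
    unfolding power_mult_distrib[symmetric] by (rule abs_le_square_iff[THEN iffD1])
  then show ?thesis unfolding ecc_eq[OF z] ennreal_power[OF nn]
    by (simp add: ennreal_mult[symmetric] ennreal_leI)
qed

text \<open>Summing the centred estimates gives a bound independent of the truncation length
  \<open>m\<close>, which will be chosen depending on the number of steps.\<close>

lemma poisson_avg_bound:
  assumes z: "z \<in> space MZ"
  shows "ennreal ((poisson_avg h m z x)\<^sup>2)
    \<le> ennreal ((L * poisson_const C \<tau> k0)\<^sup>2) * (ecc tgt z x)\<^sup>2"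
proof -
  interpret contractive_kernel "K z" "tgt z" C \<tau> k0 by (rule contractive_kernel[OF z])
  let ?e = "\<integral>y. dist x y \<partial>tgt z"
  have nn: "0 \<le> ?e" by simp
  have "\<bar>poisson_avg h m z x\<bar> \<le> (\<Sum>k<m. \<bar>avg h (Suc k) z x - (\<integral>y. h y \<partial>tgt z)\<bar>)"
    unfolding poisson_avg_def by (rule sum_abs)
  also have "\<dots> \<le> (\<Sum>k<m. L * decay C \<tau> k0 (Suc k) * ?e)"
    using kernel_avg_pow_centered[OF h] unfolding avg_def by (intro sum_mono)
  also have "\<dots> = L * (\<Sum>k\<in>{1..m}. decay C \<tau> k0 k) * ?e"
    by (simp add: sum_distrib_left sum_distrib_right sum.atLeast1_atMost_eq)
  also have "\<dots> \<le> L * poisson_const C \<tau> k0 * ?e"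
    using L_nonneg nn constants by (intro mult_right_mono mult_left_mono sum_decay_le) auto
  finally have "\<bar>poisson_avg h m z x\<bar> \<le> \<bar>L * poisson_const C \<tau> k0 * ?e\<bar>" by linarith
  then have "(poisson_avg h m z x)\<^sup>2 \<le> (L * poisson_const C \<tau> k0)\<^sup>2 * ?e\<^sup>2"
    unfolding power_mult_distrib[symmetric] by (rule abs_le_square_iff[THEN iffD1])
  then show ?thesis unfolding ecc_eq[OF z] ennreal_power[OF nn]
    by (simp add: ennreal_mult[symmetric] ennreal_leI)
qed

lemma poisson_lipschitz:
  assumes z: "z \<in> space MZ"
  shows "(L * poisson_const C \<tau> k0)-lipschitz_on UNIV (poisson h m z)"
proof (rule lipschitz_onI)
  interpret contractive_kernel "K z" "tgt z" C \<tau> k0 by (rule contractive_kernel[OF z])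
  fix x y
  have "\<bar>poisson h m z x - poisson h m z y\<bar> = \<bar>\<Sum>k<m. avg h k z x - avg h k z y\<bar>"
    by (simp add: poisson_def sum_subtractf)
  also have "\<dots> \<le> (\<Sum>k<m. \<bar>avg h k z x - avg h k z y\<bar>)" by (rule sum_abs)
  also have "\<dots> \<le> (\<Sum>k<m. L * decay C \<tau> k0 k * dist x y)"
    unfolding avg_def by (intro sum_mono lipschitz_on_absD[OF kernel_avg_decay_lipschitz[OF h]])
  also have "\<dots> = L * (\<Sum>k<m. decay C \<tau> k0 k) * dist x y"
    by (simp add: sum_distrib_left sum_distrib_right)
  also have "\<dots> \<le> L * poisson_const C \<tau> k0 * dist x y"
    using L_nonneg constants by (intro mult_right_mono mult_left_mono sum_decay_le) auto
  finally show "dist (poisson h m z x) (poisson h m z y) \<le> L * poisson_const C \<tau> k0 * dist x y"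
    by (simp add: dist_real_def)
next
  show "0 \<le> L * poisson_const C \<tau> k0"
    using L_nonneg constants by (simp add: poisson_const_def)
qed

lemma poisson_integral:
  assumes z: "z \<in> space MZ"
  shows "integrable (K z x) (poisson h m z)" "(\<integral>y. poisson h m z y \<partial>K z x) = poisson_avg h m z x"
proof -
  interpret contractive_kernel "K z" "tgt z" C \<tau> k0 by (rule contractive_kernel[OF z])
  interpret Q: prob_space "K z x" by (rule prob_Q)
  show "integrable (K z x) (poisson h m z)" by (rule lipschitz_integrable_Q[OF poisson_lipschitz[OF z]])
  have i: "integrable (K z x) (avg h k z)" for k
    unfolding avg_def by (rule lipschitz_integrable_Q[OF kernel_avg_pow_lipschitz[OF h]])
  have "(\<integral>y. poisson h m z y \<partial>K z x) = (\<Sum>k<m. \<integral>y. avg h k z y - (\<integral>y. h y \<partial>tgt z) \<partial>K z x)"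
    unfolding poisson_def using i by (intro Bochner_Integration.integral_sum) auto
  also have "\<dots> = poisson_avg h m z x"
    unfolding poisson_avg_def using i by (intro sum.cong refl)
      (simp add: Q.prob_space, simp add: avg_def kernel_avg_def[of _ "(kernel_avg _ ^^ _) h"])
  finally show "(\<integral>y. poisson h m z y \<partial>K z x) = poisson_avg h m z x" .
qed

text \<open>\<open>poisson_avg\<close> is the mean of \<open>poisson\<close> under
  \<open>K z x\<close>, so the deviation at \<open>y\<close> is an average over a second draw
  \<open>y'\<close>. Jensen and the Lipschitz bound produce the double integral of
  \<open>diff_kernel\<close>.\<close>

lemma poisson_variance:
  assumes z: "z \<in> space MZ"
  shows "(\<integral>\<^sup>+y. ennreal ((poisson h m z y - poisson_avg h m z x)\<^sup>2) \<partial>K z x)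
    \<le> ennreal ((L * poisson_const C \<tau> k0)\<^sup>2) * diff_kernel K z x"
proof -
  interpret contractive_kernel "K z" "tgt z" C \<tau> k0 by (rule contractive_kernel[OF z])
  interpret Q: prob_space "K z x" by (rule prob_Q)
  note [measurable_cong] = sets_Q
  let ?D = "L * poisson_const C \<tau> k0" and ?g = "poisson h m z"
  note g = poisson_lipschitz[OF z, of m]
  have [measurable]: "?g \<in> borel_measurable borel" using lipschitz_borel_measurable[OF g] .
  have D0: "0 \<le> ?D" using lipschitz_on_nonneg[OF g] .
  have "(\<integral>\<^sup>+y. ennreal ((?g y - poisson_avg h m z x)\<^sup>2) \<partial>K z x)
      \<le> (\<integral>\<^sup>+y. ennreal (?D\<^sup>2) * (\<integral>\<^sup>+y'. ennreal ((dist y y')\<^sup>2) \<partial>K z x) \<partial>K z x)"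
  proof (intro nn_integral_mono)
    fix y
    have "ennreal ((?g y - poisson_avg h m z x)\<^sup>2) = ennreal ((\<integral>y'. ?g y - ?g y' \<partial>K z x)\<^sup>2)"
      using poisson_integral[OF z, of x m] by (simp add: Q.prob_space)
    also have "\<dots> \<le> (\<integral>\<^sup>+y'. ennreal ((?g y - ?g y')\<^sup>2) \<partial>K z x)"
      using poisson_integral[OF z, of x m] by (intro Q.integral_square_le_nn_integral) auto
    also have "\<dots> \<le> (\<integral>\<^sup>+y'. ennreal (?D\<^sup>2) * ennreal ((dist y y')\<^sup>2) \<partial>K z x)"
    proof (intro nn_integral_mono)
      fix y'
      have "\<bar>?g y - ?g y'\<bar> \<le> \<bar>?D * dist y y'\<bar>"
        using lipschitz_on_absD[OF g, of y y'] by linarith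
      then have "(?g y - ?g y')\<^sup>2 \<le> ?D\<^sup>2 * (dist y y')\<^sup>2"
        unfolding power_mult_distrib[symmetric] by (rule abs_le_square_iff[THEN iffD1])
      then show "ennreal ((?g y - ?g y')\<^sup>2) \<le> ennreal (?D\<^sup>2) * ennreal ((dist y y')\<^sup>2)"
        by (simp add: ennreal_mult[symmetric] ennreal_leI)
    qed
    also have "\<dots> = ennreal (?D\<^sup>2) * (\<integral>\<^sup>+y'. ennreal ((dist y y')\<^sup>2) \<partial>K z x)"
      by (rule nn_integral_cmult) measurable
    finally show "ennreal ((?g y - poisson_avg h m z x)\<^sup>2)
      \<le> ennreal (?D\<^sup>2) * (\<integral>\<^sup>+y'. ennreal ((dist y y')\<^sup>2) \<partial>K z x)" .
  qed
  also have "\<dots> = ennreal (?D\<^sup>2) * diff_kernel K z x"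
    unfolding diff_kernel_def by (rule nn_integral_cmult) measurable
  finally show ?thesis .
qed

lemma increment_past_measurable: "i < n \<Longrightarrow> increment h m i \<in> borel_measurable (past n)"
  unfolding increment_def
  by (intro borel_measurable_diff eval_past_measurable poisson_measurable poisson_avg_measurable) auto

lemma increment_measurable: "increment h m i \<in> borel_measurable M"
  unfolding increment_def
  by (intro borel_measurable_diff eval_measurable_M poisson_measurable poisson_avg_measurable)

text \<open>The increment as a function of the past and of the new state, the form to which the
  disintegration lemmas apply.\<close>

lemma increment_joint_measurable:
  "(\<lambda>(\<omega>, x). poisson h m (Z j \<omega>) x - poisson_avg h m (Z j \<omega>) (X j \<omega>))
    \<in> borel_measurable (past j \<Otimes>\<^sub>M borel)"
proof -
  have "(\<lambda>p. poisson h m (Z j (fst p)) (snd p)) \<in> borel_measurable (past j \<Otimes>\<^sub>M borel)"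
    using measurable_compose[OF measurable_Pair[OF measurable_compose[OF measurable_fst Z_past[of j j]] measurable_snd]
        poisson_measurable[of m]] by simp
  moreover have "(\<lambda>p. poisson_avg h m (Z j (fst p)) (X j (fst p))) \<in> borel_measurable (past j \<Otimes>\<^sub>M borel)"
    by (rule measurable_compose[OF measurable_fst eval_past_measurable[OF poisson_avg_measurable]]) auto
  ultimately show ?thesis unfolding case_prod_beta by (rule borel_measurable_diff)
qed

lemma increment_square_le:
  "(\<integral>\<^sup>+\<omega>. ennreal ((increment h m j \<omega>)\<^sup>2) \<partial>M) \<le> ennreal ((L * poisson_const C \<tau> k0)\<^sup>2 * \<Lambda>)"
proof -
  let ?D = "L * poisson_const C \<tau> k0"
  let ?f = "\<lambda>(\<omega>, x). ennreal ((poisson h m (Z j \<omega>) x - poisson_avg h m (Z j \<omega>) (X j \<omega>))\<^sup>2)"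
  have f: "?f \<in> borel_measurable (past j \<Otimes>\<^sub>M borel)"
    using increment_joint_measurable[of m j] unfolding case_prod_beta
    by (intro measurable_compose[OF borel_measurable_power measurable_ennreal])
  have "(\<integral>\<^sup>+\<omega>. ennreal ((increment h m j \<omega>)\<^sup>2) \<partial>M)
      = (\<integral>\<^sup>+\<omega>. \<integral>\<^sup>+x. ?f (\<omega>, x) \<partial>K (Z j \<omega>) (X j \<omega>) \<partial>M)"
    using cond_law_nn_integral[OF prob_M past_subalgebra X_measurable K_past X_cond_law f]
    by (simp add: increment_def)
  also have "\<dots> \<le> (\<integral>\<^sup>+\<omega>. ennreal (?D\<^sup>2) * diff_kernel K (Z j \<omega>) (X j \<omega>) \<partial>M)"
    by (intro nn_integral_mono) (simp add: poisson_variance[OF Z_space])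
  also have "\<dots> = ennreal (?D\<^sup>2) * (\<integral>\<^sup>+\<omega>. diff_kernel K (Z j \<omega>) (X j \<omega>) \<partial>M)"
    by (rule nn_integral_cmult[OF eval_measurable_M[OF diff_measurable]])
  also have "\<dots> \<le> ennreal (?D\<^sup>2) * ennreal \<Lambda>" by (intro mult_left_mono diff_le) simp
  finally show ?thesis using Lambda_nonneg by (simp add: ennreal_mult)
qed

lemma increment_square_integrable: "integrable M (\<lambda>\<omega>. (increment h m j \<omega>)\<^sup>2)"
  by (rule nn_integral_square_finite_integrable(1)[OF increment_measurable increment_square_le])

text \<open>The earlier increment involves \<open>X\<close> only up to \<open>Suc i \<le> j\<close>,
  so it belongs to \<open>past j\<close> and factors out of the conditional mean of the later
  one.\<close>

lemma increment_orthogonal: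
  assumes "i < j"
  shows "(\<integral>\<omega>. increment h m i \<omega> * increment h m j \<omega> \<partial>M) = 0"
proof -
  let ?f = "\<lambda>(\<omega>, x). increment h m i \<omega> * (poisson h m (Z j \<omega>) x - poisson_avg h m (Z j \<omega>) (X j \<omega>))"
  have "(\<integral>\<omega>. ?f (\<omega>, X (Suc j) \<omega>) \<partial>M) = 0"
  proof (rule cond_law_integral_zero[OF prob_M past_subalgebra X_measurable K_past X_cond_law])
    show "?f \<in> borel_measurable (past j \<Otimes>\<^sub>M borel)"
      using increment_joint_measurable[of m j] unfolding case_prod_beta
      by (intro borel_measurable_times measurable_compose[OF measurable_fst increment_past_measurable[OF assms]])
    show "integrable M (\<lambda>\<omega>. ?f (\<omega>, X (Suc j) \<omega>))"
      using integrable_mult_of_squares[OF increment_measurable increment_measurable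
          increment_square_integrable increment_square_integrable, of m i m j]
      by (simp add: increment_def)
  next
    fix \<omega> assume "\<omega> \<in> space M"
    then have z: "Z j \<omega> \<in> space MZ" by (rule Z_space)
    interpret contractive_kernel "K (Z j \<omega>)" "tgt (Z j \<omega>)" C \<tau> k0 by (rule contractive_kernel[OF z])
    interpret Q: prob_space "K (Z j \<omega>) (X j \<omega>)" by (rule prob_Q)
    note i = poisson_integral[OF z, of "X j \<omega>" m]
    show "integrable (K (Z j \<omega>) (X j \<omega>)) (\<lambda>x. ?f (\<omega>, x))" using i by auto
    show "(\<integral>x. ?f (\<omega>, x) \<partial>K (Z j \<omega>) (X j \<omega>)) = 0" using i by (simp add: Q.prob_space)
  qed
  then show ?thesis by (simp add: increment_def)
qed

lemma increment_sum_le: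
  "(\<integral>\<^sup>+\<omega>. ennreal ((\<Sum>j<n. increment h m j \<omega>)\<^sup>2) \<partial>M)
    \<le> ennreal (real n * ((L * poisson_const C \<tau> k0)\<^sup>2 * \<Lambda>))"
proof -
  let ?c = "(L * poisson_const C \<tau> k0)\<^sup>2 * \<Lambda>"
  have orth: "(\<integral>\<omega>. increment h m i \<omega> * increment h m j \<omega> \<partial>M) = 0" if "i \<noteq> j" for i j
    using that increment_orthogonal[of i j m] increment_orthogonal[of j i m]
    by (cases i j rule: linorder_cases) (auto simp: mult.commute)
  have I: "integrable M (\<lambda>\<omega>. (\<Sum>j<n. increment h m j \<omega>)\<^sup>2)"
    and S: "(\<integral>\<omega>. (\<Sum>j<n. increment h m j \<omega>)\<^sup>2 \<partial>M) = (\<Sum>j<n. \<integral>\<omega>. (increment h m j \<omega>)\<^sup>2 \<partial>M)"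
    using integral_square_orthogonal_sum[where I = "{..<n}" and a = "increment h m" and M = M]
      increment_measurable increment_square_integrable orth by auto
  have "(\<Sum>j<n. \<integral>\<omega>. (increment h m j \<omega>)\<^sup>2 \<partial>M) \<le> (\<Sum>j<n. ?c)"
    using Lambda_nonneg
    by (intro sum_mono nn_integral_square_finite_integrable(2)[OF increment_measurable increment_square_le]) auto
  then have "(\<integral>\<omega>. (\<Sum>j<n. increment h m j \<omega>)\<^sup>2 \<partial>M) \<le> real n * ?c" using S by simp
  then show ?thesis using nn_integral_eq_integral[OF I] by (simp add: ennreal_leI)
qed

lemma poisson_avg_square_le:
  "(\<integral>\<^sup>+\<omega>. ennreal ((poisson_avg h m (Z i \<omega>) (X j \<omega>))\<^sup>2) \<partial>M)
    \<le> ennreal ((L * poisson_const C \<tau> k0 * sqrt \<kappa>)\<^sup>2)"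
  by (intro square_le_ecc[where i = i and j = j] poisson_avg_bound Z_space)

lemma truncation_square_le:
  "(\<integral>\<^sup>+\<omega>. ennreal ((avg h m (Z i \<omega>) (X j \<omega>) - (\<integral>y. h y \<partial>tgt (Z i \<omega>)))\<^sup>2) \<partial>M)
    \<le> ennreal ((L * decay C \<tau> k0 m * sqrt \<kappa>)\<^sup>2)"
  by (intro square_le_ecc[where i = i and j = j] avg_centered Z_space)

text \<open>\<open>Z\<close> changes only at the update times, so after summation by parts all but \<open>O(sqrt n)\<close> terms
  cancel.\<close>

lemma telescoped_sum_le:
  assumes n: "1 \<le> n"
  shows "(\<integral>\<^sup>+\<omega>. ennreal ((\<Sum>j<n. poisson_avg h m (Z j \<omega>) (X j \<omega>) - poisson_avg h m (Z j \<omega>) (X (Suc j) \<omega>))\<^sup>2) \<partial>M)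
    \<le> ennreal (24 * real n * ((L * poisson_const C \<tau> k0)\<^sup>2 * \<kappa>))"
proof -
  define J where "J = range air_time \<inter> {1..<n}"
  \<comment> \<open>The surviving terms, listed one by one so that each has its own second moment
    bound. \<open>True\<close> marks a value under the current \<open>Z\<close>,
    \<open>False\<close> one under its predecessor; the two extra entries are the ends of the
    telescope, with \<open>Z (n - 1)\<close> at the final state.\<close>
  define I where "I = insert (0, True) (insert (n, False) (J \<times> UNIV))"
  define a where "a p \<omega> = (if snd p then poisson_avg h m (Z (fst p) \<omega>) (X (fst p) \<omega>)
      else - poisson_avg h m (Z (fst p - 1) \<omega>) (X (fst p) \<omega>))" for p :: "nat \<times> bool" and \<omega>
  let ?c = "L * poisson_const C \<tau> k0 * sqrt \<kappa>"
  have c0: "0 \<le> ?c" using L_nonneg constants kappa_nonneg by (simp add: poisson_const_def)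
  have fJ: "finite J" by (simp add: J_def)
  have fI: "finite I" using fJ by (simp add: I_def)
  have eq: "(\<Sum>j<n. poisson_avg h m (Z j \<omega>) (X j \<omega>) - poisson_avg h m (Z j \<omega>) (X (Suc j) \<omega>)) = (\<Sum>p\<in>I. a p \<omega>)"
    if \<omega>: "\<omega> \<in> space M" for \<omega>
  proof -
    have "(\<Sum>j\<in>{1..<n}. poisson_avg h m (Z j \<omega>) (X j \<omega>) - poisson_avg h m (Z (j - 1) \<omega>) (X j \<omega>))
        = (\<Sum>j\<in>J. poisson_avg h m (Z j \<omega>) (X j \<omega>) - poisson_avg h m (Z (j - 1) \<omega>) (X j \<omega>))"
      using Z_update[OF _ \<omega>] by (intro sum.mono_neutral_right) (auto simp: J_def)
    also have "\<dots> = (\<Sum>j\<in>J. \<Sum>b\<in>UNIV. a (j, b) \<omega>)"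
      by (simp add: a_def UNIV_bool)
    also have "\<dots> = (\<Sum>p\<in>J \<times> UNIV. a p \<omega>)" by (simp add: sum.cartesian_product)
    finally have J: "(\<Sum>j\<in>{1..<n}. poisson_avg h m (Z j \<omega>) (X j \<omega>) - poisson_avg h m (Z (j - 1) \<omega>) (X j \<omega>))
        = (\<Sum>p\<in>J \<times> UNIV. a p \<omega>)" .
    have "(0, True) \<notin> insert (n, False) (J \<times> UNIV)" "(n, False) \<notin> J \<times> UNIV"
      by (auto simp: J_def)
    then have "(\<Sum>p\<in>I. a p \<omega>) = a (0, True) \<omega> + (a (n, False) \<omega> + (\<Sum>p\<in>J \<times> UNIV. a p \<omega>))"
      unfolding I_def using fJ by (subst sum.insert) auto
    then show ?thesis
      using sum_telescope_changing[OF n, of "\<lambda>j. poisson_avg h m (Z j \<omega>)" "\<lambda>j. X j \<omega>"] J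
      by (simp add: a_def)
  qed
  have am: "a p \<in> borel_measurable M" for p
    unfolding a_def
    by (cases "snd p") (simp_all add: eval_measurable_M[OF poisson_avg_measurable])
  have asq: "(\<integral>\<^sup>+\<omega>. ennreal ((a p \<omega>)\<^sup>2) \<partial>M) \<le> ennreal (?c\<^sup>2)" for p
    unfolding a_def by (cases "snd p") (simp_all add: poisson_avg_square_le)
  have "(\<integral>\<^sup>+\<omega>. ennreal ((\<Sum>j<n. poisson_avg h m (Z j \<omega>) (X j \<omega>) - poisson_avg h m (Z j \<omega>) (X (Suc j) \<omega>))\<^sup>2) \<partial>M)
      = (\<integral>\<^sup>+\<omega>. ennreal ((\<Sum>p\<in>I. a p \<omega>)\<^sup>2) \<partial>M)"
    by (intro nn_integral_cong) (simp only: eq)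
  also have "\<dots> \<le> ennreal ((\<Sum>p\<in>I. ?c)\<^sup>2)"
    using c0 asq am by (intro nn_integral_sum_square_le fI) auto
  also have "\<dots> \<le> ennreal (24 * real n * ((L * poisson_const C \<tau> k0)\<^sup>2 * \<kappa>))"
  proof (rule ennreal_leI)
    \<comment> \<open>Origin of 24: \<open>card I\<close> is at most \<open>2 * card J + 2\<close>,
      its square at most \<open>8 * (card J)^2 + 8\<close>, hence at most
      \<open>16 * n + 8\<close>.\<close>
    have "card I \<le> Suc (Suc (card (J \<times> (UNIV :: bool set))))"
      unfolding I_def using fJ by (simp add: card_insert_if)
    then have "real (card I) \<le> 2 * real (card J) + 2" by (simp add: card_cartesian_product)
    then have "(real (card I))\<^sup>2 \<le> (2 * real (card J) + 2)\<^sup>2" by (intro power_mono) auto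
    also have "\<dots> \<le> 8 * (real (card J))\<^sup>2 + 8"
      using sum_squares_bound[of "real (card J)" 1] by (simp add: power2_eq_square algebra_simps)
    also have "(real (card J))\<^sup>2 \<le> 2 * real n"
      using card_air_times_le[of n] unfolding J_def by (metis of_nat_le_iff of_nat_mult of_nat_numeral of_nat_power)
    finally have "(real (card I))\<^sup>2 \<le> 24 * real n" using n by simp
    then have "(real (card I))\<^sup>2 * ?c\<^sup>2 \<le> 24 * real n * ?c\<^sup>2" by (intro mult_right_mono) auto
    then show "(\<Sum>p\<in>I. ?c)\<^sup>2 \<le> 24 * real n * ((L * poisson_const C \<tau> k0)\<^sup>2 * \<kappa>)"
      using kappa_nonneg by (simp add: power_mult_distrib)
  qed
  finally show ?thesis .
qed

text \<open>With \<open>m\<close> chosen in terms of \<open>n\<close>, each of the \<open>n\<close>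
  terms is a fraction 1 / n of its full size, so the sum stays bounded. The weaker linear bound is
  stated because it matches the martingale part.\<close>

lemma truncation_sum_le:
  assumes n: "1 \<le> n" and m: "decay C \<tau> k0 m \<le> 1 / real n"
  shows "(\<integral>\<^sup>+\<omega>. ennreal ((\<Sum>j<n. avg h m (Z j \<omega>) (X (Suc j) \<omega>) - (\<integral>y. h y \<partial>tgt (Z j \<omega>)))\<^sup>2) \<partial>M)
    \<le> ennreal (real n * (L\<^sup>2 * \<kappa>))"
proof -
  let ?c = "L * decay C \<tau> k0 m * sqrt \<kappa>"
  have c0: "0 \<le> ?c" using L_nonneg constants kappa_nonneg by (simp add: decay_nonneg)
  have "(\<lambda>\<omega>. avg h m (Z j \<omega>) (X (Suc j) \<omega>) - (\<integral>y. h y \<partial>tgt (Z j \<omega>))) \<in> borel_measurable M" for j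
    by (intro borel_measurable_diff eval_measurable_M[OF avg_measurable]
        measurable_compose[OF Z_measurable tgt_mean_measurable])
  then have "(\<integral>\<^sup>+\<omega>. ennreal ((\<Sum>j<n. avg h m (Z j \<omega>) (X (Suc j) \<omega>) - (\<integral>y. h y \<partial>tgt (Z j \<omega>)))\<^sup>2) \<partial>M)
      \<le> ennreal ((\<Sum>j<n. ?c)\<^sup>2)"
    using c0 truncation_square_le by (intro nn_integral_sum_square_le finite_lessThan)
  also have "\<dots> \<le> ennreal (real n * (L\<^sup>2 * \<kappa>))"
  proof (rule ennreal_leI)
    have "real n * decay C \<tau> k0 m \<le> 1" using m n by (simp add: field_simps)
    then have "(real n * decay C \<tau> k0 m)\<^sup>2 \<le> 1\<^sup>2"
      using constants by (intro power_mono) (auto simp: decay_nonneg)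
    also have "\<dots> \<le> real n" using n by simp
    finally have "(real n * decay C \<tau> k0 m)\<^sup>2 * (L\<^sup>2 * \<kappa>) \<le> real n * (L\<^sup>2 * \<kappa>)"
      using kappa_nonneg by (intro mult_right_mono) auto
    then show "(\<Sum>j<n. ?c)\<^sup>2 \<le> real n * (L\<^sup>2 * \<kappa>)"
      using kappa_nonneg by (simp add: power_mult_distrib mult_ac)
  qed
  finally show ?thesis .
qed

text \<open>\<alpha> is capped at 1 so that the root mean square decays with exponent at most 1/2,
  the range covered by \<open>sum_powr_neg_le\<close>.\<close>

lemma bias_square_le:
  "(\<integral>\<^sup>+\<omega>. ennreal (((\<integral>x. h x \<partial>tgt (Z j \<omega>)) - (\<integral>x. h x \<partial>tgt zstar))\<^sup>2) \<partial>M)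
    \<le> ennreal ((L * sqrt bias_const * real (Suc j) powr (- ((1 + min 1 \<alpha>) / 4)))\<^sup>2)"
proof -
  let ?b = "3 powr ((1 + \<alpha>) / 2) * real (Suc j) powr (- ((1 + \<alpha>) / 2))"
  have "(\<integral>\<^sup>+\<omega>. ennreal (((\<integral>x. h x \<partial>tgt (Z j \<omega>)) - (\<integral>x. h x \<partial>tgt zstar))\<^sup>2) \<partial>M)
      \<le> ennreal (2 * L\<^sup>2 * ?b * (enn2real (bound_R \<mu> \<nu> E ybar l u) + 1))"
    by (intro expected_tgt_diff_square_le prob_M Z_measurable h Z_variance_le) simp
  also have "2 * L\<^sup>2 * ?b * (enn2real (bound_R \<mu> \<nu> E ybar l u) + 1)
      = L\<^sup>2 * bias_const * real (Suc j) powr (- ((1 + \<alpha>) / 2))"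
    by (simp add: bias_const_def mult_ac)
  also have "\<dots> \<le> L\<^sup>2 * bias_const * real (Suc j) powr (- ((1 + min 1 \<alpha>) / 2))"
    using bias_const_nonneg by (intro mult_left_mono powr_mono) auto
  also have "\<dots> = (L * sqrt bias_const * real (Suc j) powr (- ((1 + min 1 \<alpha>) / 4)))\<^sup>2"
  proof -
    have "2 * - ((1 + min 1 \<alpha>) / 4) = - ((1 + min 1 \<alpha>) / 2)" by simp
    then show ?thesis
      using bias_const_nonneg by (simp only: power_mult_distrib powr_square real_sqrt_pow2)
  qed
  finally show ?thesis by (simp add: ennreal_leI)
qed

text \<open>Biases at different times are built from the same samples, so root mean squares are
  added instead of variances.\<close>

lemma bias_sum_le:
  "(\<integral>\<^sup>+\<omega>. ennreal ((\<Sum>j<n. (\<integral>x. h x \<partial>tgt (Z j \<omega>)) - (\<integral>x. h x \<partial>tgt zstar))\<^sup>2) \<partial>M)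
    \<le> ennreal (4 * (L\<^sup>2 * bias_const) * real n powr (2 - (1 + min 1 \<alpha>) / 2))"
proof -
  let ?p = "(1 + min 1 \<alpha>) / 4" and ?S = "L * sqrt bias_const"
  have S0: "0 \<le> ?S" using L_nonneg bias_const_nonneg by simp
  have "(\<lambda>\<omega>. (\<integral>x. h x \<partial>tgt (Z j \<omega>)) - (\<integral>x. h x \<partial>tgt zstar)) \<in> borel_measurable M" for j
    by (intro borel_measurable_diff measurable_compose[OF Z_measurable tgt_mean_measurable]
        borel_measurable_const)
  then have "(\<integral>\<^sup>+\<omega>. ennreal ((\<Sum>j<n. (\<integral>x. h x \<partial>tgt (Z j \<omega>)) - (\<integral>x. h x \<partial>tgt zstar))\<^sup>2) \<partial>M)
      \<le> ennreal ((\<Sum>j<n. ?S * real (Suc j) powr (- ?p))\<^sup>2)"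
    using S0 by (intro nn_integral_sum_square_le bias_square_le finite_lessThan mult_nonneg_nonneg[of ?S] powr_ge_zero)
  also have "\<dots> \<le> ennreal ((?S * (2 * real n powr (1 - ?p)))\<^sup>2)"
  proof (intro ennreal_leI power_mono)
    show "(\<Sum>j<n. ?S * real (Suc j) powr (- ?p)) \<le> ?S * (2 * real n powr (1 - ?p))"
      unfolding sum_distrib_left[symmetric]
      using S0 by (intro mult_left_mono sum_powr_neg_le) auto
    show "0 \<le> (\<Sum>j<n. ?S * real (Suc j) powr (- ?p))" using S0 by (intro sum_nonneg) auto
  qed
  also have "(?S * (2 * real n powr (1 - ?p)))\<^sup>2 = 4 * (L\<^sup>2 * bias_const) * real n powr (2 - (1 + min 1 \<alpha>) / 2)"
  proof -
    have "(real n powr (1 - ?p))\<^sup>2 = real n powr (2 * (1 - ?p))" by (rule powr_square)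
    also have "2 * (1 - ?p) = 2 - (1 + min 1 \<alpha>) / 2" by (simp add: field_simps)
    finally show ?thesis using bias_const_nonneg by (simp add: power_mult_distrib)
  qed
  finally show ?thesis .
qed

text \<open>The first three sums contribute order 1 / n after division by \<open>n^2\<close>, the
  bias order \<open>n powr (- (1 + min 1 \<alpha>) / 2)\<close>. This exponent is at least -1, so
  the bias rate absorbs the others; the leading 4 is the price of squaring a sum of four
  terms.\<close>

lemma air_error_bound:
  assumes n: "1 \<le> n"
  shows "(\<integral>\<^sup>+\<omega>. ennreal (\<bar>air_average X h n \<omega> - (\<integral>x. h x \<partial>tgt zstar)\<bar>\<^sup>2) \<partial>M)
    \<le> ennreal (4 * L\<^sup>2 * ((poisson_const C \<tau> k0)\<^sup>2 * (\<Lambda> + 24 * \<kappa>) + \<kappa> + 4 * bias_const)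
        * real n powr (- ((1 + min 1 \<alpha>) / 2)))"
proof -
  \<comment> \<open>The truncation length depends on \<open>n\<close>; this is harmless since the
    Poisson estimates are uniform in \<open>m\<close>.\<close>
  obtain m where m: "decay C \<tau> k0 m \<le> 1 / real n"
    using decay_arbitrarily_small[of \<tau> k0 "1 / real n" C] constants n by auto
  let ?D = "poisson_const C \<tau> k0" and ?\<pi> = "\<integral>x. h x \<partial>tgt zstar" and ?r = "(1 + min 1 \<alpha>) / 2"
  define a where "a \<omega> = (\<Sum>j<n. increment h m j \<omega>)" for \<omega>
  define b where "b \<omega> = (\<Sum>j<n. poisson_avg h m (Z j \<omega>) (X j \<omega>) - poisson_avg h m (Z j \<omega>) (X (Suc j) \<omega>))" for \<omega>
  define c where "c \<omega> = (\<Sum>j<n. avg h m (Z j \<omega>) (X (Suc j) \<omega>) - (\<integral>y. h y \<partial>tgt (Z j \<omega>)))" for \<omega>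
  define d where "d \<omega> = (\<Sum>j<n. (\<integral>x. h x \<partial>tgt (Z j \<omega>)) - ?\<pi>)" for \<omega>
  have am: "a \<in> borel_measurable M" unfolding a_def
    by (intro borel_measurable_sum increment_measurable)
  have bm: "b \<in> borel_measurable M" unfolding b_def
    by (intro borel_measurable_sum borel_measurable_diff eval_measurable_M[OF poisson_avg_measurable])
  have cm: "c \<in> borel_measurable M" unfolding c_def
    by (intro borel_measurable_sum borel_measurable_diff eval_measurable_M[OF avg_measurable]
        measurable_compose[OF Z_measurable tgt_mean_measurable])
  have dm: "d \<in> borel_measurable M" unfolding d_def
    by (intro borel_measurable_sum borel_measurable_diff
        measurable_compose[OF Z_measurable tgt_mean_measurable] borel_measurable_const)
  have decomposition: "air_average X h n \<omega> - ?\<pi> = 1 / real n * (a \<omega> + b \<omega> + c \<omega> + d \<omega>)" for \<omega>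
  proof -
    have "a \<omega> + b \<omega> + c \<omega> + d \<omega> = (\<Sum>j<n. h (X (Suc j) \<omega>) - ?\<pi>)"
      unfolding a_def b_def c_def d_def sum.distrib[symmetric]
    proof (rule sum.cong[OF refl])
      fix j
      show "increment h m j \<omega>
          + (poisson_avg h m (Z j \<omega>) (X j \<omega>) - poisson_avg h m (Z j \<omega>) (X (Suc j) \<omega>))
          + (avg h m (Z j \<omega>) (X (Suc j) \<omega>) - (\<integral>y. h y \<partial>tgt (Z j \<omega>)))
          + ((\<integral>x. h x \<partial>tgt (Z j \<omega>)) - ?\<pi>) = h (X (Suc j) \<omega>) - ?\<pi>"
        using poisson_equation[of h m "Z j \<omega>" "X (Suc j) \<omega>"] by (simp add: increment_def)
    qed
    also have "\<dots> = (\<Sum>j = 1..n. h (X j \<omega>)) - real n * ?\<pi>"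
      by (simp add: sum_subtractf sum.atLeast1_atMost_eq)
    finally show ?thesis using n by (simp add: air_average_def field_simps)
  qed
  have "(\<integral>\<^sup>+\<omega>. ennreal (\<bar>air_average X h n \<omega> - ?\<pi>\<bar>\<^sup>2) \<partial>M)
      \<le> (\<integral>\<^sup>+\<omega>. ennreal (4 / (real n)\<^sup>2) * (ennreal ((a \<omega>)\<^sup>2) + ennreal ((b \<omega>)\<^sup>2)
            + ennreal ((c \<omega>)\<^sup>2) + ennreal ((d \<omega>)\<^sup>2)) \<partial>M)"
  proof (intro nn_integral_mono)
    fix \<omega>
    have "\<bar>air_average X h n \<omega> - ?\<pi>\<bar>\<^sup>2 = (1 / (real n)\<^sup>2) * (a \<omega> + b \<omega> + c \<omega> + d \<omega>)\<^sup>2"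
      unfolding decomposition by (simp add: power_mult_distrib power_divide)
    also have "\<dots> \<le> (1 / (real n)\<^sup>2) * (4 * ((a \<omega>)\<^sup>2 + (b \<omega>)\<^sup>2 + (c \<omega>)\<^sup>2 + (d \<omega>)\<^sup>2))"
      by (intro mult_left_mono square_sum4_le) simp
    also have "\<dots> = (4 / (real n)\<^sup>2) * ((a \<omega>)\<^sup>2 + (b \<omega>)\<^sup>2 + (c \<omega>)\<^sup>2 + (d \<omega>)\<^sup>2)" by simp
    finally have "ennreal (\<bar>air_average X h n \<omega> - ?\<pi>\<bar>\<^sup>2)
        \<le> ennreal ((4 / (real n)\<^sup>2) * ((a \<omega>)\<^sup>2 + (b \<omega>)\<^sup>2 + (c \<omega>)\<^sup>2 + (d \<omega>)\<^sup>2))"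
      by (rule ennreal_leI)
    also have "\<dots> = ennreal (4 / (real n)\<^sup>2) * (ennreal ((a \<omega>)\<^sup>2) + ennreal ((b \<omega>)\<^sup>2)
            + ennreal ((c \<omega>)\<^sup>2) + ennreal ((d \<omega>)\<^sup>2))"
      by (simp only: ennreal_mult ennreal_plus add_nonneg_nonneg zero_le_power2 divide_nonneg_nonneg
          zero_le_numeral)
    finally show "ennreal (\<bar>air_average X h n \<omega> - ?\<pi>\<bar>\<^sup>2)
        \<le> ennreal (4 / (real n)\<^sup>2) * (ennreal ((a \<omega>)\<^sup>2) + ennreal ((b \<omega>)\<^sup>2)
            + ennreal ((c \<omega>)\<^sup>2) + ennreal ((d \<omega>)\<^sup>2))" .
  qed
  also have "\<dots> = ennreal (4 / (real n)\<^sup>2) * ((\<integral>\<^sup>+\<omega>. ennreal ((a \<omega>)\<^sup>2) \<partial>M)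
      + (\<integral>\<^sup>+\<omega>. ennreal ((b \<omega>)\<^sup>2) \<partial>M) + (\<integral>\<^sup>+\<omega>. ennreal ((c \<omega>)\<^sup>2) \<partial>M)
      + (\<integral>\<^sup>+\<omega>. ennreal ((d \<omega>)\<^sup>2) \<partial>M))"
    using am bm cm dm by (simp add: nn_integral_cmult nn_integral_add)
  also have "\<dots> \<le> ennreal (4 / (real n)\<^sup>2) * (ennreal (real n * ((L * ?D)\<^sup>2 * \<Lambda>))
      + ennreal (24 * real n * ((L * ?D)\<^sup>2 * \<kappa>)) + ennreal (real n * (L\<^sup>2 * \<kappa>))
      + ennreal (4 * (L\<^sup>2 * bias_const) * real n powr (2 - ?r)))"
    unfolding a_def b_def c_def d_def
    by (intro mult_left_mono add_mono increment_sum_le telescoped_sum_le truncation_sum_le bias_sum_le h n m) simp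
  also have "\<dots> = ennreal ((4 / (real n)\<^sup>2) * (real n * ((L * ?D)\<^sup>2 * \<Lambda>)
      + 24 * real n * ((L * ?D)\<^sup>2 * \<kappa>) + real n * (L\<^sup>2 * \<kappa>)
      + 4 * (L\<^sup>2 * bias_const) * real n powr (2 - ?r)))"
    using kappa_nonneg Lambda_nonneg bias_const_nonneg
    by (simp only: ennreal_mult ennreal_plus add_nonneg_nonneg mult_nonneg_nonneg zero_le_power2
        divide_nonneg_nonneg zero_le_numeral of_nat_0_le_iff powr_ge_zero)
  also have "\<dots> \<le> ennreal (4 * L\<^sup>2 * (?D\<^sup>2 * (\<Lambda> + 24 * \<kappa>) + \<kappa> + 4 * bias_const) * real n powr (- ?r))"
  proof (rule ennreal_leI)
    have n2: "(real n)\<^sup>2 = real n powr 2" using n by (simp add: powr_numeral)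
    have "real n * (1 / (real n)\<^sup>2) = real n powr (- 1)"
      using n by (simp add: powr_minus_divide power2_eq_square)
    also have "\<dots> \<le> real n powr (- ?r)" using n by (intro powr_mono) auto
    finally have 1: "real n * (1 / (real n)\<^sup>2) \<le> real n powr (- ?r)" .
    have 2: "real n powr (2 - ?r) * (1 / (real n)\<^sup>2) = real n powr (- ?r)"
      unfolding n2 using n by (simp add: powr_diff powr_minus_divide)
    let ?q = "4 * L\<^sup>2 * (?D\<^sup>2 * (\<Lambda> + 24 * \<kappa>) + \<kappa>)"
    have "(4 / (real n)\<^sup>2) * (real n * ((L * ?D)\<^sup>2 * \<Lambda>)
        + 24 * real n * ((L * ?D)\<^sup>2 * \<kappa>) + real n * (L\<^sup>2 * \<kappa>)
        + 4 * (L\<^sup>2 * bias_const) * real n powr (2 - ?r))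
      = ?q * (real n * (1 / (real n)\<^sup>2)) + 16 * L\<^sup>2 * bias_const * (real n powr (2 - ?r) * (1 / (real n)\<^sup>2))"
      by (simp add: power_mult_distrib algebra_simps add_divide_distrib)
    also have "\<dots> \<le> ?q * real n powr (- ?r) + 16 * L\<^sup>2 * bias_const * real n powr (- ?r)"
      unfolding 2 using kappa_nonneg Lambda_nonneg bias_const_nonneg
      by (intro add_mono mult_left_mono 1 mult_nonneg_nonneg add_nonneg_nonneg) auto
    also have "\<dots> = 4 * L\<^sup>2 * (?D\<^sup>2 * (\<Lambda> + 24 * \<kappa>) + \<kappa> + 4 * bias_const) * real n powr (- ?r)"
      by (simp add: algebra_simps)
    finally show "(4 / (real n)\<^sup>2) * (real n * ((L * ?D)\<^sup>2 * \<Lambda>)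
        + 24 * real n * ((L * ?D)\<^sup>2 * \<kappa>) + real n * (L\<^sup>2 * \<kappa>)
        + 4 * (L\<^sup>2 * bias_const) * real n powr (2 - ?r))
      \<le> 4 * L\<^sup>2 * (?D\<^sup>2 * (\<Lambda> + 24 * \<kappa>) + \<kappa> + 4 * bias_const) * real n powr (- ?r)" .
  qed
  finally show ?thesis .
qed

end

end

section \<open>The three regimes and the choice of the constant\<close>

text \<open>Any one Lipschitz constant makes the supremum finite, and then the supremum is itself a
  Lipschitz constant. This turns bounds in terms of \<open>L\<close> into bounds in terms of
  \<open>lip_norm h\<close>.\<close>

lemma lip_norm_lipschitz:
  fixes h :: "'x::metric_space \<Rightarrow> real"
  assumes h: "L-lipschitz_on UNIV h"
  shows "(enn2real (lip_norm h))-lipschitz_on UNIV h" "lip_norm h = ennreal (enn2real (lip_norm h))"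
proof -
  have "lip_norm h \<le> ennreal L" unfolding lip_norm_def
  proof (intro SUP_least, clarify)
    fix x y :: 'x assume "x \<noteq> y"
    then show "ennreal (\<bar>h x - h y\<bar> / dist x y) \<le> ennreal L"
      using lipschitz_on_absD[OF h, of x y] by (intro ennreal_leI) (simp add: divide_le_eq)
  qed
  then have fin: "lip_norm h < \<infinity>" by (auto intro: le_less_trans)
  then show eq: "lip_norm h = ennreal (enn2real (lip_norm h))" by simp
  show "(enn2real (lip_norm h))-lipschitz_on UNIV h"
  proof (rule lipschitz_onI)
    fix x y
    show "dist (h x) (h y) \<le> enn2real (lip_norm h) * dist x y"
    proof (cases "x = y")
      case False
      have "ennreal (\<bar>h x - h y\<bar> / dist x y) \<le> lip_norm h"
        unfolding lip_norm_def using False by (intro SUP_upper2[of "(x, y)"]) auto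
      then have "ennreal (\<bar>h x - h y\<bar> / dist x y) \<le> ennreal (enn2real (lip_norm h))" using eq by simp
      then have "\<bar>h x - h y\<bar> / dist x y \<le> enn2real (lip_norm h)" by (simp add: ennreal_le_iff)
      then show ?thesis using False by (simp add: dist_real_def divide_le_eq)
    qed simp
  qed simp
qed

text \<open>For \<alpha> below 1 the divisor \<open>1 - \<alpha>\<close> is at most 1; at 1,
  \<open>n \<ge> 3\<close> exceeds the base of the logarithm, so \<open>ln n\<close> is at least 1;
  above 1, \<open>\<alpha> / (\<alpha> - 1)\<close> is at least 1, which explains the factor
  \<open>max 1 \<alpha>\<close>.\<close>

lemma rate_le:
  assumes "0 \<le> \<alpha>" "1 \<le> n" "\<alpha> = 1 \<Longrightarrow> 3 \<le> n"
  shows "real n powr (- ((1 + min 1 \<alpha>) / 2)) \<le> max 1 \<alpha> *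
    (if \<alpha> < 1 then real n powr (- ((1 + \<alpha>) / 2)) / (1 - \<alpha>)
     else if \<alpha> = 1 then ln (real n) / real n else 1 / (real n * (\<alpha> - 1)))"
proof -
  consider "\<alpha> < 1" | "\<alpha> = 1" | "1 < \<alpha>" by linarith
  then show ?thesis
  proof cases
    case 1
    have "real n powr (- ((1 + \<alpha>) / 2)) * (1 - \<alpha>) \<le> real n powr (- ((1 + \<alpha>) / 2)) * 1"
      using assms 1 by (intro mult_left_mono) auto
    then show ?thesis using 1 by (simp add: le_divide_eq)
  next
    case 2
    have "exp 1 \<le> real n" using exp_le assms(3)[OF 2] by linarith
    then have "1 \<le> ln (real n)" using assms(2) by (subst ln_ge_iff) auto
    then show ?thesis using 2 assms(2) by (simp add: powr_minus_divide divide_right_mono)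
  next
    case 3
    then have "1 / real n \<le> \<alpha> / (real n * (\<alpha> - 1))"
      using assms(2) by (simp add: divide_simps)
    then show ?thesis using 3 assms(2) by (simp add: powr_minus_divide)
  qed
qed

theorem proposition4p3:
  fixes \<alpha> C \<tau> :: real and k0 :: nat and \<kappa> \<Lambda> R :: ennreal
  assumes "0 \<le> \<alpha>"
  shows "\<exists>Ct::real. 0 < Ct \<and>
    (\<forall>(\<mu> :: 'd measure) ybar (\<nu> :: 'x::{metric_space, second_countable_topology} measure) E P MZ K
       l u (M :: 'w measure) X Z Y N.
       doubly_intractable \<mu> ybar \<nu> E P MZ \<longrightarrow>
       (\<lambda>(z, x). K z x) \<in> MZ \<Otimes>\<^sub>M borel \<rightarrow>\<^sub>M prob_algebra borel \<longrightarrow>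
       sim_wasserstein_contractive (norm_funs E P) (target \<nu> E ybar) K C \<tau> k0 \<longrightarrow>
       bounding_funs \<mu> E l u \<longrightarrow> bound_R \<mu> \<nu> E ybar l u = R \<longrightarrow> R < \<infinity> \<longrightarrow>
       air_process \<mu> E MZ K N M X Z Y \<longrightarrow>
       N 0 = 0 \<longrightarrow> (\<forall>j\<ge>1. N (air_time j) = nat \<lceil>real j powr (1 + \<alpha>)\<rceil>) \<longrightarrow>
       metric_regular M (target \<nu> E ybar) K X Z \<longrightarrow>
       sup_ecc M (target \<nu> E ybar) X Z = \<kappa> \<longrightarrow> sup_diff M K X Z = \<Lambda> \<longrightarrow>
       (\<forall>n h. 1 \<le> n \<longrightarrow> (\<alpha> = 1 \<longrightarrow> 3 \<le> n) \<longrightarrow>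
          (\<exists>L. L-lipschitz_on UNIV h) \<longrightarrow>
          (\<forall>z\<in>norm_funs E P \<union> {mixture E \<mu>}. integrable (target \<nu> E ybar z) h) \<longrightarrow>
          (\<integral>\<^sup>+\<omega>. ennreal (\<bar>air_average X h n \<omega> -
                (\<integral>x. h x \<partial>target \<nu> E ybar (mixture E \<mu>))\<bar>\<^sup>2) \<partial>M)
          \<le> 3 * ennreal Ct * (lip_norm h)\<^sup>2 *
             ennreal (if \<alpha> < 1 then real n powr (- ((1 + \<alpha>) / 2)) / (1 - \<alpha>)
                      else if \<alpha> = 1 then ln (real n) / real n
                      else 1 / (real n * (\<alpha> - 1)))))"
proof -
  \<comment> \<open>\<open>B\<close> and \<open>Q\<close> reproduce \<open>bias_const\<close> and
    the coefficient in \<open>air_error_bound\<close> from \<alpha>, \<tau>, \<open>C\<close>,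
    \<open>k0\<close>, \<kappa>, \<Lambda> and \<open>R\<close> alone, so the constant is fixed
    before the model and the process.\<close>
  define B where "B = 2 * 3 powr ((1 + \<alpha>) / 2) * (enn2real R + 1)"
  define Q where "Q = 4 * ((poisson_const C \<tau> k0)\<^sup>2 * (enn2real \<Lambda> + 24 * enn2real \<kappa>) + enn2real \<kappa> + 4 * B)"
  have Q0: "0 \<le> Q" by (simp add: Q_def B_def)
  show ?thesis
  \<comment> \<open>\<open>max 1 \<alpha>\<close> comes from \<open>rate_le\<close>; the added 1
    keeps the constant positive when \<open>Q\<close> is 0.\<close>
  proof (intro exI[of _ "Q * max 1 \<alpha> + 1"] conjI allI impI)
    show "0 < Q * max 1 \<alpha> + 1" using Q0 by (simp add: add_nonneg_pos)
  next
    fix \<mu> :: "'d measure" and ybar and \<nu> :: "'x measure" and E P MZ K l u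
      and M :: "'w measure" and X Z Y N and n :: nat and h :: "'x \<Rightarrow> real"
    assume as: "doubly_intractable \<mu> ybar \<nu> E P MZ"
      "(\<lambda>(z, x). K z x) \<in> MZ \<Otimes>\<^sub>M borel \<rightarrow>\<^sub>M prob_algebra borel"
      "sim_wasserstein_contractive (norm_funs E P) (target \<nu> E ybar) K C \<tau> k0"
      "bounding_funs \<mu> E l u" "bound_R \<mu> \<nu> E ybar l u = R" "R < \<infinity>"
      "air_process \<mu> E MZ K N M X Z Y"
      "\<forall>j\<ge>1. N (air_time j) = nat \<lceil>real j powr (1 + \<alpha>)\<rceil>"
      "metric_regular M (target \<nu> E ybar) K X Z"
      "sup_ecc M (target \<nu> E ybar) X Z = \<kappa>" "sup_diff M K X Z = \<Lambda>"
      and n: "1 \<le> n" "\<alpha> = 1 \<longrightarrow> 3 \<le> n" and h: "\<exists>L. L-lipschitz_on UNIV h"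
    interpret s: air_setup \<mu> ybar \<nu> E P MZ l u K C \<tau> \<alpha> k0 M X Z Y N
      using as assms by unfold_locales auto
    let ?L = "enn2real (lip_norm h)"
    let ?rate = "if \<alpha> < 1 then real n powr (- ((1 + \<alpha>) / 2)) / (1 - \<alpha>)
                      else if \<alpha> = 1 then ln (real n) / real n
                      else 1 / (real n * (\<alpha> - 1))"
    have L: "?L-lipschitz_on UNIV h" "lip_norm h = ennreal ?L"
      using h lip_norm_lipschitz by blast+
    have rate0: "0 \<le> ?rate" using n by simp
    have Q: "4 * ?L\<^sup>2 * ((poisson_const C \<tau> k0)\<^sup>2 * (s.\<Lambda> + 24 * s.\<kappa>) + s.\<kappa> + 4 * s.bias_const) = ?L\<^sup>2 * Q"
      unfolding Q_def B_def s.bias_const_def s.\<kappa>_def s.\<Lambda>_def as by simp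
    have "(\<integral>\<^sup>+\<omega>. ennreal (\<bar>air_average X h n \<omega> -
                (\<integral>x. h x \<partial>target \<nu> E ybar (mixture E \<mu>))\<bar>\<^sup>2) \<partial>M)
        \<le> ennreal (?L\<^sup>2 * Q * real n powr (- ((1 + min 1 \<alpha>) / 2)))"
      using s.air_error_bound[OF L(1) n(1)] unfolding Q .
    also have "\<dots> \<le> ennreal (3 * (Q * max 1 \<alpha> + 1) * ?L\<^sup>2 * ?rate)"
    proof (rule ennreal_leI)
      have "?L\<^sup>2 * Q * real n powr (- ((1 + min 1 \<alpha>) / 2)) \<le> ?L\<^sup>2 * Q * (max 1 \<alpha> * ?rate)"
        using rate_le[OF assms n(1)] n(2) Q0 by (intro mult_left_mono) auto
      also have "\<dots> = (Q * max 1 \<alpha>) * (?L\<^sup>2 * ?rate)" by (simp add: mult_ac)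
      also have "\<dots> \<le> (3 * (Q * max 1 \<alpha> + 1)) * (?L\<^sup>2 * ?rate)"
      proof (rule mult_right_mono)
        have "t \<le> 3 * (t + 1)" if "0 \<le> t" for t :: real using that by simp
        then show "Q * max 1 \<alpha> \<le> 3 * (Q * max 1 \<alpha> + 1)" using Q0 by simp
        show "0 \<le> ?L\<^sup>2 * ?rate" using rate0 by (intro mult_nonneg_nonneg) auto
      qed
      finally show "?L\<^sup>2 * Q * real n powr (- ((1 + min 1 \<alpha>) / 2))
          \<le> 3 * (Q * max 1 \<alpha> + 1) * ?L\<^sup>2 * ?rate" by (simp add: mult.assoc)
    qed
    also have "\<dots> = 3 * ennreal (Q * max 1 \<alpha> + 1) * (lip_norm h)\<^sup>2 * ennreal ?rate"
    proof -
      have 1: "0 \<le> Q * max 1 \<alpha> + 1" using Q0 by simp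
      have "ennreal (3 * (Q * max 1 \<alpha> + 1) * ?L\<^sup>2 * ?rate)
          = ennreal 3 * ennreal (Q * max 1 \<alpha> + 1) * ennreal (?L\<^sup>2) * ennreal ?rate"
        using 1 rate0 by (simp only: ennreal_mult mult_nonneg_nonneg zero_le_power2 zero_le_numeral)
      also have "ennreal (?L\<^sup>2) = (lip_norm h)\<^sup>2"
        by (subst (2) L(2)) (simp add: ennreal_power)
      finally show ?thesis by simp
    qed
    finally show "(\<integral>\<^sup>+\<omega>. ennreal (\<bar>air_average X h n \<omega> -
                (\<integral>x. h x \<partial>target \<nu> E ybar (mixture E \<mu>))\<bar>\<^sup>2) \<partial>M)
          \<le> 3 * ennreal (Q * max 1 \<alpha> + 1) * (lip_norm h)\<^sup>2 * ennreal ?rate" .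
  qed
qed

end
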